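(* Let $\mathcal{P}$ be a class of finite posets of bounded width. Then $\textsc{MC}(\mathcal{P},\mathcal{FO}(\exists,\wedge,\vee,\neg))$ is fixed-parameter tractable (with single exponential parameter dependence).
   Context: Posets are finite structures $(P,\le)$ with $\le$ reflexive, antisymmetric, transitive; width is the maximum size of an antichain, and a class has bounded width if a constant bounds the width of all members. $\mathcal{FO}(\exists,\wedge,\vee,\neg)$ denotes existential first-order sentences over the vocabulary $\{\le\}$ in prefix negation normal form (existential quantifier prefix, quantifier-free part built from atoms $x=y$, $x\le y$ and their negations using $\wedge,\vee$). $\textsc{MC}(\mathcal{P},\mathcal{L})$: given $\mathbf{P}\in\mathcal{P}$ and $\phi\in\mathcal{L}$, decide whether $\mathbf{P}\models\phi$, parameterized by the size of $\phi$. Fixed-parameter tractable: decidable in time $f(k)\cdot p(n)$ with $f$ computable, $p$ polynomial, $k$ the parameter, $n$ the input size. *)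

theory Defs
  imports "HOL-Computational_Algebra.Polynomial"
begin

section \<open>Finite posets and width\<close>

definition finite_poset :: "'a set \<Rightarrow> ('a \<times> 'a) set \<Rightarrow> bool" where
  "finite_poset A r \<longleftrightarrow> finite A \<and> partial_order_on A r"

definition antichain :: "'a set \<Rightarrow> ('a \<times> 'a) set \<Rightarrow> 'a set \<Rightarrow> bool" where
  "antichain A r S \<longleftrightarrow> S \<subseteq> A \<and> (\<forall>x\<in>S. \<forall>y\<in>S. x \<noteq> y \<longrightarrow> (x, y) \<notin> r)"

definition poset_width :: "'a set \<Rightarrow> ('a \<times> 'a) set \<Rightarrow> nat" where
  "poset_width A r = Max (card ` {S. antichain A r S})"

definition bounded_width :: "('a set \<times> ('a \<times> 'a) set) set \<Rightarrow> bool" where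
  "bounded_width C \<longleftrightarrow> (\<exists>w. \<forall>(A, r) \<in> C. poset_width A r \<le> w)"


section \<open>Existential first-order sentences over the vocabulary of posets\<close>

datatype atom = Equal nat nat | Leq nat nat

datatype matrix =
    Pos atom
  | Neg atom
  | Conj matrix matrix
  | Disj matrix matrix

text \<open>
  A formula is a pair of an existential quantifier prefix and a quantifier-free matrix in
  negation normal form; variables are natural numbers.
\<close>

type_synonym ex_formula = "nat list \<times> matrix"

primrec atom_vars :: "atom \<Rightarrow> nat set" where
  "atom_vars (Equal x y) = {x, y}"
| "atom_vars (Leq x y) = {x, y}"

primrec matrix_vars :: "matrix \<Rightarrow> nat set" where
  "matrix_vars (Pos a) = atom_vars a"
| "matrix_vars (Neg a) = atom_vars a"
| "matrix_vars (Conj m m') = matrix_vars m \<union> matrix_vars m'"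
| "matrix_vars (Disj m m') = matrix_vars m \<union> matrix_vars m'"

definition is_sentence :: "ex_formula \<Rightarrow> bool" where
  "is_sentence \<phi> \<longleftrightarrow> matrix_vars (snd \<phi>) \<subseteq> set (fst \<phi>)"

primrec sat_atom :: "('a \<times> 'a) set \<Rightarrow> (nat \<Rightarrow> 'a) \<Rightarrow> atom \<Rightarrow> bool" where
  "sat_atom r \<sigma> (Equal x y) \<longleftrightarrow> \<sigma> x = \<sigma> y"
| "sat_atom r \<sigma> (Leq x y) \<longleftrightarrow> (\<sigma> x, \<sigma> y) \<in> r"

primrec sat_matrix :: "('a \<times> 'a) set \<Rightarrow> (nat \<Rightarrow> 'a) \<Rightarrow> matrix \<Rightarrow> bool" where
  "sat_matrix r \<sigma> (Pos a) \<longleftrightarrow> sat_atom r \<sigma> a"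
| "sat_matrix r \<sigma> (Neg a) \<longleftrightarrow> \<not> sat_atom r \<sigma> a"
| "sat_matrix r \<sigma> (Conj m m') \<longleftrightarrow> sat_matrix r \<sigma> m \<and> sat_matrix r \<sigma> m'"
| "sat_matrix r \<sigma> (Disj m m') \<longleftrightarrow> sat_matrix r \<sigma> m \<or> sat_matrix r \<sigma> m'"

primrec sat_prefix ::
  "'a set \<Rightarrow> ('a \<times> 'a) set \<Rightarrow> matrix \<Rightarrow> nat list \<Rightarrow> (nat \<Rightarrow> 'a) \<Rightarrow> bool" where
  "sat_prefix A r m [] \<sigma> \<longleftrightarrow> sat_matrix r \<sigma> m"
| "sat_prefix A r m (v # vs) \<sigma> \<longleftrightarrow> (\<exists>a\<in>A. sat_prefix A r m vs (\<sigma>(v := a)))"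

text \<open>The initial assignment is irrelevant when the formula is a sentence.\<close>

definition models :: "'a set \<Rightarrow> ('a \<times> 'a) set \<Rightarrow> ex_formula \<Rightarrow> bool" where
  "models A r \<phi> \<longleftrightarrow> sat_prefix A r (snd \<phi>) (fst \<phi>) (\<lambda>_. undefined)"


section \<open>Random access machines\<close>

text \<open>
  Random access machines with the uniform cost measure, over registers holding natural numbers.
  The arithmetic operations are addition, truncated subtraction and halving; there is no
  multiplication, so a register value at most doubles per step and the model is polynomially
  equivalent to Turing machines. The input is a read-only binary word with random access.
\<close>

datatype instr =
    Const nat nat
  | Move nat nat
  | Load nat nat
  | Store nat nat
  | Add nat nat nat
  | Sub nat nat nat
  | Half nat nat
  | Read nat nat
  | Jump nat
  | JumpZero nat nat

type_synonym ram = "instr list"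
type_synonym config = "nat \<times> (nat \<Rightarrow> nat)"

primrec exec :: "bool list \<Rightarrow> instr \<Rightarrow> config \<Rightarrow> config" where
  "exec w (Const i c) s = (Suc (fst s), (snd s)(i := c))"
| "exec w (Move i j) s = (Suc (fst s), (snd s)(i := snd s j))"
| "exec w (Load i j) s = (Suc (fst s), (snd s)(i := snd s (snd s j)))"
| "exec w (Store i j) s = (Suc (fst s), (snd s)(snd s i := snd s j))"
| "exec w (Add i j k) s = (Suc (fst s), (snd s)(i := snd s j + snd s k))"
| "exec w (Sub i j k) s = (Suc (fst s), (snd s)(i := snd s j - snd s k))"
| "exec w (Half i j) s = (Suc (fst s), (snd s)(i := snd s j div 2))"
| "exec w (Read i j) s =
     (Suc (fst s), (snd s)(i := of_bool (snd s j < length w \<and> w ! (snd s j))))"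
| "exec w (Jump l) s = (l, snd s)"
| "exec w (JumpZero i l) s = ((if snd s i = 0 then l else Suc (fst s)), snd s)"

text \<open>
  The machine halts when the program counter leaves the program; a halted configuration is a
  fixed point of the step function.
\<close>

definition step :: "ram \<Rightarrow> bool list \<Rightarrow> config \<Rightarrow> config" where
  "step M w s = (if fst s < length M then exec w (M ! fst s) s else s)"

text \<open>Register 0 initially holds the length of the input and finally the output.\<close>

definition initial :: "bool list \<Rightarrow> config" where
  "initial w = (0, (\<lambda>_. 0)(0 := length w))"

definition outputs_within :: "ram \<Rightarrow> bool list \<Rightarrow> nat \<Rightarrow> nat \<Rightarrow> bool" where
  "outputs_within M w t out \<longleftrightarrow>
     (let s = (step M w ^^ t) (initial w) in length M \<le> fst s \<and> snd s 0 = out)"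

text \<open>Arguments of number-theoretic functions are given in unary.\<close>

definition computable :: "(nat \<Rightarrow> nat) \<Rightarrow> bool" where
  "computable f \<longleftrightarrow> (\<exists>M. \<forall>k. \<exists>t. outputs_within M (replicate k True) t (f k))"


section \<open>Parameterized problems and fixed-parameter tractability\<close>

text \<open>
  Problems are promise problems: an algorithm is only required to behave correctly on
  (encodings of) the instances of the problem.
\<close>

record 'i param_problem =
  instances :: "'i set"
  encoding :: "'i \<Rightarrow> bool list"
  parameter :: "'i \<Rightarrow> nat"
  yes_instance :: "'i \<Rightarrow> bool"

definition decidable_in_time ::
  "'i param_problem \<Rightarrow> (nat \<Rightarrow> nat) \<Rightarrow> nat poly \<Rightarrow> bool" where
  "decidable_in_time Q f p \<longleftrightarrow>
     (\<exists>M. \<forall>i \<in> instances Q.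
        outputs_within M (encoding Q i)
          (f (parameter Q i) * poly p (length (encoding Q i)))
          (of_bool (yes_instance Q i)))"

definition fpt :: "'i param_problem \<Rightarrow> bool" where
  "fpt Q \<longleftrightarrow> (\<exists>f p. computable f \<and> decidable_in_time Q f p)"

text \<open>Parameter dependence \<open>2\<^sup>O\<^sup>(\<^sup>k\<^sup>)\<close>.\<close>

definition single_exponential :: "(nat \<Rightarrow> nat) \<Rightarrow> bool" where
  "single_exponential f \<longleftrightarrow> (\<exists>c. \<forall>\<^sub>F k in sequentially. f k \<le> 2 ^ (c * k))"

definition fpt_single_exponential :: "'i param_problem \<Rightarrow> bool" where
  "fpt_single_exponential Q \<longleftrightarrow>
     (\<exists>f p. computable f \<and> single_exponential f \<and> decidable_in_time Q f p)"

lemma fpt_single_exponential_imp_fpt: "fpt_single_exponential Q \<Longrightarrow> fpt Q"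
  unfolding fpt_def fpt_single_exponential_def by blast


section \<open>Model checking\<close>

text \<open>
  Self-delimiting binary code of a number: each binary digit, least significant first, is
  preceded by \<open>True\<close>, and \<open>False\<close> ends the code.
\<close>

fun enc_nat :: "nat \<Rightarrow> bool list" where
  "enc_nat n = (if n = 0 then [False] else True # odd n # enc_nat (n div 2))"

declare enc_nat.simps [simp del]

primrec enc_atom :: "atom \<Rightarrow> bool list" where
  "enc_atom (Equal x y) = False # enc_nat x @ enc_nat y"
| "enc_atom (Leq x y) = True # enc_nat x @ enc_nat y"

primrec enc_matrix :: "matrix \<Rightarrow> bool list" where
  "enc_matrix (Pos a) = [False, True] @ enc_atom a"
| "enc_matrix (Neg a) = [False, False] @ enc_atom a"
| "enc_matrix (Conj m m') = [True, True] @ enc_matrix m @ enc_matrix m'"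
| "enc_matrix (Disj m m') = [True, False] @ enc_matrix m @ enc_matrix m'"

definition enc_formula :: "ex_formula \<Rightarrow> bool list" where
  "enc_formula \<phi> =
     concat (map (\<lambda>v. True # enc_nat v) (fst \<phi>)) @ [False] @ enc_matrix (snd \<phi>)"

text \<open>
  A finite poset is presented by an enumeration of its universe: its size in unary followed by
  the adjacency matrix of the order, row by row.
\<close>

definition enc_poset :: "'a list \<Rightarrow> ('a \<times> 'a) set \<Rightarrow> bool list" where
  "enc_poset xs r =
     replicate (length xs) True @ [False] @ map (\<lambda>e. e \<in> r) (List.product xs xs)"

text \<open>
  An instance \<open>(xs, r, \<phi>)\<close> consists of a poset of the class, together with an arbitrary
  enumeration \<open>xs\<close> of its universe, and an existential sentence. The parameter is the size of
  the sentence, i.e. the length of its binary encoding.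
\<close>

definition MC ::
  "('a set \<times> ('a \<times> 'a) set) set \<Rightarrow> ('a list \<times> ('a \<times> 'a) set \<times> ex_formula) param_problem" where
  "MC C = \<lparr>
     instances = {(xs, r, \<phi>). distinct xs \<and> (set xs, r) \<in> C \<and> is_sentence \<phi>},
     encoding = (\<lambda>(xs, r, \<phi>). enc_poset xs r @ enc_formula \<phi>),
     parameter = (\<lambda>(xs, r, \<phi>). length (enc_formula \<phi>)),
     yes_instance = (\<lambda>(xs, r, \<phi>). models (set xs) r \<phi>)\<rparr>"

end

(*
  The parameter is the binary length k of the sentence, so 2^O(k) guesses may be tried one after
  another. A guess picks a disjunct of every disjunction, a direction of every inequation, and,
  for every variable, a chain of a fixed partition of the poset into at most w chains. What
  remains is a conjunction of constraints x <= y and not x <= y over variables ranging over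
  chains. Such constraints are closed under componentwise minimum, so starting from the bottom
  of the chains and moving a variable up whenever a constraint forces it yields the least
  solution, if there is one, after at most n moves per variable.

  A minimum chain partition is computed by an auction: an element without successor takes
  the strictly larger element of least label, evicting its previous predecessor, and
  increments that label. When all labels still on offer exceed n, a value missing among the labels
  separates off an antichain with as many elements as there are chains.

  Machine code is compiled from a loop language with total semantics, whose running time is
  bounded statically because loop counters are never modified inside the loop.
*)
theory Submission
  imports Defs
begin

section \<open>A loop language and its compilation to random access machines\<close>

text \<open>Componentwise minima preserve neither \<open>x \<noteq> y\<close> nor disjunctions, and
  exactly these choices are guessed; a fixed chain for each variable is what makes the minima exist.
  Every prefix variable and every matrix node costs at least one bit of the encoding, so both
  numbers are at most k. With C bits for the chain of a variable and one bit for a node, (C + 1) k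
  bits are enough, which is the exponent of the bound. Almost no phase of the program detects its
  own end. It is repeated as often as a register known beforehand says, usually the input length N:
  the auction needs at most n (n + 1) < N rounds, the bumping at most N N passes. Each step is
  therefore written so that surplus rounds leave a finished result alone, and the proofs only have
  to show that there are enough rounds.\<close>

type_synonym state = "nat \<times> nat \<Rightarrow> nat"

datatype expr = Num nat | At nat expr | Plus expr expr | Minus expr expr | Halve expr | Inp expr

datatype cmd = Skip | Assign nat expr expr | Seq cmd cmd (infixr \<open>;;\<close> 60)
  | Cond expr cmd cmd | Loop nat cmd

definition input_at :: "bool list \<Rightarrow> nat \<Rightarrow> nat" where
  "input_at w p = of_bool (p < length w \<and> w ! p)"

primrec eval_expr :: "bool list \<Rightarrow> expr \<Rightarrow> state \<Rightarrow> nat" where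
  "eval_expr w (Num c) s = c"
| "eval_expr w (At a e) s = s (a, eval_expr w e s)"
| "eval_expr w (Plus e f) s = eval_expr w e s + eval_expr w f s"
| "eval_expr w (Minus e f) s = eval_expr w e s - eval_expr w f s"
| "eval_expr w (Halve e) s = eval_expr w e s div 2"
| "eval_expr w (Inp e) s = input_at w (eval_expr w e s)"

text \<open>A loop reads its counter once, on entry, so every command terminates whatever its body
  does to that cell.\<close>

primrec sem :: "bool list \<Rightarrow> cmd \<Rightarrow> state \<Rightarrow> state" where
  "sem w Skip s = s"
| "sem w (Assign a e f) s = s((a, eval_expr w e s) := eval_expr w f s)"
| "sem w (c ;; c') s = sem w c' (sem w c s)"
| "sem w (Cond e c c') s = (if eval_expr w e s = 0 then sem w c' s else sem w c s)"
| "sem w (Loop i c) s = (sem w c ^^ s (0, i)) s"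

primrec expr_len :: "expr \<Rightarrow> nat" where
  "expr_len (Num c) = 1"
| "expr_len (At a e) = expr_len e + 6"
| "expr_len (Plus e f) = expr_len e + expr_len f + 1"
| "expr_len (Minus e f) = expr_len e + expr_len f + 1"
| "expr_len (Halve e) = expr_len e + 1"
| "expr_len (Inp e) = expr_len e + 1"

primrec cmd_len :: "cmd \<Rightarrow> nat" where
  "cmd_len Skip = 0"
| "cmd_len (Assign a e f) = expr_len e + expr_len f + 6"
| "cmd_len (c ;; c') = cmd_len c + cmd_len c'"
| "cmd_len (Cond e c c') = expr_len e + cmd_len c + cmd_len c' + 2"
| "cmd_len (Loop i c) = cmd_len c + 5"

text \<open>The exact number of machine steps of the compiled code. For a \<open>Loop\<close>, 2
  pays for copying the counter and for the last test; 4 pays for the test, the two instructions of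
  the decrement and the jump of each round.\<close>

primrec cost :: "bool list \<Rightarrow> cmd \<Rightarrow> state \<Rightarrow> nat" where
  "cost w Skip s = 0"
| "cost w (Assign a e f) s = expr_len e + expr_len f + 6"
| "cost w (c ;; c') s = cost w c s + cost w c' (sem w c s)"
| "cost w (Cond e c c') s =
     expr_len e + 1 + (if eval_expr w e s = 0 then cost w c' s else cost w c s + 1)"
| "cost w (Loop i c) s = 2 + (\<Sum>j<s (0, i). cost w c ((sem w c ^^ j) s) + 4)"

text \<open>
  Cell \<open>i\<close> of array \<open>a < 8\<close> lives in register \<open>8 * i + a\<close>; array 1 is reserved for the
  temporaries and loop counters, which form a stack whose height is known statically.
\<close>

definition tmp :: "nat \<Rightarrow> nat" where
  "tmp d = 8 * d + 1"

lemma tmp_eq_iff [simp]: "tmp d = tmp d' \<longleftrightarrow> d = d'"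
  by (simp add: tmp_def)

lemma cell_neq_tmp: "a < 8 \<Longrightarrow> a \<noteq> 1 \<Longrightarrow> 8 * i + a \<noteq> tmp d"
  unfolding tmp_def by presburger

lemma cell_eq_iff: "a < 8 \<Longrightarrow> b < 8 \<Longrightarrow> 8 * i + a = 8 * j + b \<longleftrightarrow> i = j \<and> a = b" for i j :: nat
  by (metis add.commute add_left_imp_eq div_less div_mult_self2 mod_less mod_mult_self2
      mult_cancel1 zero_neq_numeral)

text \<open>Without multiplication, the factor 8 is obtained by three doublings.\<close>

definition index_code :: "nat \<Rightarrow> nat \<Rightarrow> ram" where
  "index_code a d = replicate 3 (Add (tmp d) (tmp d) (tmp d)) @
     [Const (tmp (Suc d)) a, Add (tmp d) (tmp d) (tmp (Suc d))]"

text \<open>The result is left in \<open>tmp d\<close>, and only temporaries of level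
  \<open>d\<close> and above are written.\<close>

primrec expr_code :: "expr \<Rightarrow> nat \<Rightarrow> ram" where
  "expr_code (Num c) d = [Const (tmp d) c]"
| "expr_code (At a e) d = expr_code e d @ index_code a d @ [Load (tmp d) (tmp d)]"
| "expr_code (Plus e f) d =
     expr_code e d @ expr_code f (Suc d) @ [Add (tmp d) (tmp d) (tmp (Suc d))]"
| "expr_code (Minus e f) d =
     expr_code e d @ expr_code f (Suc d) @ [Sub (tmp d) (tmp d) (tmp (Suc d))]"
| "expr_code (Halve e) d = expr_code e d @ [Half (tmp d) (tmp d)]"
| "expr_code (Inp e) d = expr_code e d @ [Read (tmp d) (tmp d)]"

text \<open>Jump targets are absolute, hence the argument \<open>pos\<close>, the address at which
  the code will be placed.\<close>

primrec cmd_code :: "cmd \<Rightarrow> nat \<Rightarrow> nat \<Rightarrow> ram" where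
  "cmd_code Skip pos d = []"
| "cmd_code (Assign a e f) pos d =
     expr_code e d @ index_code a d @ expr_code f (Suc d) @ [Store (tmp d) (tmp (Suc d))]"
| "cmd_code (c ;; c') pos d = cmd_code c pos d @ cmd_code c' (pos + cmd_len c) d"
| "cmd_code (Cond e c c') pos d =
     (let q = pos + expr_len e + 1; r = q + cmd_len c + 1 in
      expr_code e d @ [JumpZero (tmp d) r] @ cmd_code c q d @ [Jump (r + cmd_len c')] @
      cmd_code c' r d)"
| "cmd_code (Loop i c) pos d =
     [Move (tmp d) (8 * i), JumpZero (tmp d) (pos + cmd_len c + 5)] @
     cmd_code c (pos + 2) (Suc d) @
     [Const (tmp (Suc d)) 1, Sub (tmp d) (tmp d) (tmp (Suc d)), Jump (pos + 1)]"

primrec wf_expr :: "expr \<Rightarrow> bool" where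
  "wf_expr (Num c) \<longleftrightarrow> True"
| "wf_expr (At a e) \<longleftrightarrow> a < 8 \<and> a \<noteq> 1 \<and> wf_expr e"
| "wf_expr (Plus e f) \<longleftrightarrow> wf_expr e \<and> wf_expr f"
| "wf_expr (Minus e f) \<longleftrightarrow> wf_expr e \<and> wf_expr f"
| "wf_expr (Halve e) \<longleftrightarrow> wf_expr e"
| "wf_expr (Inp e) \<longleftrightarrow> wf_expr e"

primrec wf_cmd :: "cmd \<Rightarrow> bool" where
  "wf_cmd Skip \<longleftrightarrow> True"
| "wf_cmd (Assign a e f) \<longleftrightarrow> a < 8 \<and> a \<noteq> 1 \<and> wf_expr e \<and> wf_expr f"
| "wf_cmd (c ;; c') \<longleftrightarrow> wf_cmd c \<and> wf_cmd c'"
| "wf_cmd (Cond e c c') \<longleftrightarrow> wf_expr e \<and> wf_cmd c \<and> wf_cmd c'"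
| "wf_cmd (Loop i c) \<longleftrightarrow> wf_cmd c"

lemma length_expr_code [simp]: "length (expr_code e d) = expr_len e"
  by (induction e arbitrary: d) (auto simp: index_code_def)

lemma length_cmd_code [simp]: "length (cmd_code c pos d) = cmd_len c"
  by (induction c arbitrary: pos d) (auto simp: index_code_def Let_def)

section \<open>Simulation of loop programs by machine steps\<close>

definition represents :: "state \<Rightarrow> (nat \<Rightarrow> nat) \<Rightarrow> bool" where
  "represents s \<mu> \<longleftrightarrow> (\<forall>a<8. a \<noteq> 1 \<longrightarrow> (\<forall>i. \<mu> (8 * i + a) = s (a, i)))"

definition frame_eq :: "nat \<Rightarrow> (nat \<Rightarrow> nat) \<Rightarrow> (nat \<Rightarrow> nat) \<Rightarrow> bool" where
  "frame_eq d \<mu> \<mu>' \<longleftrightarrow> (\<forall>l. (\<forall>t\<ge>d. l \<noteq> tmp t) \<longrightarrow> \<mu>' l = \<mu> l)"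

lemma frame_eq_refl: "frame_eq d \<mu> \<mu>"
  by (simp add: frame_eq_def)

lemma frame_eq_trans: "frame_eq d \<mu> \<mu>' \<Longrightarrow> frame_eq d' \<mu>' \<mu>'' \<Longrightarrow> d \<le> d' \<Longrightarrow> frame_eq d \<mu> \<mu>''"
  unfolding frame_eq_def by (metis order_trans)

lemma frame_eq_upd: "d \<le> d' \<Longrightarrow> frame_eq d \<mu> \<mu>' \<Longrightarrow> frame_eq d \<mu> (\<mu>'(tmp d' := x))"
  by (auto simp: frame_eq_def)

lemma represents_frame: "represents s \<mu> \<Longrightarrow> frame_eq d \<mu> \<mu>' \<Longrightarrow> represents s \<mu>'"
  unfolding represents_def frame_eq_def using cell_neq_tmp by metis

lemma frame_eq_tmp: "frame_eq d \<mu> \<mu>' \<Longrightarrow> t < d \<Longrightarrow> \<mu>' (tmp t) = \<mu> (tmp t)"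
  by (auto simp: frame_eq_def)

text \<open>The effect of an instruction on the registers is independent of the program counter,
  which is therefore fixed to 0.\<close>

definition mem_effect :: "bool list \<Rightarrow> ram \<Rightarrow> (nat \<Rightarrow> nat) \<Rightarrow> (nat \<Rightarrow> nat)" where
  "mem_effect w is \<mu> = fold (\<lambda>i m. snd (exec w i (0, m))) is \<mu>"

lemma mem_effect_simps [simp]:
  "mem_effect w [] \<mu> = \<mu>"
  "mem_effect w (i # is) \<mu> = mem_effect w is (snd (exec w i (0, \<mu>)))"
  "mem_effect w (is @ js) \<mu> = mem_effect w js (mem_effect w is \<mu>)"
  by (simp_all add: mem_effect_def)

primrec no_jump :: "instr \<Rightarrow> bool" where
  "no_jump (Const i c) = True"
| "no_jump (Move i j) = True"
| "no_jump (Load i j) = True"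
| "no_jump (Store i j) = True"
| "no_jump (Add i j k) = True"
| "no_jump (Sub i j k) = True"
| "no_jump (Half i j) = True"
| "no_jump (Read i j) = True"
| "no_jump (Jump l) = False"
| "no_jump (JumpZero i l) = False"

definition code_at :: "ram \<Rightarrow> nat \<Rightarrow> ram \<Rightarrow> bool" where
  "code_at M pos is \<longleftrightarrow> pos + length is \<le> length M \<and> (\<forall>i<length is. M ! (pos + i) = is ! i)"

lemma code_at_append:
  "code_at M pos (is @ js) \<longleftrightarrow> code_at M pos is \<and> code_at M (pos + length is) js"
proof
  assume *: "code_at M pos (is @ js)"
  have "M ! (pos + length is + i) = js ! i" if "i < length js" for i
    using * that by (auto simp: code_at_def add.assoc dest!: spec[of _ "length is + i"])
  moreover have "M ! (pos + i) = is ! i" if "i < length is" for i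
    using * that by (auto simp: code_at_def nth_append dest!: spec[of _ i])
  ultimately show "code_at M pos is \<and> code_at M (pos + length is) js"
    using * by (simp add: code_at_def)
next
  assume *: "code_at M pos is \<and> code_at M (pos + length is) js"
  have "M ! (pos + i) = (is @ js) ! i" if "i < length is + length js" for i
  proof (cases "i < length is")
    case True
    then show ?thesis
      using * by (simp add: code_at_def nth_append)
  next
    case False
    then show ?thesis
      using * that by (auto simp: code_at_def nth_append dest!: spec[of _ "i - length is"])
  qed
  then show "code_at M pos (is @ js)"
    using * by (simp add: code_at_def)
qed

lemma code_at_Cons:
  "code_at M pos (i # is) \<longleftrightarrow> code_at M pos [i] \<and> code_at M (Suc pos) is"
  using code_at_append[of M pos "[i]" "is"] by simp

text \<open>Unlike \<open>code_at_Cons\<close>, this terminates as a rewrite rule, because its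
  right-hand side contains a one-instruction list that no longer matches.\<close>

lemma code_at_Cons_Cons:
  "code_at M pos (i # j # is) \<longleftrightarrow> code_at M pos [i] \<and> code_at M (Suc pos) (j # is)"
  by (rule code_at_Cons)

lemma code_at_single: "code_at M pos [i] \<Longrightarrow> step M w (pos, \<mu>) = exec w i (pos, \<mu>)"
  by (auto simp: code_at_def step_def)

lemma step_straight:
  assumes "code_at M pos is" "\<forall>i\<in>set is. no_jump i"
  shows "(step M w ^^ length is) (pos, \<mu>) = (pos + length is, mem_effect w is \<mu>)"
  using assms
proof (induction "is" arbitrary: pos \<mu>)
  case (Cons i js)
  have "code_at M pos [i]"
    using Cons.prems(1) by (simp add: code_at_Cons[of _ _ _ js])
  then have "step M w (pos, \<mu>) = (Suc pos, snd (exec w i (0, \<mu>)))"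
    using Cons.prems(2) by (cases i) (auto simp: code_at_single)
  moreover have "code_at M (Suc pos) js"
    using Cons.prems(1) code_at_Cons by blast
  ultimately show ?case
    using Cons by (simp add: funpow_swap1)
qed simp

lemma no_jump_expr_code: "\<forall>i\<in>set (expr_code e d). no_jump i"
  by (induction e arbitrary: d) (auto simp: index_code_def)

lemma mem_effect_index:
  "mem_effect w (index_code a d) \<mu> = \<mu>(tmp d := 8 * \<mu> (tmp d) + a, tmp (Suc d) := a)"
  by (auto simp: index_code_def numeral_3_eq_3)

text \<open>The left operand survives in \<open>tmp d\<close> because the right one is evaluated at
  level \<open>Suc d\<close>.\<close>

lemma mem_effect_expr:
  assumes "represents s \<mu>" "wf_expr e"
  shows "mem_effect w (expr_code e d) \<mu> (tmp d) = eval_expr w e s \<and>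
    frame_eq d \<mu> (mem_effect w (expr_code e d) \<mu>)"
  using assms
proof (induction e arbitrary: d \<mu>)
  case (Num c)
  then show ?case
    using frame_eq_upd[OF order_refl frame_eq_refl, of d \<mu> c] by (simp add: fun_upd_def)
next
  case (At a e)
  let ?\<mu> = "mem_effect w (expr_code e d) \<mu>"
  have IH: "?\<mu> (tmp d) = eval_expr w e s" "frame_eq d \<mu> ?\<mu>"
    using At by auto
  have "?\<mu> (8 * eval_expr w e s + a) = s (a, eval_expr w e s)"
    using represents_frame[OF At.prems(1) IH(2)] At.prems(2) by (simp add: represents_def)
  moreover have "8 * eval_expr w e s + a \<noteq> tmp d'" for d'
    using At.prems(2) by (simp add: cell_neq_tmp)
  ultimately have "mem_effect w (expr_code (At a e) d) \<mu> =
      ?\<mu>(tmp d := 8 * eval_expr w e s + a, tmp (Suc d) := a, tmp d := s (a, eval_expr w e s))"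
    using IH(1) by (simp add: mem_effect_index)
  moreover have "frame_eq d \<mu> (?\<mu>(tmp d := 8 * eval_expr w e s + a, tmp (Suc d) := a,
      tmp d := s (a, eval_expr w e s)))"
    using IH(2) by (intro frame_eq_upd) simp_all
  ultimately show ?case
    by (simp only: fun_upd_same eval_expr.simps simp_thms)
next
  case (Plus e f)
  let ?\<mu> = "mem_effect w (expr_code e d) \<mu>"
  let ?\<mu>' = "mem_effect w (expr_code f (Suc d)) ?\<mu>"
  have 1: "?\<mu> (tmp d) = eval_expr w e s" "frame_eq d \<mu> ?\<mu>"
    using Plus by auto
  have 2: "?\<mu>' (tmp (Suc d)) = eval_expr w f s" "frame_eq (Suc d) ?\<mu> ?\<mu>'"
    using Plus represents_frame[OF _ 1(2)] by auto
  have "frame_eq d \<mu> (?\<mu>'(tmp d := x))" for x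
    using frame_eq_trans[OF 1(2) 2(2)] by (simp only: frame_eq_upd le_simps)
  then show ?case
    using 1 2 frame_eq_tmp[OF 2(2), of d] by (simp add: fun_upd_def)
next
  case (Minus e f)
  let ?\<mu> = "mem_effect w (expr_code e d) \<mu>"
  let ?\<mu>' = "mem_effect w (expr_code f (Suc d)) ?\<mu>"
  have 1: "?\<mu> (tmp d) = eval_expr w e s" "frame_eq d \<mu> ?\<mu>"
    using Minus by auto
  have 2: "?\<mu>' (tmp (Suc d)) = eval_expr w f s" "frame_eq (Suc d) ?\<mu> ?\<mu>'"
    using Minus represents_frame[OF _ 1(2)] by auto
  have "frame_eq d \<mu> (?\<mu>'(tmp d := x))" for x
    using frame_eq_trans[OF 1(2) 2(2)] by (simp only: frame_eq_upd le_simps)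
  then show ?case
    using 1 2 frame_eq_tmp[OF 2(2), of d] by (simp add: fun_upd_def)
next
  case (Halve e)
  then have "frame_eq d \<mu> ((mem_effect w (expr_code e d) \<mu>)(tmp d := x))" for x
    by (intro frame_eq_upd) auto
  then show ?case
    using Halve by (simp add: fun_upd_def)
next
  case (Inp e)
  then have "frame_eq d \<mu> ((mem_effect w (expr_code e d) \<mu>)(tmp d := x))" for x
    by (intro frame_eq_upd) auto
  then show ?case
    using Inp by (simp add: fun_upd_def input_at_def)
qed

lemma step_expr:
  assumes "code_at M pos (expr_code e d)" "represents s \<mu>" "wf_expr e"
  shows "\<exists>\<mu>'. (step M w ^^ expr_len e) (pos, \<mu>) = (pos + expr_len e, \<mu>') \<and>
    \<mu>' (tmp d) = eval_expr w e s \<and> frame_eq d \<mu> \<mu>' \<and> represents s \<mu>'"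
  using step_straight[OF assms(1) no_jump_expr_code, of w \<mu>] mem_effect_expr[OF assms(2,3), of w d]
    represents_frame[OF assms(2)] by auto

lemma funpow_add_apply: "(f ^^ (a + b)) x = (f ^^ b) ((f ^^ a) x)"
  by (metis add.commute comp_apply funpow_add)

text \<open>Preservation of the temporaries below \<open>d\<close> is what the induction needs for
  loops: the counters of all enclosing loops live there.\<close>

lemma step_cmd:
  assumes "code_at M pos (cmd_code c pos d)" "represents s \<mu>" "wf_cmd c"
  shows "\<exists>\<mu>'. (step M w ^^ cost w c s) (pos, \<mu>) = (pos + cmd_len c, \<mu>') \<and>
    represents (sem w c s) \<mu>' \<and> (\<forall>t<d. \<mu>' (tmp t) = \<mu> (tmp t))"
  using assms
proof (induction c arbitrary: pos d s \<mu>)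
  case Skip
  then show ?case
    by simp
next
  case (Assign a e f)
  let ?is = "cmd_code (Assign a e f) pos d"
  define \<mu>1 where "\<mu>1 = mem_effect w (expr_code e d) \<mu>"
  define \<mu>2 where "\<mu>2 = mem_effect w (index_code a d) \<mu>1"
  define \<mu>3 where "\<mu>3 = mem_effect w (expr_code f (Suc d)) \<mu>2"
  have wf: "a < 8" "a \<noteq> 1" "wf_expr e" "wf_expr f"
    using Assign.prems(3) by auto
  have 1: "\<mu>1 (tmp d) = eval_expr w e s" "frame_eq d \<mu> \<mu>1"
    using mem_effect_expr[OF Assign.prems(2) wf(3)] by (auto simp: \<mu>1_def)
  have \<mu>2: "\<mu>2 = \<mu>1(tmp d := 8 * eval_expr w e s + a, tmp (Suc d) := a)"
    using 1(1) by (simp add: \<mu>2_def mem_effect_index)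
  have 2: "\<mu>2 (tmp d) = 8 * eval_expr w e s + a" "frame_eq d \<mu> \<mu>2"
    using 1(2) by (simp_all only: \<mu>2) (simp_all add: frame_eq_upd)
  have 3: "\<mu>3 (tmp (Suc d)) = eval_expr w f s" "frame_eq (Suc d) \<mu>2 \<mu>3"
    using mem_effect_expr[OF represents_frame[OF Assign.prems(2) 2(2)] wf(4)]
    by (auto simp: \<mu>3_def)
  have 4: "\<mu>3 (tmp d) = 8 * eval_expr w e s + a" "frame_eq d \<mu> \<mu>3"
    using 2 3 frame_eq_tmp[OF 3(2), of d] frame_eq_trans[OF 2(2) 3(2)] by auto
  have fin: "mem_effect w ?is \<mu> = \<mu>3(8 * eval_expr w e s + a := eval_expr w f s)"
    using 3(1) 4(1) by (simp add: \<mu>1_def \<mu>2_def \<mu>3_def)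
  have "\<forall>i\<in>set ?is. no_jump i"
    using no_jump_expr_code by (auto simp: index_code_def)
  from step_straight[OF Assign.prems(1) this, of w \<mu>]
  have "(step M w ^^ cost w (Assign a e f) s) (pos, \<mu>) = (pos + cmd_len (Assign a e f), mem_effect w ?is \<mu>)"
    by (simp only: length_cmd_code cost.simps cmd_len.simps)
  moreover have "represents s \<mu>3"
    using represents_frame[OF Assign.prems(2) 4(2)] .
  then have "represents (sem w (Assign a e f) s) (mem_effect w ?is \<mu>)"
    unfolding fin represents_def sem.simps
    using wf(1) cell_eq_iff by auto
  moreover have "\<forall>t<d. mem_effect w ?is \<mu> (tmp t) = \<mu> (tmp t)"
  proof -
    have "8 * eval_expr w e s + a \<noteq> tmp t" for t
      using wf(1,2) by (rule cell_neq_tmp)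
    then show ?thesis
      using 4(2) unfolding fin by (metis frame_eq_tmp fun_upd_other)
  qed
  ultimately show ?case
    by blast
next
  case (Seq c c')
  have c: "code_at M pos (cmd_code c pos d)" "code_at M (pos + cmd_len c) (cmd_code c' (pos + cmd_len c) d)"
    using Seq.prems(1) by (auto simp: code_at_append)
  obtain \<mu>1 where 1: "(step M w ^^ cost w c s) (pos, \<mu>) = (pos + cmd_len c, \<mu>1)"
    "represents (sem w c s) \<mu>1" "\<forall>t<d. \<mu>1 (tmp t) = \<mu> (tmp t)"
    using Seq.IH(1)[OF c(1) Seq.prems(2)] Seq.prems(3) by auto
  obtain \<mu>2 where 2: "(step M w ^^ cost w c' (sem w c s)) (pos + cmd_len c, \<mu>1) =
      (pos + cmd_len c + cmd_len c', \<mu>2)"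
    "represents (sem w c' (sem w c s)) \<mu>2" "\<forall>t<d. \<mu>2 (tmp t) = \<mu>1 (tmp t)"
    using Seq.IH(2)[OF c(2) 1(2)] Seq.prems(3) by auto
  show ?case
    using 1 2 by (intro exI[of _ \<mu>2]) (simp add: funpow_add_apply)
next
  case (Cond e c c')
  define q where "q = pos + expr_len e + 1"
  define r where "r = q + cmd_len c + 1"
  have c: "code_at M pos (expr_code e d)" "code_at M (pos + expr_len e) [JumpZero (tmp d) r]"
    "code_at M q (cmd_code c q d)" "code_at M (q + cmd_len c) [Jump (r + cmd_len c')]"
    "code_at M r (cmd_code c' r d)"
    using Cond.prems(1)
    by (auto simp: q_def r_def Let_def code_at_append code_at_Cons[of _ _ _ "_ @ _"] code_at_Cons[of _ _ _ "cmd_code _ _ _"])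
  obtain \<mu>1 where 1: "(step M w ^^ expr_len e) (pos, \<mu>) = (pos + expr_len e, \<mu>1)"
    "\<mu>1 (tmp d) = eval_expr w e s" "frame_eq d \<mu> \<mu>1" "represents s \<mu>1"
    using step_expr[OF c(1) Cond.prems(2), of w] Cond.prems(3) by auto
  note jz = code_at_single[OF c(2), of w \<mu>1]
  show ?case
  proof (cases "eval_expr w e s = 0")
    case True
    obtain \<mu>2 where 2: "(step M w ^^ cost w c' s) (r, \<mu>1) = (r + cmd_len c', \<mu>2)"
      "represents (sem w c' s) \<mu>2" "\<forall>t<d. \<mu>2 (tmp t) = \<mu>1 (tmp t)"
      using Cond.IH(2)[OF c(5) 1(4)] Cond.prems(3) by auto
    have "(step M w ^^ cost w (Cond e c c') s) (pos, \<mu>) = (pos + cmd_len (Cond e c c'), \<mu>2)"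
      using True 1 2 jz unfolding cost.simps funpow_add_apply
      by (simp add: q_def r_def)
    then show ?thesis
      using True 2 1(3) by (intro exI[of _ \<mu>2]) (simp add: frame_eq_tmp)
  next
    case False
    obtain \<mu>2 where 2: "(step M w ^^ cost w c s) (q, \<mu>1) = (q + cmd_len c, \<mu>2)"
      "represents (sem w c s) \<mu>2" "\<forall>t<d. \<mu>2 (tmp t) = \<mu>1 (tmp t)"
      using Cond.IH(1)[OF c(3) 1(4)] Cond.prems(3) by auto
    note j = code_at_single[OF c(4), of w \<mu>2]
    have "(step M w ^^ cost w (Cond e c c') s) (pos, \<mu>) = (pos + cmd_len (Cond e c c'), \<mu>2)"
      using False 1 2 jz j unfolding cost.simps funpow_add_apply
      by (simp add: q_def r_def)
    then show ?thesis
      using False 2 1(3) by (intro exI[of _ \<mu>2]) (simp add: frame_eq_tmp)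
  qed
next
  case (Loop i c)
  define q where "q = pos + 2 + cmd_len c"
  have c: "code_at M pos [Move (tmp d) (8 * i)]" "code_at M (Suc pos) [JumpZero (tmp d) (q + 3)]"
    "code_at M (pos + 2) (cmd_code c (pos + 2) (Suc d))"
    "code_at M q [Const (tmp (Suc d)) 1]" "code_at M (q + 1) [Sub (tmp d) (tmp d) (tmp (Suc d))]"
    "code_at M (q + 2) [Jump (pos + 1)]"
    using Loop.prems(1)
    by (simp_all only: cmd_code.simps code_at_append code_at_Cons_Cons list.size length_cmd_code q_def)
      (simp_all add: numeral_eq_Suc)
  define m where "m = s (0, i)"
  define \<mu>0 where "\<mu>0 = \<mu>(tmp d := m)"
  have start: "step M w (pos, \<mu>) = (Suc pos, \<mu>0)"
    using code_at_single[OF c(1), of w \<mu>] Loop.prems(2)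
    by (auto simp: \<mu>0_def m_def represents_def dest: spec[of _ "0::nat"])
  have rep0: "represents s \<mu>0"
    unfolding \<mu>0_def by (rule represents_frame[OF Loop.prems(2) frame_eq_upd[OF order_refl frame_eq_refl]])
  \<comment> \<open>The invariant is stated at the test, address \<open>Suc pos\<close>;
    \<open>tmp d\<close> holds the number of rounds still to do and is safe from the body, which is
    compiled at level \<open>Suc d\<close>.\<close>
  have iter: "\<exists>\<mu>'. (step M w ^^ (\<Sum>j<k. cost w c ((sem w c ^^ j) s) + 4)) (Suc pos, \<mu>0) = (Suc pos, \<mu>') \<and>
      represents ((sem w c ^^ k) s) \<mu>' \<and> \<mu>' (tmp d) = m - k \<and> (\<forall>t<d. \<mu>' (tmp t) = \<mu> (tmp t))"
    if "k \<le> m" for k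
    using that
  proof (induction k)
    case 0
    have "\<mu>0 (tmp t) = \<mu> (tmp t)" if "t < d" for t
      using that by (simp add: \<mu>0_def)
    then show ?case
      using rep0 by (auto simp: \<mu>0_def fun_upd_def)
  next
    case (Suc k)
    let ?s = "(sem w c ^^ k) s"
    obtain \<mu>1 where 1:
      "(step M w ^^ (\<Sum>j<k. cost w c ((sem w c ^^ j) s) + 4)) (Suc pos, \<mu>0) = (Suc pos, \<mu>1)"
      "represents ?s \<mu>1" "\<mu>1 (tmp d) = m - k" "\<forall>t<d. \<mu>1 (tmp t) = \<mu> (tmp t)"
      using Suc by auto
    obtain \<mu>2 where 2: "(step M w ^^ cost w c ?s) (pos + 2, \<mu>1) = (q, \<mu>2)"
      "represents (sem w c ?s) \<mu>2" "\<forall>t<Suc d. \<mu>2 (tmp t) = \<mu>1 (tmp t)"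
      using Loop.IH[OF c(3) 1(2)] Loop.prems(3) by (auto simp: q_def)
    let ?\<mu>3 = "\<mu>2(tmp (Suc d) := 1, tmp d := m - Suc k)"
    have "step M w (Suc pos, \<mu>1) = (pos + 2, \<mu>1)"
      using code_at_single[OF c(2), of w \<mu>1] 1(3) Suc.prems by simp
    moreover have "(step M w ^^ 3) (q, \<mu>2) = (Suc pos, ?\<mu>3)"
      using code_at_single[OF c(4), of w \<mu>2] code_at_single[OF c(5), of w "\<mu>2(tmp (Suc d) := 1)"]
        code_at_single[OF c(6), of w ?\<mu>3] 1(3) 2(3)
      by (simp add: numeral_3_eq_3 numeral_2_eq_2)
    ultimately have "(step M w ^^ (1 + cost w c ?s + 3)) (Suc pos, \<mu>1) = (Suc pos, ?\<mu>3)"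
      unfolding funpow_add_apply using 2(1) by simp
    moreover have "(\<Sum>j<Suc k. cost w c ((sem w c ^^ j) s) + 4) =
       (\<Sum>j<k. cost w c ((sem w c ^^ j) s) + 4) + (1 + cost w c ?s + 3)"
      by simp
    ultimately have "(step M w ^^ (\<Sum>j<Suc k. cost w c ((sem w c ^^ j) s) + 4)) (Suc pos, \<mu>0) = (Suc pos, ?\<mu>3)"
      using 1(1) by (simp only: funpow_add_apply)
    moreover have "frame_eq d \<mu>2 ?\<mu>3"
      by (intro frame_eq_upd frame_eq_refl) auto
    ultimately show ?case
      using represents_frame[OF 2(2), of d ?\<mu>3] 2(3) 1(4)
      by (intro exI[of _ ?\<mu>3]) (simp add: fun_upd_def)
  qed
  obtain \<mu>' where 1: "(step M w ^^ (\<Sum>j<m. cost w c ((sem w c ^^ j) s) + 4)) (Suc pos, \<mu>0) = (Suc pos, \<mu>')"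
     "represents ((sem w c ^^ m) s) \<mu>'" "\<mu>' (tmp d) = 0" "\<forall>t<d. \<mu>' (tmp t) = \<mu> (tmp t)"
    using iter[of m] by auto
  have "step M w (Suc pos, \<mu>') = (q + 3, \<mu>')"
    using code_at_single[OF c(2), of w \<mu>'] 1(3) by simp
  moreover have "cost w (Loop i c) s = 1 + (\<Sum>j<m. cost w c ((sem w c ^^ j) s) + 4) + 1"
    by (simp add: m_def)
  ultimately have "(step M w ^^ cost w (Loop i c) s) (pos, \<mu>) = (q + 3, \<mu>')"
    using start 1(1) by (simp only: funpow_add_apply) simp
  then show ?case
    using 1 by (intro exI[of _ \<mu>']) (simp add: q_def m_def)
qed

definition init_state :: "bool list \<Rightarrow> state" where
  "init_state w = (\<lambda>_. 0)((0, 0) := length w)"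

text \<open>Halted configurations are fixed points, so an upper bound on the exact cost is good
  enough.\<close>

lemma outputs_within_cmd:
  assumes "wf_cmd c" "cost w c (init_state w) \<le> t"
  shows "outputs_within (cmd_code c 0 0) w t (sem w c (init_state w) (0, 0))"
proof -
  let ?M = "cmd_code c 0 0"
  have "represents (init_state w) ((\<lambda>_. 0)(0 := length w))"
    by (auto simp: represents_def init_state_def)
  then obtain \<mu> where 1: "(step ?M w ^^ cost w c (init_state w)) (initial w) = (cmd_len c, \<mu>)"
    "represents (sem w c (init_state w)) \<mu>"
    using step_cmd[of ?M 0 c 0 "init_state w" "(\<lambda>_. 0)(0 := length w)" w] assms(1)
    by (auto simp: code_at_def initial_def)
  have "step ?M w (cmd_len c, \<mu>) = (cmd_len c, \<mu>)"
    by (simp add: step_def)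
  then have "(step ?M w ^^ j) (cmd_len c, \<mu>) = (cmd_len c, \<mu>)" for j
    by (induction j) auto
  then have "(step ?M w ^^ t) (initial w) = (cmd_len c, \<mu>)"
    using 1(1) assms(2)
      funpow_add_apply[of "cost w c (init_state w)" "t - cost w c (init_state w)" "step ?M w" "initial w"]
    by simp
  moreover have "\<mu> 0 = sem w c (init_state w) (0, 0)"
    using 1(2) by (auto simp: represents_def dest!: spec[of _ "0::nat"])
  ultimately show ?thesis
    by (simp add: outputs_within_def)
qed

subsection \<open>Frame rule and static cost bounds\<close>

text \<open>An over-approximation: scalars, addressed by literals, are tracked individually, while a
  write at a computed index counts as a write to the whole array.\<close>

primrec mods :: "cmd \<Rightarrow> (nat \<times> nat) set" where
  "mods Skip = {}"
| "mods (Assign a e f) = (case e of Num i \<Rightarrow> {(a, i)} | _ \<Rightarrow> {a} \<times> UNIV)"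
| "mods (c ;; c') = mods c \<union> mods c'"
| "mods (Cond e c c') = mods c \<union> mods c'"
| "mods (Loop i c) = mods c"

lemma sem_frame: "l \<notin> mods c \<Longrightarrow> sem w c s l = s l"
proof (induction c arbitrary: s)
  case (Assign a e f)
  then show ?case
    by (cases e) (auto simp: fun_upd_def)
next
  case (Loop i c)
  then have "(sem w c ^^ k) s l = s l" for k
    by (induction k) auto
  then show ?case
    by simp
qed auto

lemma funpow_sem_frame: "l \<notin> mods c \<Longrightarrow> (sem w c ^^ k) s l = s l"
  by (induction k) (auto simp: sem_frame)

primrec loop_regs :: "cmd \<Rightarrow> nat set" where
  "loop_regs Skip = {}"
| "loop_regs (Assign a e f) = {}"
| "loop_regs (c ;; c') = loop_regs c \<union> loop_regs c'"
| "loop_regs (Cond e c c') = loop_regs c \<union> loop_regs c'"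
| "loop_regs (Loop i c) = insert i (loop_regs c)"

primrec cost_poly :: "cmd \<Rightarrow> nat poly" where
  "cost_poly Skip = 0"
| "cost_poly (Assign a e f) = [:expr_len e + expr_len f + 6:]"
| "cost_poly (c ;; c') = cost_poly c + cost_poly c'"
| "cost_poly (Cond e c c') = [:expr_len e + 2:] + cost_poly c + cost_poly c'"
| "cost_poly (Loop i c) = [:2:] + [:0, 1:] * (cost_poly c + [:4:])"

text \<open>A counter that the command never writes keeps its initial value at every entry of its
  loop, so one bound on the initial counters controls all nested rounds.\<close>

lemma cost_le_cost_poly:
  assumes "\<And>i. i \<in> loop_regs c \<Longrightarrow> s (0, i) \<le> B" "\<And>i. i \<in> loop_regs c \<Longrightarrow> (0, i) \<notin> mods c"
  shows "cost w c s \<le> poly (cost_poly c) B"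
  using assms
proof (induction c arbitrary: s)
  case (Seq c c')
  have "cost w c s \<le> poly (cost_poly c) B"
    using Seq.prems by (intro Seq.IH(1)) auto
  moreover have "cost w c' (sem w c s) \<le> poly (cost_poly c') B"
    using Seq.prems by (intro Seq.IH(2)) (auto simp: sem_frame)
  ultimately show ?case
    by simp
next
  case (Cond e c c')
  have "cost w c s \<le> poly (cost_poly c) B" "cost w c' s \<le> poly (cost_poly c') B"
    using Cond.prems by (auto intro!: Cond.IH)
  then show ?case
    by simp
next
  case (Loop i c)
  have "cost w c ((sem w c ^^ j) s) \<le> poly (cost_poly c) B" for j
    using Loop.prems by (intro Loop.IH) (auto simp: funpow_sem_frame)
  then have "(\<Sum>j<s (0, i). cost w c ((sem w c ^^ j) s) + 4) \<le> s (0, i) * (poly (cost_poly c) B + 4)"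
    using sum_bounded_above[of "{..<s (0, i)}" "\<lambda>j. cost w c ((sem w c ^^ j) s) + 4"
        "poly (cost_poly c) B + 4"] by simp
  also have "\<dots> \<le> B * (poly (cost_poly c) B + 4)"
    using Loop.prems(1)[of i] by (intro mult_right_mono) auto
  finally show ?case
    by simp
qed auto

section \<open>Chain partitions by pushing labels\<close>

text \<open>The number 0 stands for ``no element'' throughout.\<close>

locale indexed_poset =
  fixes n :: nat and L :: "nat \<Rightarrow> nat \<Rightarrow> bool"
  assumes L_refl: "a \<in> {1..n} \<Longrightarrow> L a a"
    and L_antisym: "\<lbrakk>a \<in> {1..n}; b \<in> {1..n}; L a b; L b a\<rbrakk> \<Longrightarrow> a = b"
    and L_trans: "\<lbrakk>a \<in> {1..n}; b \<in> {1..n}; c \<in> {1..n}; L a b; L b c\<rbrakk> \<Longrightarrow> L a c"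
begin

definition lt :: "nat \<Rightarrow> nat \<Rightarrow> bool" where
  "lt a b \<longleftrightarrow> a \<in> {1..n} \<and> b \<in> {1..n} \<and> a \<noteq> b \<and> L a b"

lemma lt_irrefl: "\<not> lt a a"
  by (simp add: lt_def)

lemma lt_trans: "lt a b \<Longrightarrow> lt b c \<Longrightarrow> lt a c"
  unfolding lt_def using L_trans L_antisym by blast

lemma lt_range: "lt a b \<Longrightarrow> a \<in> {1..n} \<and> b \<in> {1..n}"
  by (simp add: lt_def)

lemma lt_nonzero: "lt a b \<Longrightarrow> a \<noteq> 0 \<and> b \<noteq> 0"
  by (auto simp: lt_def)

text \<open>The number of strict upper bounds is the measure for all walks along chains, both
  downwards in \<open>ex_chain_start\<close> and upwards in \<open>potential\<close>.\<close>

lemma card_above_less: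
  assumes "lt a b"
  shows "card {c. lt b c} < card {c. lt a c}"
proof (rule psubset_card_mono)
  show "finite {c. lt a c}"
    by (rule finite_subset[of _ "{1..n}"]) (auto dest: lt_range)
  show "{c. lt b c} \<subset> {c. lt a c}"
    using assms lt_trans lt_irrefl by blast
qed

lemma card_above_le: "card {c. lt a c} \<le> n"
proof -
  have "{c. lt a c} \<subseteq> {1..n}"
    using lt_range by blast
  from card_mono[OF _ this] show ?thesis
    by simp
qed

text \<open>
  \<open>nx\<close> and \<open>pv\<close> are a partial successor function and its inverse, that is, a matching in the
  bipartite comparability graph. The label \<open>d b\<close> counts how often \<open>b\<close> has been matched.
\<close>

definition chain_inv :: "(nat \<Rightarrow> nat) \<Rightarrow> (nat \<Rightarrow> nat) \<Rightarrow> (nat \<Rightarrow> nat) \<Rightarrow> bool" where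
  "chain_inv nx pv d \<longleftrightarrow>
     (\<forall>a. nx a \<noteq> 0 \<longrightarrow> lt a (nx a) \<and> pv (nx a) = a) \<and>
     (\<forall>b. pv b \<noteq> 0 \<longrightarrow> lt (pv b) b \<and> nx (pv b) = b) \<and>
     (\<forall>b. pv b = 0 \<longrightarrow> d b = 0) \<and>
     (\<forall>a b. nx a \<noteq> 0 \<longrightarrow> lt a b \<longrightarrow> d (nx a) \<le> Suc (d b)) \<and>
     (\<forall>b. d b \<le> Suc n)"

lemma chain_invD:
  assumes "chain_inv nx pv d"
  shows "nx a \<noteq> 0 \<Longrightarrow> lt a (nx a)" "nx a \<noteq> 0 \<Longrightarrow> pv (nx a) = a"
    "pv b \<noteq> 0 \<Longrightarrow> lt (pv b) b" "pv b \<noteq> 0 \<Longrightarrow> nx (pv b) = b" "pv b = 0 \<Longrightarrow> d b = 0"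
    "nx a \<noteq> 0 \<Longrightarrow> lt a b \<Longrightarrow> d (nx a) \<le> Suc (d b)" "d b \<le> Suc n"
  using assms by (auto simp: chain_inv_def)

lemma chain_inv_init: "chain_inv (\<lambda>_. 0) (\<lambda>_. 0) (\<lambda>_. 0)"
  by (simp add: chain_inv_def)

text \<open>For \<open>a\<close> the label condition is the minimality of \<open>d b\<close>. Any
  other element with a successor keeps it, and that successor is not \<open>b\<close>; so in its
  condition only the right-hand side can grow. If \<open>b\<close> had no predecessor, the update at
  \<open>pv b\<close> writes 0 at index 0.\<close>

lemma chain_inv_augment:
  assumes inv: "chain_inv nx pv d" and a: "nx a = 0" "lt a b" and "d b \<le> n"
    and min: "\<And>b'. lt a b' \<Longrightarrow> d b \<le> d b'"
  shows "chain_inv (nx(pv b := 0, a := b)) (pv(b := a)) (d(b := Suc (d b)))"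
proof -
  note D = chain_invD[OF inv]
  have nz: "a \<noteq> 0" "b \<noteq> 0"
    using a(2) lt_nonzero by auto
  have pvb: "pv b \<noteq> a"
    using D(4)[of b] nz a(1) by auto
  let ?nx = "nx(pv b := 0, a := b)"
  let ?pv = "pv(b := a)"
  \<comment> \<open>The only element that pointed to \<open>b\<close> was \<open>pv b\<close>, and
    it has just lost its successor.\<close>
  have nx_old: "?nx c = nx c \<and> nx c \<noteq> b" if "c \<noteq> a" "?nx c \<noteq> 0" for c
    using that D(2)[of c] by (auto split: if_splits)
  show ?thesis
    unfolding chain_inv_def
  proof (intro conjI allI impI)
    fix c
    assume c: "?nx c \<noteq> 0"
    show "lt c (?nx c)"
      using nx_old[OF _ c] c D(1)[of c] a(2) by (cases "c = a") auto
    show "?pv (?nx c) = c"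
      using nx_old[OF _ c] c D(2)[of c] by (cases "c = a") auto
    fix b'
    assume "lt c b'"
    then show "(d(b := Suc (d b))) (?nx c) \<le> Suc ((d(b := Suc (d b))) b')"
      using nx_old[OF _ c] c D(6)[of c b'] min[of b'] by (cases "c = a") auto
  next
    fix c
    assume c: "?pv c \<noteq> 0"
    show "lt (?pv c) c"
      using c a(2) D(3)[of c] by (cases "c = b") auto
    show "?nx (?pv c) = c"
      using c D(3,4)[of c] D(4)[of b] a(1) lt_nonzero[of "pv c" c] by (cases "c = b") auto
  next
    fix c
    assume "?pv c = 0"
    then show "(d(b := Suc (d b))) c = 0"
      using nz D(5)[of c] by (auto split: if_splits)
  next
    fix c
    show "(d(b := Suc (d b))) c \<le> Suc n"
      using D(7)[of c] assms(4) by auto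
  qed
qed

text \<open>Bounds the number of rounds of the auction, since each successful one raises the label
  sum by 1.\<close>

lemma sum_labels_le: "chain_inv nx pv d \<Longrightarrow> sum d {1..n} \<le> n * Suc n"
  using sum_bounded_above[of "{1..n}" d "Suc n"] chain_invD(7) by auto

text \<open>Following \<open>pv\<close> downwards strictly increases the number of upper bounds,
  which is at most \<open>n\<close>, so the walk stops.\<close>

lemma ex_chain_start:
  assumes inv: "chain_inv nx pv d" and "a \<in> {1..n}"
  shows "\<exists>s i. s \<in> {1..n} \<and> pv s = 0 \<and> (nx ^^ i) s = a"
  using assms(2)
proof (induction "n - card {c. lt a c}" arbitrary: a rule: less_induct)
  case less
  show ?case
  proof (cases "pv a = 0")
    case True
    then show ?thesis
      using less.prems by (intro exI[of _ a] exI[of _ 0]) simp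
  next
    case False
    then have pa: "lt (pv a) a" "nx (pv a) = a"
      using chain_invD[OF inv] by auto
    then have "n - card {c. lt (pv a) c} < n - card {c. lt a c}"
      using card_above_less[OF pa(1)] card_above_le[of "pv a"] by linarith
    then obtain s i where "s \<in> {1..n}" "pv s = 0" "(nx ^^ i) s = pv a"
      using less.hyps pa(1) lt_range by blast
    then show ?thesis
      using pa(2) by (intro exI[of _ s] exI[of _ "Suc i"]) simp
  qed
qed

text \<open>
  The labels omit some value \<open>l\<close> in \<open>{1..n}\<close>. With \<open>R\<close> the elements of label above \<open>l\<close> and \<open>Q\<close>
  the elements all of whose upper bounds lie in \<open>R\<close>, the set \<open>Q - R\<close> is an antichain. All chain
  tops and all predecessors of elements of \<open>R\<close> are in \<open>Q\<close>, so \<open>Q - R\<close> has at least as many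
  elements as there are chains.
\<close>

lemma card_chain_starts_le:
  assumes inv: "chain_inv nx pv d"
    and final: "\<And>a b. nx a = 0 \<Longrightarrow> lt a b \<Longrightarrow> n < d b"
    and width: "\<And>S. S \<subseteq> {1..n} \<Longrightarrow> (\<And>x y. x \<in> S \<Longrightarrow> y \<in> S \<Longrightarrow> \<not> lt x y) \<Longrightarrow> card S \<le> w"
  shows "card {a \<in> {1..n}. pv a = 0} \<le> w"
proof (cases "{a \<in> {1..n}. pv a = 0} = {}")
  case True
  then show ?thesis
    by (simp only: card.empty)
next
  case False
  then obtain s where s: "s \<in> {1..n}" "pv s = 0"
    by blast
  note D = chain_invD[OF inv]
  \<comment> \<open>The chain start \<open>s\<close> has label 0, so at most n - 1 elements can
    carry the n values in question.\<close>
  have "\<not> {1..n} \<subseteq> d ` ({1..n} - {s})"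
  proof
    assume "{1..n} \<subseteq> d ` ({1..n} - {s})"
    then have "card {1..n} \<le> card ({1..n} - {s})"
      by (rule surj_card_le[rotated]) simp
    then show False
      using s(1) by simp arith
  qed
  then obtain l where l: "l \<in> {1..n}" "l \<notin> d ` ({1..n} - {s})"
    by blast
  have gap: "d b \<noteq> l" if "b \<in> {1..n}" for b
    using that l D(5)[OF s(2)] by (cases "b = s") auto
  define R where "R = {b \<in> {1..n}. l < d b}"
  define Q where "Q = {a \<in> {1..n}. \<forall>b. lt a b \<longrightarrow> l < d b}"
  define T where "T = {a \<in> {1..n}. nx a = 0}"
  have fin: "finite R" "finite Q" "finite T"
    by (auto simp: R_def Q_def T_def)
  have TQ: "T \<subseteq> Q"
    using final l(1) by (force simp: T_def Q_def)
  have R_pv: "pv b \<noteq> 0 \<and> pv b \<in> Q" if "b \<in> R" for b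
  proof -
    have b: "b \<in> {1..n}" "l < d b"
      using that by (auto simp: R_def)
    then have "pv b \<noteq> 0"
      using D(5)[of b] by auto
    moreover from this have "lt (pv b) b" "nx (pv b) = b"
      using D by auto
    \<comment> \<open>The label condition gives \<open>d b \<le> Suc (d b')\<close>, hence
      \<open>l \<le> d b'\<close>; equality is excluded because \<open>l\<close> is not a
      label.\<close>
    moreover have "l < d b'" if "lt (pv b) b'" for b'
      using D(6)[of "pv b" b'] that b calculation lt_nonzero gap[of b'] lt_range[OF that] by force
    ultimately show ?thesis
      using lt_range by (auto simp: Q_def)
  qed
  have inj: "inj_on pv {b. pv b \<noteq> 0}"
    by (rule inj_on_inverseI[of _ nx]) (use D in auto)
  have "card T + card R \<le> card Q"
  proof -
    have "card (pv ` R) = card R"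
      using R_pv by (intro card_image inj_on_subset[OF inj]) auto
    moreover have "T \<inter> pv ` R = {}"
    proof -
      have "nx (pv b) \<noteq> 0" if "b \<in> R" for b
        using D(4)[of b] R_pv[OF that] that by (auto simp: R_def)
      then show ?thesis
        unfolding T_def by blast
    qed
    ultimately have "card T + card R = card (T \<union> pv ` R)"
      using fin by (simp add: card_Un_disjoint)
    also have "\<dots> \<le> card Q"
      using fin TQ R_pv by (intro card_mono) auto
    finally show ?thesis .
  qed
  moreover have "card Q - card R \<le> card (Q - R)"
    using fin by (simp add: diff_card_le_card_Diff)
  \<comment> \<open>If x < y with x in Q, then the label of y exceeds \<open>l\<close>, which puts y
    into R.\<close>
  moreover have "card (Q - R) \<le> w"
    by (rule width) (auto simp: Q_def R_def dest: lt_range)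
  \<comment> \<open>Bottoms and tops of chains are equally many: either number is n minus the number
    of matched pairs.\<close>
  moreover have "card {a \<in> {1..n}. pv a = 0} = card T"
  proof -
    have *: "pv b \<in> {1..n} \<and> nx (pv b) = b \<and> nx (pv b) \<noteq> 0" if "pv b \<noteq> 0" for b
      using D(3,4)[OF that] lt_range[of "pv b" b] lt_nonzero[of "pv b" b] by metis
    have **: "nx a \<in> {1..n} \<and> pv (nx a) = a \<and> pv (nx a) \<noteq> 0" if "nx a \<noteq> 0" for a
      using D(1,2)[OF that] lt_range[of a "nx a"] lt_nonzero[of a "nx a"] by metis
    have "bij_betw pv {b \<in> {1..n}. pv b \<noteq> 0} {a \<in> {1..n}. nx a \<noteq> 0}"
    proof (rule bij_betw_byWitness[of _ nx])
      show "pv ` {b \<in> {1..n}. pv b \<noteq> 0} \<subseteq> {a \<in> {1..n}. nx a \<noteq> 0}"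
        using * by blast
      show "nx ` {a \<in> {1..n}. nx a \<noteq> 0} \<subseteq> {b \<in> {1..n}. pv b \<noteq> 0}"
        using ** by blast
    qed (use * ** in blast)+
    then have eq: "card {b \<in> {1..n}. pv b \<noteq> 0} = card {a \<in> {1..n}. nx a \<noteq> 0}"
      by (rule bij_betw_same_card)
    have "card {a \<in> {1..n}. f a = 0} + card {a \<in> {1..n}. f a \<noteq> 0} = n" for f :: "nat \<Rightarrow> nat"
    proof -
      have "{a \<in> {1..n}. f a = 0} \<union> {a \<in> {1..n}. f a \<noteq> 0} = {1..n}"
        by auto
      then show ?thesis
        by (subst card_Un_disjoint[symmetric]) (auto simp flip: Collect_conj_eq)
    qed
    from this[of pv] this[of nx] eq show ?thesis
      by (simp add: T_def)
  qed
  ultimately show ?thesis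
    by linarith
qed

end

section \<open>Least solutions by bumping\<close>

text \<open>
  A constraint \<open>(b, x, y)\<close> demands \<open>x \<le> y\<close> if \<open>b\<close> and \<open>\<not> x \<le> y\<close> otherwise. When each variable
  ranges over a chain and its current value is a lower bound for a solution, a violated
  constraint forces \<open>y\<close> respectively \<open>x\<close> to move up.
  The state consists of the current values, a flag for changes and a flag for failure.
\<close>

type_synonym constraint = "bool \<times> nat \<times> nat"

type_synonym valuation = "(nat \<Rightarrow> nat) \<times> nat \<times> nat"

fun holds :: "(nat \<Rightarrow> nat \<Rightarrow> bool) \<Rightarrow> (nat \<Rightarrow> nat) \<Rightarrow> constraint \<Rightarrow> bool" where
  "holds L v (b, x, y) \<longleftrightarrow> L (v x) (v y) = b"

fun constraint_vars :: "constraint \<Rightarrow> nat set" where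
  "constraint_vars (b, x, y) = {x, y}"

text \<open>Leaving a chain at its top yields the value 0 and raises the failure flag, which is
  never lowered by later constraints or passes.\<close>

definition bump :: "(nat \<Rightarrow> nat) \<Rightarrow> nat \<Rightarrow> valuation \<Rightarrow> valuation" where
  "bump nx z = (\<lambda>(v, c, f). (v(z := nx (v z)), 1, if nx (v z) = 0 then 1 else f))"

fun enforce :: "(nat \<Rightarrow> nat \<Rightarrow> bool) \<Rightarrow> (nat \<Rightarrow> nat) \<Rightarrow> constraint \<Rightarrow> valuation \<Rightarrow> valuation" where
  "enforce L nx (b, x, y) (v, c, f) =
     (if L (v x) (v y) = b then (v, c, f) else bump nx (if b then y else x) (v, c, f))"

definition pass ::
  "(nat \<Rightarrow> nat \<Rightarrow> bool) \<Rightarrow> (nat \<Rightarrow> nat) \<Rightarrow> constraint list \<Rightarrow> valuation \<Rightarrow> valuation" where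
  "pass L nx ps = (\<lambda>(v, c, f). fold (enforce L nx) ps (v, 0, f))"

text \<open>Within a pass the change flag is never lowered, so if it ends as 0 then all constraints
  were tested against one and the same valuation.\<close>

lemma fold_enforce_unchanged:
  "fold (enforce L nx) ps (v, c, f) = (v', 0, f') \<Longrightarrow>
    c = 0 \<and> v' = v \<and> f' = f \<and> (\<forall>p\<in>set ps. holds L v p)"
proof (induction ps arbitrary: v c f)
  case (Cons p ps)
  obtain b x y where p: "p = (b, x, y)"
    by (cases p)
  show ?case
  proof (cases "L (v x) (v y) = b")
    case True
    then show ?thesis
      using Cons p by auto
  next
    case False
    let ?z = "if b then y else x"
    have "fold (enforce L nx) ps (v(?z := nx (v ?z)), 1, if nx (v ?z) = 0 then 1 else f) = (v', 0, f')"
      using Cons.prems False by (simp add: p bump_def)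
    from Cons.IH[OF this] show ?thesis
      by simp
  qed
qed simp

context indexed_poset
begin

section \<open>Soundness of repeated passes\<close>

lemma enforce_range:
  assumes nx: "\<And>a. nx a \<noteq> 0 \<Longrightarrow> lt a (nx a)"
    and "f = 0 \<longrightarrow> (\<forall>x\<in>V. v x \<in> {1..n})" "enforce L nx p (v, c, f) = (v', c', f')"
  shows "f' = 0 \<longrightarrow> (\<forall>x\<in>V. v' x \<in> {1..n})"
  using assms(2,3) lt_range[OF nx]
  by (cases p) (auto simp: bump_def split: if_splits)

lemma fold_enforce_range:
  assumes nx: "\<And>a. nx a \<noteq> 0 \<Longrightarrow> lt a (nx a)"
  shows "f = 0 \<longrightarrow> (\<forall>x\<in>V. v x \<in> {1..n}) \<Longrightarrow> fold (enforce L nx) ps (v, c, f) = (v', c', f') \<Longrightarrow>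
    f' = 0 \<longrightarrow> (\<forall>x\<in>V. v' x \<in> {1..n})"
proof (induction ps arbitrary: v c f)
  case (Cons p ps)
  obtain v1 c1 f1 where 1: "enforce L nx p (v, c, f) = (v1, c1, f1)"
    by (metis prod_cases3)
  show ?case
    using Cons.IH[OF enforce_range[OF nx Cons.prems(1) 1]] Cons.prems(2) 1 by simp
qed simp

text \<open>At least one pass is demanded because only a pass gives meaning to the change flag; its
  initial value \<open>c\<close> is arbitrary.\<close>

lemma passes_sound:
  assumes nx: "\<And>a. nx a \<noteq> 0 \<Longrightarrow> lt a (nx a)"
    and init: "f = 0 \<longrightarrow> (\<forall>x\<in>V. v x \<in> {1..n})"
    and final: "(pass L nx ps ^^ Suc k) (v, c, f) = (v', 0, 0)"
  shows "(\<forall>x\<in>V. v' x \<in> {1..n}) \<and> (\<forall>p\<in>set ps. holds L v' p)"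
proof -
  have range: "case (pass L nx ps ^^ k) (v, c, f) of (v, c, f) \<Rightarrow> f = 0 \<longrightarrow> (\<forall>x\<in>V. v x \<in> {1..n})" for k
  proof (induction k)
    case (Suc k)
    obtain v1 c1 f1 where 1: "(pass L nx ps ^^ k) (v, c, f) = (v1, c1, f1)"
      by (metis prod_cases3)
    obtain v2 c2 f2 where 2: "fold (enforce L nx) ps (v1, 0, f1) = (v2, c2, f2)"
      by (metis prod_cases3)
    have "f1 = 0 \<longrightarrow> (\<forall>x\<in>V. v1 x \<in> {1..n})"
      using Suc 1 by (simp only: prod.case)
    from fold_enforce_range[OF nx this 2] show ?case
      using 1 2 by (simp add: pass_def)
  qed (use init in simp)
  obtain v1 c1 f1 where 1: "(pass L nx ps ^^ k) (v, c, f) = (v1, c1, f1)"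
    by (metis prod_cases3)
  then have "fold (enforce L nx) ps (v1, 0, f1) = (v', 0, 0)"
    using final by (simp add: pass_def)
  from fold_enforce_unchanged[OF this] range[of k] 1 show ?thesis
    by auto
qed

section \<open>Progress of the passes towards a given solution\<close>

definition potential :: "nat set \<Rightarrow> (nat \<Rightarrow> nat) \<Rightarrow> nat" where
  "potential V v = (\<Sum>x\<in>V. card {c. lt (v x) c})"

lemma potential_le: "potential V v \<le> card V * n"
  using sum_bounded_above[of V "\<lambda>x. card {c. lt (v x) c}" n, OF card_above_le]
  by (simp only: potential_def of_nat_id)

text \<open>Since 0 is absorbing, an orbit of \<open>nx\<close> that ends in \<open>{1..n}\<close>
  never left it, so all its steps go upwards.\<close>

lemma reach_le:
  assumes nx: "\<And>a. nx a \<noteq> 0 \<Longrightarrow> lt a (nx a)" and "nx 0 = 0"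
  shows "(nx ^^ i) a = b \<Longrightarrow> b \<in> {1..n} \<Longrightarrow> a \<in> {1..n} \<and> L a b"
proof (induction i arbitrary: a)
  case 0
  then show ?case
    using L_refl by simp
next
  case (Suc i)
  have "(nx ^^ i) 0 = 0" for i
    using assms(2) by (induction i) auto
  moreover have "(nx ^^ i) (nx a) = b"
    using Suc.prems(1) by (simp add: funpow_swap1)
  ultimately have "nx a \<noteq> 0" "nx a \<in> {1..n} \<and> L (nx a) b"
    using Suc.prems(2) Suc.IH[of "nx a"] by auto
  then show ?case
    using nx[of a] L_trans[of a "nx a" b] Suc.prems(2) by (auto simp: lt_def)
qed

text \<open>Stronger than \<open>L (v x) (\<sigma> x)\<close>: the solution lies further up on the
  same chain, so repeated bumping hits it.\<close>

definition below :: "(nat \<Rightarrow> nat) \<Rightarrow> nat set \<Rightarrow> (nat \<Rightarrow> nat) \<Rightarrow> (nat \<Rightarrow> nat) \<Rightarrow> bool" where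
  "below nx V v \<sigma> \<longleftrightarrow> (\<forall>x\<in>V. \<sigma> x \<in> {1..n} \<and> (\<exists>i. (nx ^^ i) (v x) = \<sigma> x))"

lemma bump_below:
  assumes nx: "\<And>a. nx a \<noteq> 0 \<Longrightarrow> lt a (nx a)" and "nx 0 = 0"
    and "finite V" "z \<in> V" "below nx V v \<sigma>" "v z \<noteq> \<sigma> z"
  shows "\<exists>v'. bump nx z (v, c, 0) = (v', 1, 0) \<and> below nx V v' \<sigma> \<and> potential V v' < potential V v"
proof -
  obtain i where i: "(nx ^^ i) (v z) = \<sigma> z" and z: "\<sigma> z \<in> {1..n}"
    using assms(4,5) by (auto simp: below_def)
  then obtain j where j: "(nx ^^ j) (nx (v z)) = \<sigma> z"
    using assms(6) by (cases i) (auto simp: funpow_swap1)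
  then have "nx (v z) \<in> {1..n}"
    using reach_le[OF nx assms(2) j z] by simp
  then have "nx (v z) \<noteq> 0"
    by simp
  moreover have "below nx V (v(z := nx (v z))) \<sigma>"
    using assms(5) j by (auto simp: below_def)
  moreover have "potential V (v(z := nx (v z))) < potential V v"
    unfolding potential_def
    using card_above_less[OF nx[OF \<open>nx (v z) \<noteq> 0\<close>]] assms(3,4)
    by (intro sum_strict_mono_ex1) auto
  ultimately show ?thesis
    by (simp add: bump_def)
qed

text \<open>The variable to be raised cannot have reached its target yet. If x \<le> y is violated
  but \<open>v y = \<sigma> y\<close>, then v x \<le> \<sigma> x \<le> \<sigma> y = v y. If v x
  \<le> v y is forbidden but \<open>v x = \<sigma> x\<close>, then \<sigma> x = v x \<le> v y \<le>
  \<sigma> y. Both are contradictions, so no bump overshoots.\<close>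

lemma enforce_below:
  assumes nx: "\<And>a. nx a \<noteq> 0 \<Longrightarrow> lt a (nx a)" and "nx 0 = 0" and "finite V"
    and "below nx V v \<sigma>" "holds L \<sigma> p" "constraint_vars p \<subseteq> V"
  shows "enforce L nx p (v, c, 0) = (v, c, 0) \<or>
    (\<exists>v'. enforce L nx p (v, c, 0) = (v', 1, 0) \<and> below nx V v' \<sigma> \<and> potential V v' < potential V v)"
proof -
  obtain b x y where p: "p = (b, x, y)"
    by (cases p)
  have xy: "x \<in> V" "y \<in> V"
    using assms(6) p by auto
  have le: "v z \<in> {1..n} \<and> L (v z) (\<sigma> z) \<and> \<sigma> z \<in> {1..n}" if "z \<in> V" for z
  proof -
    obtain i where "\<sigma> z \<in> {1..n}" "(nx ^^ i) (v z) = \<sigma> z"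
      using assms(4) \<open>z \<in> V\<close> by (auto simp: below_def)
    then show ?thesis
      using reach_le[OF nx assms(2)] by blast
  qed
  show ?thesis
  proof (cases "L (v x) (v y) = b")
    case True
    then show ?thesis
      by (simp add: p)
  next
    case False
    have "v (if b then y else x) \<noteq> \<sigma> (if b then y else x)"
    proof (cases b)
      case True
      then have "L (\<sigma> x) (\<sigma> y)" "\<not> L (v x) (v y)"
        using False assms(5) p by auto
      then show ?thesis
        using True le[OF xy(1)] le[OF xy(2)] L_trans[of "v x" "\<sigma> x" "\<sigma> y"] by metis
    next
      case b: False
      then have "\<not> L (\<sigma> x) (\<sigma> y)" "L (v x) (v y)"
        using False assms(5) p by auto
      then show ?thesis
        using b le[OF xy(1)] le[OF xy(2)] L_trans[of "\<sigma> x" "v y" "\<sigma> y"] by metis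
    qed
    then show ?thesis
      using bump_below[OF nx assms(2,3) _ assms(4), of "if b then y else x" c] False xy
      by (auto simp: p)
  qed
qed

lemma fold_enforce_below:
  assumes nx: "\<And>a. nx a \<noteq> 0 \<Longrightarrow> lt a (nx a)" and "nx 0 = 0" and "finite V"
  shows "below nx V v \<sigma> \<Longrightarrow> \<forall>p\<in>set ps. holds L \<sigma> p \<and> constraint_vars p \<subseteq> V \<Longrightarrow>
    fold (enforce L nx) ps (v, c, 0) = (v, c, 0) \<or>
    (\<exists>v'. fold (enforce L nx) ps (v, c, 0) = (v', 1, 0) \<and> below nx V v' \<sigma> \<and> potential V v' < potential V v)"
proof (induction ps arbitrary: v c)
  case (Cons p ps)
  consider "enforce L nx p (v, c, 0) = (v, c, 0)" |
    v1 where "enforce L nx p (v, c, 0) = (v1, 1, 0)" "below nx V v1 \<sigma>" "potential V v1 < potential V v"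
    using enforce_below[OF nx assms(2,3) Cons.prems(1), of p c] Cons.prems(2) by auto
  then show ?case
  proof cases
    case 1
    then show ?thesis
      using Cons by simp
  next
    case 2
    then show ?thesis
      using Cons.IH[OF 2(2), of 1] Cons.prems(2) by (fastforce intro: order.strict_trans)
  qed
qed simp

text \<open>A pass either lowers the potential or changes no value, and in the latter case all later
  passes repeat it.\<close>

lemma passes_complete:
  assumes nx: "\<And>a. nx a \<noteq> 0 \<Longrightarrow> lt a (nx a)" and "nx 0 = 0" and "finite V"
    and ps: "\<forall>p\<in>set ps. holds L \<sigma> p \<and> constraint_vars p \<subseteq> V"
  shows "below nx V v \<sigma> \<Longrightarrow> potential V v < k \<Longrightarrow> \<exists>v'. (pass L nx ps ^^ k) (v, c, 0) = (v', 0, 0)"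
proof (induction k arbitrary: v c)
  case (Suc k)
  consider "fold (enforce L nx) ps (v, 0, 0) = (v, 0, 0)" |
    v1 where "fold (enforce L nx) ps (v, 0, 0) = (v1, 1, 0)" "below nx V v1 \<sigma>" "potential V v1 < potential V v"
    using fold_enforce_below[OF nx assms(2,3) Suc.prems(1) ps, of 0] by auto
  then show ?case
  proof cases
    case 1
    then have "pass L nx ps (v, c, 0) = (v, 0, 0)" for c
      by (simp add: pass_def)
    then have "(pass L nx ps ^^ Suc k) (v, c, 0) = (v, 0, 0)"
      by (induction k) auto
    then show ?thesis
      by blast
  next
    case 2
    then have "pass L nx ps (v, c, 0) = (v1, 1, 0)"
      by (simp add: pass_def)
    then show ?thesis
      using Suc.IH[OF 2(2), of 1] 2(3) Suc.prems(2) by (simp add: funpow_swap1)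
  qed
qed simp

end

section \<open>Guessing a chain for each variable and a disjunct for each disjunction\<close>

primrec nodes :: "matrix \<Rightarrow> nat" where
  "nodes (Pos a) = 1"
| "nodes (Neg a) = 1"
| "nodes (Conj m m') = Suc (nodes m + nodes m')"
| "nodes (Disj m m') = Suc (nodes m + nodes m')"

text \<open>On one chain with a < b, the pairs (a, b) and (b, a) satisfy \<open>x \<noteq> y\<close>
  but their minimum (a, a) does not. By antisymmetry distinctness means that one of the two
  comparisons fails, and the bit \<open>b\<close> says which.\<close>

fun literal_constraints :: "bool \<Rightarrow> bool \<Rightarrow> atom \<Rightarrow> constraint list" where
  "literal_constraints s b (Leq x y) = [(s, x, y)]"
| "literal_constraints True b (Equal x y) = [(True, x, y), (True, y, x)]"
| "literal_constraints False b (Equal x y) = [if b then (False, y, x) else (False, x, y)]"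

text \<open>
  The guess \<open>g\<close> is a bit string, lowest bit first, with one bit for each node of the matrix in
  preorder; \<open>act\<close> tells whether the current node belongs to the chosen part of the matrix.
\<close>

primrec constraints :: "matrix \<Rightarrow> bool \<Rightarrow> nat \<Rightarrow> constraint list" where
  "constraints (Pos a) act g = (if act then literal_constraints True (odd g) a else [])"
| "constraints (Neg a) act g = (if act then literal_constraints False (odd g) a else [])"
| "constraints (Conj m m') act g =
     constraints m act (g div 2) @ constraints m' act (g div 2 div 2 ^ nodes m)"
| "constraints (Disj m m') act g =
     constraints m (act \<and> odd g) (g div 2) @
     constraints m' (act \<and> even g) (g div 2 div 2 ^ nodes m)"

lemma constraints_inactive [simp]: "constraints m False g = []"
  by (induction m arbitrary: g) auto

lemma constraints_vars: "p \<in> set (constraints m act g) \<Longrightarrow> constraint_vars p \<subseteq> matrix_vars m"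
proof (induction m arbitrary: act g)
  case (Pos a)
  then show ?case
    by (cases a) (auto split: if_splits)
next
  case (Neg a)
  then show ?case
    by (cases a) (auto split: if_splits)
next
  case (Conj m m')
  then show ?case
    by fastforce
next
  case (Disj m m')
  then show ?case
    by fastforce
qed

lemma add_mult_pow_div: "(g + 2 ^ (a + b) * h) div 2 ^ a = g div 2 ^ a + 2 ^ b * (h::nat)" for g :: nat
  by (simp add: power_add mult.assoc)

lemma add_mult_pow_div_2: "(g + 2 ^ Suc b * h) div 2 = g div 2 + 2 ^ b * (h::nat)" for g :: nat
  by (simp add: mult.assoc)

text \<open>Only the lowest \<open>nodes m\<close> bits are read, so the guesses for the two
  subformulas can be concatenated.\<close>

lemma constraints_add: "constraints m act (g + 2 ^ nodes m * h) = constraints m act g"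
proof (induction m arbitrary: act g h)
  case (Conj m m')
  have 1: "(g + 2 ^ nodes (Conj m m') * h) div 2 = g div 2 + 2 ^ (nodes m + nodes m') * h"
    by (simp only: nodes.simps add_mult_pow_div_2)
  show ?case
    unfolding constraints.simps 1 add_mult_pow_div Conj.IH(2)
    using Conj.IH(1)[of act "g div 2" "2 ^ nodes m' * h"] by (simp only: power_add mult.assoc)
next
  case (Disj m m')
  have 1: "(g + 2 ^ nodes (Disj m m') * h) div 2 = g div 2 + 2 ^ (nodes m + nodes m') * h"
    by (simp only: nodes.simps add_mult_pow_div_2)
  have 2: "even (g + 2 ^ nodes (Disj m m') * h) = even g"
    by simp
  show ?case
    unfolding constraints.simps 1 2 add_mult_pow_div Disj.IH(2)
    using Disj.IH(1)[of _ "g div 2" "2 ^ nodes m' * h"] by (simp only: power_add mult.assoc)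
qed auto

text \<open>Assembles the guess of a binary node from its own bit and the guesses of its
  subformulas.\<close>

lemma ex_guess_append:
  assumes "g1 < 2 ^ k1" "g2 < 2 ^ k2" "b < 2"
  shows "\<exists>g<2 ^ Suc (k1 + k2). g mod 2 = b \<and> g div 2 = g1 + 2 ^ k1 * g2 \<and> g div 2 div 2 ^ k1 = (g2::nat)"
proof -
  define h where "h = g1 + 2 ^ k1 * g2"
  have "h div 2 ^ k1 = g2"
    using assms(1) by (simp add: h_def)
  have "g1 + 2 ^ k1 * g2 < 2 ^ k1 * Suc g2"
    using assms(1) by simp
  also have "\<dots> \<le> 2 ^ k1 * 2 ^ k2"
    using assms(2) by (intro mult_left_mono) auto
  finally have "b + 2 * h < 2 ^ Suc (k1 + k2)"
    using assms(3) by (simp add: power_add h_def)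
  then show ?thesis
    using assms(3) \<open>h div 2 ^ k1 = g2\<close> unfolding h_def[symmetric] by (intro exI[of _ "b + 2 * h"]) simp
qed

context indexed_poset
begin

text \<open>The locale constrains \<open>L\<close> only on \<open>{1..n}\<close>, hence the
  restriction.\<close>

definition rel :: "(nat \<times> nat) set" where
  "rel = {(a, b). a \<in> {1..n} \<and> b \<in> {1..n} \<and> L a b}"

lemma literal_constraints_sound:
  assumes "\<forall>x\<in>atom_vars a. v x \<in> {1..n}" "\<forall>p\<in>set (literal_constraints s b a). holds L v p"
  shows "sat_atom rel v a = s"
  using assms L_refl L_antisym by (cases "(s, b, a)" rule: literal_constraints.cases)
    (auto simp: rel_def split: if_splits)

lemma literal_constraints_complete:
  assumes "\<forall>x\<in>atom_vars a. v x \<in> {1..n}" "sat_atom rel v a = s"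
  shows "\<exists>b. \<forall>p\<in>set (literal_constraints s b a). holds L v p"
proof (cases "(s, True, a)" rule: literal_constraints.cases)
  case (3 b x y)
  then have "\<not> L (v y) (v x) \<or> \<not> L (v x) (v y)"
    using assms L_antisym[of "v x" "v y"] by auto
  then show ?thesis
    using 3 by (auto intro: exI[of _ True] exI[of _ False])
qed (use assms L_refl in \<open>auto simp: rel_def\<close>)

lemma constraints_sound:
  "\<forall>x\<in>matrix_vars m. v x \<in> {1..n} \<Longrightarrow> \<forall>p\<in>set (constraints m True g). holds L v p \<Longrightarrow> sat_matrix rel v m"
proof (induction m arbitrary: g)
  case (Pos a)
  then show ?case
    using literal_constraints_sound[of a v True "odd g"] by auto
next
  case (Neg a)
  then show ?case
    using literal_constraints_sound[of a v False "odd g"] by auto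
next
  case (Conj m m')
  then show ?case
    by auto
next
  case (Disj m m')
  then show ?case
    by (cases "odd g") auto
qed

lemma constraints_complete:
  "\<forall>x\<in>matrix_vars m. v x \<in> {1..n} \<Longrightarrow> sat_matrix rel v m \<Longrightarrow>
    \<exists>g<2 ^ nodes m. \<forall>p\<in>set (constraints m True g). holds L v p"
proof (induction m)
  case (Pos a)
  then obtain b where "\<forall>p\<in>set (literal_constraints True b a). holds L v p"
    using literal_constraints_complete[of a v True] by auto
  then show ?case
    by (intro exI[of _ "of_bool b"]) simp
next
  case (Neg a)
  then obtain b where "\<forall>p\<in>set (literal_constraints False b a). holds L v p"
    using literal_constraints_complete[of a v False] by auto
  then show ?case
    by (intro exI[of _ "of_bool b"]) simp
next
  case (Conj m m')
  then obtain g1 g2 where "g1 < 2 ^ nodes m" "\<forall>p\<in>set (constraints m True g1). holds L v p"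
    "g2 < 2 ^ nodes m'" "\<forall>p\<in>set (constraints m' True g2). holds L v p"
    by auto
  moreover from this obtain g where "g < 2 ^ Suc (nodes m + nodes m')"
    "g div 2 = g1 + 2 ^ nodes m * g2" "g div 2 div 2 ^ nodes m = g2"
    using ex_guess_append[of g1 "nodes m" g2 "nodes m'" 0] by auto
  ultimately show ?case
    using constraints_add[of m True g1 g2] by (intro exI[of _ g]) auto
next
  case (Disj m m')
  show ?case
  proof (cases "sat_matrix rel v m")
    case True
    then obtain g1 where g1: "g1 < 2 ^ nodes m" "\<forall>p\<in>set (constraints m True g1). holds L v p"
      using Disj by auto
    \<comment> \<open>The rejected disjunct is inactive and yields no constraints, so its part of
      the guess is filled with 0.\<close>
    obtain g where "g < 2 ^ Suc (nodes m + nodes m')" "g mod 2 = 1" "g div 2 = g1 + 2 ^ nodes m * 0"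
      using ex_guess_append[OF g1(1), of 0 "nodes m'" 1] by auto
    then show ?thesis
      using g1(2) odd_iff_mod_2_eq_one[of g] by (intro exI[of _ g]) (simp only: constraints.simps nodes.simps, simp)
  next
    case False
    then obtain g2 where g2: "g2 < 2 ^ nodes m'" "\<forall>p\<in>set (constraints m' True g2). holds L v p"
      using Disj by auto
    obtain g where "g < 2 ^ Suc (nodes m + nodes m')" "g mod 2 = 0" "g div 2 div 2 ^ nodes m = g2"
      using ex_guess_append[OF _ g2(1), of 0 "nodes m" 0] by auto
    then show ?thesis
      using g2(2) even_iff_mod_2_eq_zero[of g] by (intro exI[of _ g]) (simp only: constraints.simps nodes.simps, simp)
  qed
qed

end

text \<open>A redundant code for numbers up to \<open>k\<close>: every \<open>k\<close>-bit string
  is a legal code word and decoding needs only halving and addition. The waste is harmless because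
  it is applied with the constant C.\<close>

primrec popcount :: "nat \<Rightarrow> nat \<Rightarrow> nat" where
  "popcount 0 g = 0"
| "popcount (Suc k) g = g mod 2 + popcount k (g div 2)"

lemma ex_popcount: "j \<le> k \<Longrightarrow> \<exists>g<2 ^ k. popcount k g = j"
proof (induction k arbitrary: j)
  case (Suc k)
  \<comment> \<open>By truncated subtraction, \<open>j - (j - 1)\<close> is 0 for
    \<open>j = 0\<close> and 1 otherwise.\<close>
  have "\<exists>j'\<le>k. \<exists>b<2. j = b + j'"
    using Suc.prems by (intro exI[of _ "j - 1"]) (auto intro: exI[of _ "j - (j - 1)"])
  then obtain b j' where b: "b < 2" "j' \<le> k" "j = b + j'"
    by auto
  obtain g where "g < 2 ^ k" "popcount k g = j'"
    using Suc.IH b(2) by blast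
  then show ?case
    using b by (intro exI[of _ "b + 2 * g"]) auto
qed simp

lemma popcount_add: "popcount k (g + 2 ^ k * h) = popcount k g"
proof (induction k arbitrary: g)
  case (Suc k)
  have "popcount (Suc k) (g + 2 ^ Suc k * h) = (g + 2 ^ Suc k * h) mod 2 + popcount k (g div 2 + 2 ^ k * h)"
    by (simp only: popcount.simps add_mult_pow_div_2)
  also have "(g + 2 ^ Suc k * h) mod 2 = g mod 2"
    by (simp add: mult.assoc)
  finally show ?case
    using Suc by simp
qed simp

text \<open>
  Each variable of the prefix consumes \<open>C\<close> bits of the guess, whose digit sum selects an entry of
  the list \<open>st\<close> of least elements of chains.
\<close>

primrec choose_starts ::
  "nat \<Rightarrow> (nat \<Rightarrow> nat) \<Rightarrow> nat list \<Rightarrow> nat \<Rightarrow> (nat \<Rightarrow> nat) \<times> nat \<Rightarrow> (nat \<Rightarrow> nat) \<times> nat" where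
  "choose_starts C st [] g s = s"
| "choose_starts C st (x # xs) g s =
     (let a = st (popcount C g) in
      choose_starts C st xs (g div 2 ^ C) ((fst s)(x := a), if a = 0 then 1 else snd s))"

lemma choose_starts_add:
  "choose_starts C st xs (g + 2 ^ (C * length xs) * h) s = choose_starts C st xs g s"
proof (induction xs arbitrary: g s)
  case (Cons x xs)
  have "popcount C (g + 2 ^ (C * length (x # xs)) * h) = popcount C g"
    using popcount_add[of C g "2 ^ (C * length xs) * h"] by (simp add: power_add mult.assoc)
  moreover have "(g + 2 ^ (C * length (x # xs)) * h) div 2 ^ C = g div 2 ^ C + 2 ^ (C * length xs) * h"
    using add_mult_pow_div[of g C "C * length xs" h] by simp
  ultimately show ?case
    using Cons by (simp only: choose_starts.simps)
qed simp

text \<open>\<open>X\<close> collects the variables assigned so far, which makes the induction go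
  through. Success of the run means that no selected entry of \<open>st\<close> was 0.\<close>

lemma choose_starts_sound:
  assumes "choose_starts C st xs g (v, f) = (v', 0)"
    and "f = 0 \<longrightarrow> (\<forall>x\<in>X. v x \<in> A)" "\<And>j. st j \<noteq> 0 \<Longrightarrow> st j \<in> A"
  shows "\<forall>x\<in>X \<union> set xs. v' x \<in> A"
  using assms(1,2)
proof (induction xs arbitrary: g v f X)
  case (Cons x xs)
  let ?a = "st (popcount C g)"
  have "choose_starts C st xs (g div 2 ^ C) (v(x := ?a), if ?a = 0 then 1 else f) = (v', 0)"
    using Cons.prems(1) by (simp only: choose_starts.simps Let_def fst_conv snd_conv)
  moreover have "(if ?a = 0 then 1 else f) = 0 \<longrightarrow> (\<forall>y\<in>insert x X. (v(x := ?a)) y \<in> A)"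
    using Cons.prems(2) assms(3)[of "popcount C g"] by auto
  ultimately have "\<forall>y\<in>insert x X \<union> set xs. v' y \<in> A"
    by (rule Cons.IH)
  then show ?case
    by auto
qed simp

text \<open>The alternative \<open>P x (v x)\<close> carries a good value of \<open>x\<close> past
  the remaining variables, also when the prefix quantifies \<open>x\<close> again.\<close>

lemma choose_starts_complete:
  assumes "\<forall>x\<in>set xs. \<exists>j\<le>C. st j \<noteq> 0 \<and> P x (st j)"
  shows "\<exists>g<2 ^ (C * length xs). \<forall>v. \<exists>v'. choose_starts C st xs g (v, 0) = (v', 0) \<and>
    (\<forall>x. x \<in> set xs \<or> P x (v x) \<longrightarrow> P x (v' x))"
  using assms
proof (induction xs)
  case Nil
  then show ?case
    by simp
next
  case (Cons x xs)
  then obtain g2 where g2: "g2 < 2 ^ (C * length xs)" "\<And>v. \<exists>v'. choose_starts C st xs g2 (v, 0) = (v', 0) \<and>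
    (\<forall>x. x \<in> set xs \<or> P x (v x) \<longrightarrow> P x (v' x))"
    by auto
  obtain j where j: "j \<le> C" "st j \<noteq> 0" "P x (st j)"
    using Cons.prems by auto
  then obtain g1 where g1: "g1 < 2 ^ C" "popcount C g1 = j"
    using ex_popcount by blast
  show ?case
  proof (intro exI[of _ "g1 + 2 ^ C * g2"] conjI allI)
    have "g1 + 2 ^ C * g2 < 2 ^ C * Suc g2"
      using g1(1) by simp
    also have "\<dots> \<le> 2 ^ C * 2 ^ (C * length xs)"
      using g2(1) by (intro mult_left_mono) auto
    finally show "g1 + 2 ^ C * g2 < 2 ^ (C * length (x # xs))"
      by (simp add: power_add)
    fix v
    obtain v' where v': "choose_starts C st xs g2 (v(x := st j), 0) = (v', 0)"
      "\<forall>y. y \<in> set xs \<or> P y ((v(x := st j)) y) \<longrightarrow> P y (v' y)"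
      using g2(2) by blast
    have "choose_starts C st (x # xs) (g1 + 2 ^ C * g2) (v, 0) = (v', 0)"
      using v'(1) g1 j(2) popcount_add[of C g1 g2] by (simp add: Let_def)
    moreover have "\<forall>y. y \<in> set (x # xs) \<or> P y (v y) \<longrightarrow> P y (v' y)"
      using v'(2) j(3) by auto
    ultimately show "\<exists>v'. choose_starts C st (x # xs) (g1 + 2 ^ C * g2) (v, 0) = (v', 0) \<and>
       (\<forall>y. y \<in> set (x # xs) \<or> P y (v y) \<longrightarrow> P y (v' y))"
      by blast
  qed
qed

text \<open>\<open>v\<close> and \<open>c\<close> stand for the values and the change flag found in
  memory when the guess is tried; they are whatever earlier guesses left behind.\<close>

definition accepts ::
  "(nat \<Rightarrow> nat \<Rightarrow> bool) \<Rightarrow> (nat \<Rightarrow> nat) \<Rightarrow> (nat \<Rightarrow> nat) \<Rightarrow> nat \<Rightarrow> nat \<Rightarrow> ex_formula \<Rightarrow> nat \<Rightarrow>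
    (nat \<Rightarrow> nat) \<Rightarrow> nat \<Rightarrow> bool" where
  "accepts L nx st C k \<phi> g v c \<longleftrightarrow>
     (let (v', f) = choose_starts C st (fst \<phi>) g (v, 0) in
      snd ((pass L nx (constraints (snd \<phi>) True (g div 2 ^ (C * length (fst \<phi>)))) ^^ k) (v', c, f)) = (0, 0))"

context indexed_poset
begin

lemma accepts_sound:
  assumes nx: "\<And>a. nx a \<noteq> 0 \<Longrightarrow> lt a (nx a)"
    and st: "\<And>j. st j \<noteq> 0 \<Longrightarrow> st j \<in> {1..n}"
    and "is_sentence \<phi>" "0 < k" "accepts L nx st C k \<phi> g v c"
  shows "\<exists>\<sigma>. (\<forall>x\<in>set (fst \<phi>). \<sigma> x \<in> {1..n}) \<and> sat_matrix rel \<sigma> (snd \<phi>)"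
proof -
  let ?ps = "constraints (snd \<phi>) True (g div 2 ^ (C * length (fst \<phi>)))"
  obtain v1 f1 where 1: "choose_starts C st (fst \<phi>) g (v, 0) = (v1, f1)"
    by fastforce
  have 2: "f1 = 0 \<longrightarrow> (\<forall>x\<in>set (fst \<phi>). v1 x \<in> {1..n})"
    using choose_starts_sound[of C st "fst \<phi>" g v 0 v1 "{}" "{1..n}"] 1 st by auto
  obtain k' where k: "k = Suc k'"
    using assms(4) by (cases k) auto
  obtain \<sigma> where "(pass L nx ?ps ^^ Suc k') (v1, c, f1) = (\<sigma>, 0, 0)"
    using assms(5) 1 by (auto simp: accepts_def k) (metis prod.collapse)
  then have \<sigma>: "(\<forall>x\<in>set (fst \<phi>). \<sigma> x \<in> {1..n}) \<and> (\<forall>p\<in>set ?ps. holds L \<sigma> p)"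
    using passes_sound[where ps = ?ps, OF nx 2] by blast
  then show ?thesis
    using constraints_sound[of "snd \<phi>" \<sigma>] assms(3) unfolding is_sentence_def by blast
qed

text \<open>The bound on \<open>k\<close> exceeds the largest potential, n for each variable, and
  \<open>reach\<close> allows every variable to start on the chain of its value in \<sigma>.\<close>

lemma accepts_complete:
  assumes nx: "\<And>a. nx a \<noteq> 0 \<Longrightarrow> lt a (nx a)" and "nx 0 = 0"
    and reach: "\<And>a. a \<in> {1..n} \<Longrightarrow> \<exists>j\<le>C. \<exists>i. st j \<noteq> 0 \<and> (nx ^^ i) (st j) = a"
    and "is_sentence \<phi>" "length (fst \<phi>) * n < k"
    and \<sigma>: "\<forall>x\<in>set (fst \<phi>). \<sigma> x \<in> {1..n}" "sat_matrix rel \<sigma> (snd \<phi>)"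
  shows "\<exists>g<2 ^ (C * length (fst \<phi>) + nodes (snd \<phi>)). \<forall>v c. accepts L nx st C k \<phi> g v c"
proof -
  let ?V = "set (fst \<phi>)" and ?K = "C * length (fst \<phi>)"
  obtain g2 where g2: "g2 < 2 ^ nodes (snd \<phi>)"
    "\<forall>p\<in>set (constraints (snd \<phi>) True g2). holds L \<sigma> p"
    using constraints_complete[OF _ \<sigma>(2)] \<sigma>(1) assms(4) unfolding is_sentence_def by blast
  have "\<forall>x\<in>?V. \<exists>j\<le>C. st j \<noteq> 0 \<and> (\<exists>i. (nx ^^ i) (st j) = \<sigma> x)"
    using reach \<sigma>(1) by blast
  from choose_starts_complete[OF this] obtain g1 where g1: "g1 < 2 ^ ?K"
    "\<And>v. \<exists>v'. choose_starts C st (fst \<phi>) g1 (v, 0) = (v', 0) \<and> (\<forall>x\<in>?V. \<exists>i. (nx ^^ i) (v' x) = \<sigma> x)"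
    by blast
  show ?thesis
  proof (intro exI[of _ "g1 + 2 ^ ?K * g2"] conjI allI)
    have "g1 + 2 ^ ?K * g2 < 2 ^ ?K * Suc g2"
      using g1(1) by simp
    also have "\<dots> \<le> 2 ^ ?K * 2 ^ nodes (snd \<phi>)"
      using g2(1) by (intro mult_left_mono) auto
    finally show "g1 + 2 ^ ?K * g2 < 2 ^ (?K + nodes (snd \<phi>))"
      by (simp add: power_add)
    fix v c
    obtain v' where v': "choose_starts C st (fst \<phi>) g1 (v, 0) = (v', 0)"
      "\<forall>x\<in>?V. \<exists>i. (nx ^^ i) (v' x) = \<sigma> x"
      using g1(2) by blast
    have "below nx ?V v' \<sigma>"
      using v'(2) \<sigma>(1) by (auto simp: below_def)
    moreover have "potential ?V v' < k"
      using potential_le[of ?V v'] card_length[of "fst \<phi>"] assms(5)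
      by (meson le_less_trans mult_le_mono1)
    moreover have "\<forall>p\<in>set (constraints (snd \<phi>) True g2). holds L \<sigma> p \<and> constraint_vars p \<subseteq> ?V"
      using g2(2) constraints_vars assms(4) unfolding is_sentence_def by blast
    ultimately obtain u where "(pass L nx (constraints (snd \<phi>) True g2) ^^ k) (v', c, 0) = (u, 0, 0)"
      using passes_complete[OF nx assms(2) finite_set] by blast
    then show "accepts L nx st C k \<phi> (g1 + 2 ^ ?K * g2) v c"
      using v'(1) g1(1) by (simp add: accepts_def choose_starts_add)
  qed
qed

end

section \<open>The program\<close>

text \<open>
  Array 0 holds the scalars: register \<open>rx\<close> is cell \<open>(0, rx)\<close>. The arrays hold the row offsets of
  the adjacency matrix, the successors, predecessors and labels of the chain partition, the
  least elements of the chains, and the values of the variables.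
\<close>

abbreviation (input) rN :: nat where "rN \<equiv> 0"
abbreviation (input) rn :: nat where "rn \<equiv> 2"
abbreviation (input) ra :: nat where "ra \<equiv> 3"
abbreviation (input) rb :: nat where "rb \<equiv> 4"
abbreviation (input) racc :: nat where "racc \<equiv> 5"
abbreviation (input) rbest :: nat where "rbest \<equiv> 6"
abbreviation (input) rba :: nat where "rba \<equiv> 7"
abbreviation (input) rbb :: nat where "rbb \<equiv> 8"
abbreviation (input) rj :: nat where "rj \<equiv> 9"
abbreviation (input) rC :: nat where "rC \<equiv> 10"
abbreviation (input) rD :: nat where "rD \<equiv> 11"
abbreviation (input) rcnt :: nat where "rcnt \<equiv> 12"
abbreviation (input) rk :: nat where "rk \<equiv> 13"
abbreviation (input) rfs :: nat where "rfs \<equiv> 14"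
abbreviation (input) rg :: nat where "rg \<equiv> 15"
abbreviation (input) rG :: nat where "rG \<equiv> 16"
abbreviation (input) rp :: nat where "rp \<equiv> 17"
abbreviation (input) rdone :: nat where "rdone \<equiv> 18"
abbreviation (input) rbit :: nat where "rbit \<equiv> 19"
abbreviation (input) rv :: nat where "rv \<equiv> 20"
abbreviation (input) rpw :: nat where "rpw \<equiv> 21"
abbreviation (input) rgo :: nat where "rgo \<equiv> 22"
abbreviation (input) rpop :: nat where "rpop \<equiv> 23"
abbreviation (input) rfail :: nat where "rfail \<equiv> 24"
abbreviation (input) rms :: nat where "rms \<equiv> 25"
abbreviation (input) rgm :: nat where "rgm \<equiv> 26"
abbreviation (input) rchg :: nat where "rchg \<equiv> 27"
abbreviation (input) rS :: nat where "rS \<equiv> 28"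
abbreviation (input) ract :: nat where "ract \<equiv> 29"
abbreviation (input) rbin :: nat where "rbin \<equiv> 30"
abbreviation (input) rpol :: nat where "rpol \<equiv> 31"
abbreviation (input) rat :: nat where "rat \<equiv> 32"
abbreviation (input) rx :: nat where "rx \<equiv> 33"
abbreviation (input) ry :: nat where "ry \<equiv> 34"
abbreviation (input) rans :: nat where "rans \<equiv> 35"

abbreviation (input) aRow :: nat where "aRow \<equiv> 2"
abbreviation (input) aNx :: nat where "aNx \<equiv> 3"
abbreviation (input) aPv :: nat where "aPv \<equiv> 4"
abbreviation (input) aLab :: nat where "aLab \<equiv> 5"
abbreviation (input) aSt :: nat where "aSt \<equiv> 6"
abbreviation (input) aVal :: nat where "aVal \<equiv> 7"

abbreviation V :: "nat \<Rightarrow> expr" where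
  "V i \<equiv> At 0 (Num i)"

abbreviation assign_reg :: "nat \<Rightarrow> expr \<Rightarrow> cmd" (infix \<open>::=\<close> 65) where
  "i ::= e \<equiv> Assign 0 (Num i) e"

abbreviation incr :: "nat \<Rightarrow> nat \<Rightarrow> cmd" where
  "incr i c \<equiv> i ::= Plus (V i) (Num c)"

definition decode_step :: cmd where
  "decode_step =
     Cond (V rgo)
       (Cond (Inp (V rp))
          (Cond (Inp (Plus (V rp) (Num 1))) (rv ::= Plus (V rv) (V rpw)) Skip ;;
           rpw ::= Plus (V rpw) (V rpw) ;; incr rp 2)
          (incr rp 1 ;; rgo ::= Num 0))
       Skip"

text \<open>The length of a code is not known beforehand, so the input length serves as the number
  of rounds; \<open>rgo\<close> silences the rounds after the terminator.\<close>

definition decode :: cmd where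
  "decode = rv ::= Num 0 ;; rpw ::= Num 1 ;; rgo ::= Num 1 ;; Loop rN decode_step"

definition next_bit :: cmd where
  "next_bit = rbit ::= Minus (V rG) (Plus (Halve (V rG)) (Halve (V rG))) ;; rG ::= Halve (V rG)"

definition count_step :: cmd where
  "count_step = next_bit ;; rpop ::= Plus (V rpop) (V rbit)"

definition prefix_var :: cmd where
  "prefix_var = incr rp 1 ;; decode ;; rpop ::= Num 0 ;; Loop rC count_step ;;
     Assign aVal (V rv) (At aSt (V rpop)) ;; Cond (At aVal (V rv)) Skip (rfail ::= Num 1)"

definition prefix_step :: cmd where
  "prefix_step = Cond (V rdone) Skip (Cond (Inp (V rp)) prefix_var (rdone ::= Num 1 ;; incr rp 1))"

definition bump_cmd :: "nat \<Rightarrow> cmd" where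
  "bump_cmd z = Assign aVal (V z) (At aNx (At aVal (V z))) ;; rchg ::= Num 1 ;;
     Cond (At aVal (V z)) Skip (rfail ::= Num 1)"

definition enforce_cmd :: "bool \<Rightarrow> nat \<Rightarrow> nat \<Rightarrow> cmd" where
  "enforce_cmd b x y =
     (let e = Inp (Plus (At aRow (At aVal (V x))) (At aVal (V y))) in
      if b then Cond e Skip (bump_cmd y) else Cond e (bump_cmd x) Skip)"

definition enforce_literal :: cmd where
  "enforce_literal =
     Cond (V ract)
       (Cond (V rpol)
          (enforce_cmd True rx ry ;; Cond (V rat) Skip (enforce_cmd True ry rx))
          (Cond (V rat) (enforce_cmd False rx ry)
             (Cond (V rbit) (enforce_cmd False ry rx) (enforce_cmd False rx ry))))
       Skip"

definition literal_cmd :: cmd where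
  "literal_cmd = rat ::= Inp (V rp) ;; incr rp 1 ;;
     decode ;; rx ::= V rv ;; decode ;; ry ::= V rv ;; enforce_literal"

text \<open>
  The activity flags of the nodes still to be visited form a stack of bits, stored as a number
  whose leading 1 marks the bottom.
\<close>

definition branch_cmd :: cmd where
  "branch_cmd = rS ::= Plus (V rS) (V rS) ;; rS ::= Plus (V rS) (V rS) ;;
     Cond (V ract) (Cond (V rpol) (incr rS 3) (Cond (V rbit) (incr rS 1) (incr rS 2))) Skip"

definition node_head :: cmd where
  "node_head = ract ::= Minus (V rS) (Plus (Halve (V rS)) (Halve (V rS))) ;; rS ::= Halve (V rS) ;;
     rbin ::= Inp (V rp) ;; rpol ::= Inp (Plus (V rp) (Num 1)) ;; incr rp 2 ;; next_bit"

text \<open>\<open>Halve (V rS)\<close> vanishes once only the bottom marker is left, so surplus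
  rounds do nothing.\<close>

definition node_cmd :: cmd where
  "node_cmd = Cond (Halve (V rS)) (node_head ;; Cond (V rbin) branch_cmd literal_cmd) Skip"

text \<open>The initial stack 3, binary 11, is the bottom marker below an active flag for the
  root.\<close>

definition pass_cmd :: cmd where
  "pass_cmd = rp ::= V rms ;; rG ::= V rgm ;; rchg ::= Num 0 ;; rS ::= Num 3 ;; Loop rN node_cmd"

text \<open>\<open>rms\<close> and \<open>rgm\<close> save where the matrix and its part of the
  guess begin, since every pass reads both again.\<close>

definition prefix_cmd :: cmd where
  "prefix_cmd = rG ::= V rg ;; rp ::= V rfs ;; rdone ::= Num 0 ;; rfail ::= Num 0 ;;
     Loop rN prefix_step ;; rms ::= V rp ;; rgm ::= V rG"

text \<open>Two nested loops provide N N passes, more than the number of variables times n. The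
  answer \<open>rans\<close> is set but never cleared.\<close>

definition check_cmd :: cmd where
  "check_cmd = prefix_cmd ;; Loop rN (Loop rN pass_cmd) ;;
     Cond (V rchg) Skip (Cond (V rfail) Skip (rans ::= Num 1)) ;; incr rg 1"

lemmas prog_defs = decode_step_def decode_def next_bit_def count_step_def prefix_var_def
  prefix_step_def bump_cmd_def enforce_cmd_def enforce_literal_def literal_cmd_def branch_cmd_def
  node_head_def node_cmd_def pass_cmd_def prefix_cmd_def check_cmd_def

section \<open>Cells written by the parts of the program\<close>

lemma mods_decode_step: "mods decode_step = {(0, rv), (0, rpw), (0, rp), (0, rgo)}"
  by (auto simp: decode_step_def)

lemma mods_decode: "mods decode = {(0, rv), (0, rpw), (0, rp), (0, rgo)}"
  by (auto simp: decode_def mods_decode_step)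

lemma mods_next_bit: "mods next_bit = {(0, rbit), (0, rG)}"
  by (auto simp: next_bit_def)

lemma mods_count_step: "mods count_step = {(0, rbit), (0, rG), (0, rpop)}"
  by (auto simp: count_step_def mods_next_bit)

lemma mods_prefix_step: "mods prefix_step =
    {(0, rv), (0, rpw), (0, rp), (0, rgo), (0, rbit), (0, rG), (0, rpop), (0, rfail), (0, rdone)} \<union> {aVal} \<times> UNIV"
  by (auto simp: prefix_step_def prefix_var_def mods_decode mods_count_step)

lemma mods_enforce_cmd: "mods (enforce_cmd b x y) = {(0, rchg), (0, rfail)} \<union> {aVal} \<times> UNIV"
  by (auto simp: enforce_cmd_def bump_cmd_def Let_def)

lemma mods_enforce_literal: "mods enforce_literal = {(0, rchg), (0, rfail)} \<union> {aVal} \<times> UNIV"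
  by (auto simp: enforce_literal_def mods_enforce_cmd)

lemma mods_literal_cmd: "mods literal_cmd =
    {(0, rat), (0, rp), (0, rv), (0, rpw), (0, rgo), (0, rx), (0, ry), (0, rchg), (0, rfail)} \<union> {aVal} \<times> UNIV"
  by (auto simp: literal_cmd_def mods_decode mods_enforce_literal)

lemma mods_node_cmd: "mods node_cmd =
    {(0, rat), (0, rp), (0, rv), (0, rpw), (0, rgo), (0, rx), (0, ry), (0, rchg), (0, rfail),
     (0, ract), (0, rS), (0, rbin), (0, rpol), (0, rbit), (0, rG)} \<union> {aVal} \<times> UNIV"
  by (auto simp: node_cmd_def node_head_def branch_cmd_def mods_literal_cmd mods_next_bit)

lemma mods_pass_cmd: "mods pass_cmd = mods node_cmd"
  by (auto simp: pass_cmd_def mods_node_cmd)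

lemma mods_check_cmd: "mods check_cmd = {(0, rms), (0, rgm), (0, rans), (0, rg), (0, rdone), (0, rpop)} \<union> mods node_cmd"
  by (auto simp: check_cmd_def prefix_cmd_def mods_node_cmd mods_pass_cmd mods_prefix_step)

subsection \<open>Reading the formula\<close>

lemma input_at_drop: "drop p w = b # r \<Longrightarrow> input_at w p = of_bool b"
proof -
  assume *: "drop p w = b # r"
  then have "p < length w"
    by (metis drop_all leI list.discI)
  with * show ?thesis
    by (simp add: input_at_def flip: Cons_nth_drop_Suc)
qed

lemma drop_Suc_Cons: "drop p w = b # r \<Longrightarrow> drop (Suc p) w = r"
  by (simp add: drop_Suc flip: tl_drop)

lemma drop_add_append: "drop p w = u @ r \<Longrightarrow> drop (p + length u) w = r"
proof -
  assume "drop p w = u @ r"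
  then have "drop (length u) (drop p w) = r"
    by simp
  then show ?thesis
    by (simp add: add.commute)
qed

text \<open>Each round consumes at least one bit of the code, so its length is a sufficient number
  of rounds; \<open>rpw\<close> is the weight of the next binary digit.\<close>

lemma sem_decode_iter:
  assumes "drop (s (0, rp)) w = enc_nat x @ r" "s (0, rgo) = 1" "length (enc_nat x) \<le> k"
  shows "(sem w decode_step ^^ k) s (0, rv) = s (0, rv) + s (0, rpw) * x \<and>
    (sem w decode_step ^^ k) s (0, rp) = s (0, rp) + length (enc_nat x)"
  using assms
proof (induction x arbitrary: s k rule: enc_nat.induct)
  case (1 x)
  have "enc_nat x \<noteq> []"
    by (simp add: enc_nat.simps)
  then obtain k' where k: "k = Suc k'"
    using 1(4) by (cases k) auto
  let ?s = "sem w decode_step s"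
  have k_iter: "(sem w decode_step ^^ k) s = (sem w decode_step ^^ k') ?s"
    by (simp add: k funpow_swap1)
  show ?case
  proof (cases "x = 0")
    case True
    have d0: "drop (s (0, rp)) w = False # r"
      using 1(2) True by (simp add: enc_nat.simps)
    have s: "?s (0, rv) = s (0, rv)" "?s (0, rp) = s (0, rp) + 1" "?s (0, rgo) = 0"
      using 1(3) by (auto simp: decode_step_def input_at_drop[OF d0])
    have "(sem w decode_step ^^ k') t = t" if "t (0, rgo) = 0" for t
      by (induction k') (auto simp: decode_step_def that)
    then show ?thesis
      using s True by (simp add: k_iter enc_nat.simps)
  next
    case False
    have enc: "enc_nat x = True # odd x # enc_nat (x div 2)"
      using False by (simp add: enc_nat.simps[of x])
    have d0: "drop (s (0, rp)) w = True # odd x # enc_nat (x div 2) @ r"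
      using 1(2) enc by simp
    have d1: "drop (Suc (s (0, rp))) w = odd x # enc_nat (x div 2) @ r"
      using drop_Suc_Cons[OF d0] .
    have d2: "drop (s (0, rp) + 2) w = enc_nat (x div 2) @ r"
      using drop_Suc_Cons[OF d1] by simp
    have s: "?s (0, rv) = s (0, rv) + of_bool (odd x) * s (0, rpw)" "?s (0, rpw) = 2 * s (0, rpw)"
      "?s (0, rp) = s (0, rp) + 2" "?s (0, rgo) = 1"
      using 1(3) by (auto simp: decode_step_def input_at_drop[OF d0] input_at_drop[OF d1])
    have "length (enc_nat (x div 2)) \<le> k'"
      using 1(4) by (simp add: enc k)
    from 1(1)[of ?s k', OF False _ s(4) this] d2
    have IH: "(sem w decode_step ^^ k') ?s (0, rv) = ?s (0, rv) + ?s (0, rpw) * (x div 2)"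
       "(sem w decode_step ^^ k') ?s (0, rp) = ?s (0, rp) + length (enc_nat (x div 2))"
      by (simp_all only: s)
    have "x = of_bool (odd x) + 2 * (x div 2)"
      by (cases "even x") auto
    then have "s (0, rpw) * x = s (0, rpw) * (of_bool (odd x) + 2 * (x div 2))"
      by (rule arg_cong)
    then have "s (0, rpw) * x = of_bool (odd x) * s (0, rpw) + 2 * s (0, rpw) * (x div 2)"
      by (simp only: distrib_left) (simp only: mult_ac)
    then show ?thesis
      using IH unfolding k_iter s enc by simp
  qed
qed

lemma sem_decode:
  assumes "drop (s (0, rp)) w = enc_nat x @ r" "s (0, rN) = length w"
  shows "sem w decode s (0, rv) = x" "sem w decode s (0, rp) = s (0, rp) + length (enc_nat x)"
proof -
  let ?s = "s((0, rv) := 0, (0, rpw) := 1, (0, rgo) := 1)"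
  have "length (enc_nat x @ r) \<le> length w"
    using assms(1) by (metis diff_le_self length_drop)
  then have "length (enc_nat x) \<le> length w"
    by simp
  then have "(sem w decode_step ^^ length w) ?s (0, rv) = x \<and>
      (sem w decode_step ^^ length w) ?s (0, rp) = s (0, rp) + length (enc_nat x)"
    using sem_decode_iter[of ?s w x r "length w"] assms(1) by simp
  then show "sem w decode s (0, rv) = x" "sem w decode s (0, rp) = s (0, rp) + length (enc_nat x)"
    using assms(2) by (simp_all add: decode_def)
qed

lemma sem_next_bit:
  "sem w next_bit s (0, rbit) = s (0, rG) mod 2" "sem w next_bit s (0, rG) = s (0, rG) div 2"
  by (simp_all add: next_bit_def) (simp add: minus_mult_div_eq_mod flip: mult_2)

lemma sem_count_iter:
  "(sem w count_step ^^ k) s (0, rpop) = s (0, rpop) + popcount k (s (0, rG)) \<and>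
   (sem w count_step ^^ k) s (0, rG) = s (0, rG) div 2 ^ k"
proof (induction k arbitrary: s)
  case (Suc k)
  have "sem w count_step s (0, rpop) = s (0, rpop) + s (0, rG) mod 2"
    "sem w count_step s (0, rG) = s (0, rG) div 2"
    by (simp_all add: count_step_def sem_next_bit sem_frame mods_next_bit)
  then show ?case
    using Suc[of "sem w count_step s"] by (simp add: funpow_swap1 div_mult2_eq)
qed simp

definition enc_var :: "nat \<Rightarrow> bool list" where
  "enc_var x = True # enc_nat x"

lemma sem_prefix_var:
  assumes "drop (s (0, rp)) w = enc_var x @ r" "s (0, rN) = length w"
  defines "s' \<equiv> sem w prefix_var s" and "a \<equiv> s (aSt, popcount (s (0, rC)) (s (0, rG)))"
  shows "s' (0, rp) = s (0, rp) + length (enc_var x)"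
    "s' (0, rG) = s (0, rG) div 2 ^ s (0, rC)"
    "s' (0, rfail) = (if a = 0 then 1 else s (0, rfail))"
    "s' (aVal, y) = (if y = x then a else s (aVal, y))"
proof -
  define s1 where "s1 = sem w (incr rp 1) s"
  define s2 where "s2 = sem w decode s1"
  define s3 where "s3 = sem w (Loop rC count_step) (sem w (rpop ::= Num 0) s2)"
  have s': "s' = sem w (Assign aVal (V rv) (At aSt (V rpop)) ;; Cond (At aVal (V rv)) Skip (rfail ::= Num 1)) s3"
    by (simp add: s'_def prefix_var_def s1_def s2_def s3_def)
  have "drop (s1 (0, rp)) w = enc_nat x @ r" "s1 (0, rN) = length w"
    using assms(1,2) drop_Suc_Cons[of "s (0, rp)" w] by (auto simp: s1_def enc_var_def)
  note decode = sem_decode[OF this, folded s2_def]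
  have "s1 (0, rp) = s (0, rp) + 1"
    by (simp add: s1_def)
  then have s2: "s2 (0, rv) = x" "s2 (0, rp) = s (0, rp) + length (enc_var x)"
    using decode by (simp_all add: enc_var_def)
  have s2_frame: "s2 l = s l" if "l \<notin> mods decode" for l
    using that sem_frame[OF that, of w s1] by (auto simp: s2_def s1_def mods_decode)
  have s3: "s3 (0, rpop) = popcount (s (0, rC)) (s (0, rG))" "s3 (0, rG) = s (0, rG) div 2 ^ s (0, rC)"
    by (simp_all add: s3_def sem_count_iter s2_frame mods_decode)
  have s3_frame: "s3 l = s2 l" if "l \<notin> mods count_step" for l
    using that by (auto simp: s3_def funpow_sem_frame mods_count_step)
  show "s' (0, rp) = s (0, rp) + length (enc_var x)"
    "s' (0, rG) = s (0, rG) div 2 ^ s (0, rC)"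
    "s' (0, rfail) = (if a = 0 then 1 else s (0, rfail))"
    "s' (aVal, y) = (if y = x then a else s (aVal, y))"
    by (auto simp: s' s3 s2 s3_frame s2_frame mods_count_step mods_decode a_def)
qed

definition vals :: "state \<Rightarrow> nat \<Rightarrow> nat" where
  "vals s = (\<lambda>x. s (aVal, x))"

text \<open>The strict bound on \<open>length xs\<close> leaves one round for the terminator; after
  it \<open>rdone\<close> blocks all further rounds.\<close>

lemma sem_prefix_iter:
  assumes "drop (s (0, rp)) w = concat (map enc_var xs) @ False # r" "s (0, rN) = length w"
    "s (0, rdone) = 0" "length xs < k"
  defines "s' \<equiv> (sem w prefix_step ^^ k) s" and "C \<equiv> s (0, rC)"
  shows "s' (0, rp) = s (0, rp) + length (concat (map enc_var xs)) + 1"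
    "s' (0, rG) = s (0, rG) div 2 ^ (C * length xs)"
    "(vals s', s' (0, rfail)) = choose_starts C (\<lambda>j. s (aSt, j)) xs (s (0, rG)) (vals s, s (0, rfail))"
proof -
  have "s' (0, rp) = s (0, rp) + length (concat (map enc_var xs)) + 1 \<and>
    s' (0, rG) = s (0, rG) div 2 ^ (C * length xs) \<and>
    (vals s', s' (0, rfail)) = choose_starts C (\<lambda>j. s (aSt, j)) xs (s (0, rG)) (vals s, s (0, rfail))"
    using assms(1-4) unfolding s'_def C_def
  proof (induction xs arbitrary: s k)
    case Nil
    obtain k' where k: "k = Suc k'"
      using Nil.prems(4) by (cases k) auto
    let ?s = "sem w prefix_step s"
    have "?s = s((0, rdone) := 1, (0, rp) := s (0, rp) + 1)"
      using input_at_drop[of "s (0, rp)" w False r] Nil.prems by (simp add: prefix_step_def)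
    moreover have "(sem w prefix_step ^^ k') t = t" if "t (0, rdone) \<noteq> 0" for t
      by (induction k') (use that in \<open>auto simp: prefix_step_def\<close>)
    ultimately have "(sem w prefix_step ^^ k) s = s((0, rdone) := 1, (0, rp) := s (0, rp) + 1)"
      by (simp add: k funpow_swap1)
    then show ?case
      by (simp add: vals_def)
  next
    case (Cons x xs)
    obtain k' where k: "k = Suc k'"
      using Cons.prems(4) by (cases k) auto
    let ?s = "sem w prefix_step s"
    let ?a = "s (aSt, popcount (s (0, rC)) (s (0, rG)))"
    have d: "drop (s (0, rp)) w = enc_var x @ concat (map enc_var xs) @ False # r"
      using Cons.prems(1) by simp
    have "?s = sem w prefix_var s"
      using Cons.prems(3) input_at_drop[of "s (0, rp)" w True] d by (simp add: prefix_step_def enc_var_def)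
    note s = sem_prefix_var[OF d Cons.prems(2), folded this]
    have fr: "?s (0, rN) = s (0, rN)" "?s (0, rC) = s (0, rC)" "?s (aSt, j) = s (aSt, j)" for j
      by (simp_all add: sem_frame mods_prefix_step)
    have not_done: "?s (0, rdone) = 0"
      using Cons.prems(3) \<open>?s = _\<close>
      by (simp add: prefix_var_def funpow_sem_frame mods_count_step sem_frame mods_decode)
    have "vals ?s = (vals s)(x := ?a)"
      using s(4) by (auto simp: vals_def)
    moreover have "drop (?s (0, rp)) w = concat (map enc_var xs) @ False # r"
      using drop_add_append[OF d] by (simp add: s(1))
    note IH = Cons.IH[OF this _ not_done, of k', unfolded fr]
    ultimately show ?case
      using IH Cons.prems(2,4) s(1-3)
      by (simp add: k funpow_swap1 Let_def power_add div_mult2_eq fun_upd_def)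
  qed
  then show "s' (0, rp) = s (0, rp) + length (concat (map enc_var xs)) + 1"
    "s' (0, rG) = s (0, rG) div 2 ^ (C * length xs)"
    "(vals s', s' (0, rfail)) = choose_starts C (\<lambda>j. s (aSt, j)) xs (s (0, rG)) (vals s, s (0, rfail))"
    by auto
qed

subsection \<open>One pass over the matrix\<close>

definition order_of :: "bool list \<Rightarrow> state \<Rightarrow> nat \<Rightarrow> nat \<Rightarrow> bool" where
  "order_of w s = (\<lambda>a b. input_at w (s (aRow, a) + b) \<noteq> 0)"

definition next_of :: "state \<Rightarrow> nat \<Rightarrow> nat" where
  "next_of s = (\<lambda>a. s (aNx, a))"

definition valuation_of :: "state \<Rightarrow> valuation" where
  "valuation_of s = (vals s, s (0, rchg), s (0, rfail))"

lemma order_next_frame: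
  assumes "\<And>a. (aRow, a) \<notin> mods c" "\<And>a. (aNx, a) \<notin> mods c"
  shows "order_of w (sem w c s) = order_of w s" "next_of (sem w c s) = next_of s"
  using assms by (simp_all add: order_of_def next_of_def sem_frame)

lemma sem_enforce_cmd:
  assumes "x \<in> {rx, ry}" "y \<in> {rx, ry}"
  shows "valuation_of (sem w (enforce_cmd b x y) s) =
    enforce (order_of w s) (next_of s) (b, s (0, x), s (0, y)) (valuation_of s)"
  using assms
  by (auto simp: enforce_cmd_def bump_cmd_def valuation_of_def vals_def order_of_def next_of_def
      bump_def fun_eq_iff Let_def)

lemma sem_enforce_literal:
  assumes "s (0, rat) = 0 \<Longrightarrow> a = Equal (s (0, rx)) (s (0, ry))"
    and "s (0, rat) \<noteq> 0 \<Longrightarrow> a = Leq (s (0, rx)) (s (0, ry))"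
  shows "valuation_of (sem w enforce_literal s) =
    fold (enforce (order_of w s) (next_of s))
      (if s (0, ract) = 0 then [] else literal_constraints (s (0, rpol) \<noteq> 0) (s (0, rbit) \<noteq> 0) a)
      (valuation_of s)"
  by (cases "s (0, rat) = 0")
    (simp_all add: assms enforce_literal_def sem_enforce_cmd order_next_frame sem_frame
      mods_enforce_cmd split: if_splits)

fun atom_args :: "atom \<Rightarrow> nat \<times> nat" where
  "atom_args (Equal x y) = (x, y)"
| "atom_args (Leq x y) = (x, y)"

fun is_leq :: "atom \<Rightarrow> bool" where
  "is_leq (Equal x y) = False"
| "is_leq (Leq x y) = True"

lemma enc_atom_alt: "enc_atom a = is_leq a # enc_nat (fst (atom_args a)) @ enc_nat (snd (atom_args a))"
  by (cases a) auto

lemma sem_literal_cmd: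
  assumes "drop (s (0, rp)) w = enc_atom a @ r" "s (0, rN) = length w"
  shows "sem w literal_cmd s (0, rp) = s (0, rp) + length (enc_atom a)"
    "valuation_of (sem w literal_cmd s) = fold (enforce (order_of w s) (next_of s))
      (if s (0, ract) = 0 then [] else literal_constraints (s (0, rpol) \<noteq> 0) (s (0, rbit) \<noteq> 0) a)
      (valuation_of s)"
proof -
  obtain x y where xy: "atom_args a = (x, y)"
    by (cases "atom_args a")
  have d0: "drop (s (0, rp)) w = is_leq a # enc_nat x @ enc_nat y @ r"
    using assms(1) xy by (simp add: enc_atom_alt)
  define s1 where "s1 = sem w (rat ::= Inp (V rp) ;; incr rp 1) s"
  define s2 where "s2 = sem w decode s1"
  define s3 where "s3 = sem w (rx ::= V rv) s2"
  define s4 where "s4 = sem w decode s3"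
  define s5 where "s5 = sem w (ry ::= V rv) s4"
  have s': "sem w literal_cmd s = sem w enforce_literal s5"
    by (simp add: literal_cmd_def s1_def s2_def s3_def s4_def s5_def)
  have d1: "drop (s1 (0, rp)) w = enc_nat x @ enc_nat y @ r" "s1 (0, rN) = length w"
    using drop_Suc_Cons[OF d0] assms(2) by (simp_all add: s1_def)
  note s2 = sem_decode[OF d1, folded s2_def]
  have d3: "drop (s3 (0, rp)) w = enc_nat y @ r" "s3 (0, rN) = length w"
    using drop_add_append[OF d1(1)] s2 d1(2) by (simp_all add: s3_def s2_def sem_frame mods_decode)
  note s4 = sem_decode[OF d3, folded s4_def]
  have s5: "s5 (0, rx) = x" "s5 (0, ry) = y" "s5 (0, rp) = s (0, rp) + length (enc_atom a)"
    "s5 (0, rat) = of_bool (is_leq a)"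
    using s4 s2 xy input_at_drop[OF d0]
    by (simp_all add: s5_def s4_def s3_def s2_def s1_def sem_frame mods_decode enc_atom_alt)
  have s5_frame: "s5 l = s l" if "l \<notin> mods literal_cmd" for l
    using that by (auto simp: s5_def s4_def s3_def s2_def s1_def sem_frame mods_decode mods_literal_cmd)
  have s5_chg: "s5 (0, rchg) = s (0, rchg)" "s5 (0, rfail) = s (0, rfail)" "s5 (aVal, z) = s (aVal, z)" for z
    by (auto simp: s5_def s4_def s3_def s2_def s1_def sem_frame mods_decode)
  show "sem w literal_cmd s (0, rp) = s (0, rp) + length (enc_atom a)"
    by (simp add: s' sem_frame mods_enforce_literal s5)
  have "order_of w s5 = order_of w s" "next_of s5 = next_of s" "valuation_of s5 = valuation_of s"
    by (simp_all add: order_of_def next_of_def valuation_of_def vals_def s5_frame s5_chg mods_literal_cmd)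
  moreover have "s5 (0, rat) = 0 \<Longrightarrow> a = Equal x y" "s5 (0, rat) \<noteq> 0 \<Longrightarrow> a = Leq x y"
    using xy s5(4) by (cases a; simp)+
  ultimately show "valuation_of (sem w literal_cmd s) = fold (enforce (order_of w s) (next_of s))
      (if s (0, ract) = 0 then [] else literal_constraints (s (0, rpol) \<noteq> 0) (s (0, rbit) \<noteq> 0) a)
      (valuation_of s)"
    using sem_enforce_literal[of s5 a w] by (simp add: s' s5 s5_frame mods_literal_cmd)
qed

lemma sem_node_head:
  assumes "drop (s (0, rp)) w = b # b' # r" "s (0, rS) = 2 * S + of_bool act"
  defines "s' \<equiv> sem w node_head s"
  shows "s' (0, ract) = of_bool act" "s' (0, rS) = S" "s' (0, rbin) = of_bool b"
    "s' (0, rpol) = of_bool b'" "s' (0, rp) = s (0, rp) + 2" "s' (0, rbit) = s (0, rG) mod 2"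
    "s' (0, rG) = s (0, rG) div 2" "valuation_of s' = valuation_of s"
    "order_of w s' = order_of w s" "next_of s' = next_of s" "s' (0, rN) = s (0, rN)"
    "drop (s' (0, rp)) w = r"
  using assms(2) input_at_drop[OF assms(1)] input_at_drop[OF drop_Suc_Cons[OF assms(1)]]
    drop_Suc_Cons[OF drop_Suc_Cons[OF assms(1)]]
  by (simp_all add: s'_def node_head_def sem_next_bit sem_frame mods_next_bit valuation_of_def vals_def
      order_of_def next_of_def)

text \<open>A subtree takes exactly one round per node and pops exactly its own flag. Positivity of
  the remaining stack \<open>S\<close> means that the marker is still below, so the loop does not
  fall idle inside the subtree.\<close>

lemma sem_nodes:
  assumes "drop (s (0, rp)) w = enc_matrix m @ r" "s (0, rN) = length w"
    "s (0, rS) = 2 * S + of_bool act" "0 < S"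
  defines "s' \<equiv> (sem w node_cmd ^^ nodes m) s"
  shows "s' (0, rp) = s (0, rp) + length (enc_matrix m) \<and> s' (0, rS) = S \<and>
    s' (0, rG) = s (0, rG) div 2 ^ nodes m \<and>
    valuation_of s' = fold (enforce (order_of w s) (next_of s)) (constraints m act (s (0, rG))) (valuation_of s)"
proof -
  have frame: "order_of w ((sem w node_cmd ^^ k) s) = order_of w s"
    "next_of ((sem w node_cmd ^^ k) s) = next_of s" "(sem w node_cmd ^^ k) s (0, rN) = s (0, rN)" for k s
    by (simp_all add: order_of_def next_of_def funpow_sem_frame mods_node_cmd)
  have head: "sem w node_cmd s = sem w (Cond (V rbin) branch_cmd literal_cmd) (sem w node_head s)"
    if "0 < S" "s (0, rS) = 2 * S + of_bool act" for s S act
    using that by (simp add: node_cmd_def)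
  have literal: "sem w node_cmd s (0, rp) = s (0, rp) + length [False, pol] + length (enc_atom a) \<and>
      sem w node_cmd s (0, rS) = S \<and> sem w node_cmd s (0, rG) = s (0, rG) div 2 \<and>
      valuation_of (sem w node_cmd s) = fold (enforce (order_of w s) (next_of s))
        (if act then literal_constraints pol (odd (s (0, rG))) a else []) (valuation_of s)"
    if "drop (s (0, rp)) w = [False, pol] @ enc_atom a @ r" "s (0, rN) = length w"
      "s (0, rS) = 2 * S + of_bool act" "0 < S" for s S act pol a r
  proof -
    have "drop (s (0, rp)) w = False # pol # enc_atom a @ r"
      using that(1) by simp
    note h = sem_node_head[OF this that(3)]
    have eq: "sem w node_cmd s = sem w literal_cmd (sem w node_head s)"
      using head[of S s act, OF that(4,3)] h(3) by simp
    have "sem w node_head s (0, rN) = length w"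
      using h(11) that(2) by simp
    note l = sem_literal_cmd[OF h(12) this]
    show ?thesis
      using l h by (simp add: eq sem_frame mods_literal_cmd odd_iff_mod_2_eq_one)
  qed
  \<comment> \<open>The stack \<open>S\<close> becomes 4 S + 2 r + l with the flags l and r of the
    children: the left child comes first in preorder and must lie on top.\<close>
  have branch: "sem w node_cmd s (0, rp) = s (0, rp) + 2 \<and>
      sem w node_cmd s (0, rS) = 2 * (2 * S + of_bool (if pol then act else act \<and> even (s (0, rG)))) +
        of_bool (if pol then act else act \<and> odd (s (0, rG))) \<and>
      sem w node_cmd s (0, rG) = s (0, rG) div 2 \<and>
      valuation_of (sem w node_cmd s) = valuation_of s \<and> drop (s (0, rp) + 2) w = r"
    if "drop (s (0, rp)) w = [True, pol] @ r" "s (0, rS) = 2 * S + of_bool act" "0 < S" for s S act pol r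
  proof -
    have "drop (s (0, rp)) w = True # pol # r"
      using that(1) by simp
    note h = sem_node_head[OF this that(2)]
    have eq: "sem w node_cmd s = sem w branch_cmd (sem w node_head s)"
      using head[of S s act, OF that(3,2)] h(3) by simp
    show ?thesis
      using h by (auto simp: eq branch_cmd_def odd_iff_mod_2_eq_one even_iff_mod_2_eq_zero
          valuation_of_def vals_def)
  qed
  show ?thesis
    using assms(1-4) unfolding s'_def
  proof (induction m arbitrary: s S act r)
    case (Pos a)
    then show ?case
      using literal[of s True a r S act] by simp
  next
    case (Neg a)
    then show ?case
      using literal[of s False a r S act] by simp
  next
    case (Conj m1 m2)
    have "drop (s (0, rp)) w = [True, True] @ enc_matrix m1 @ enc_matrix m2 @ r"
      using Conj.prems(1) by simp
    note b = branch[OF this Conj.prems(3,4)]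
    let ?s1 = "sem w node_cmd s"
    let ?s2 = "(sem w node_cmd ^^ nodes m1) ?s1"
    have N: "?s1 (0, rN) = length w" "?s2 (0, rN) = length w"
      using frame(3)[of 1 s] frame(3)[of "nodes m1" ?s1] Conj.prems(2) by simp_all
    have "drop (?s1 (0, rp)) w = enc_matrix m1 @ enc_matrix m2 @ r"
      "?s1 (0, rS) = 2 * (2 * S + of_bool act) + of_bool act" "0 < 2 * S + of_bool act"
      using b Conj.prems(4) by auto
    note IH1 = Conj.IH(1)[OF this(1) N(1) this(2,3)]
    have "drop (?s2 (0, rp)) w = enc_matrix m2 @ r"
      using IH1 drop_add_append[OF \<open>drop (?s1 (0, rp)) w = _\<close>] by simp
    note IH2 = Conj.IH(2)[OF this N(2) _ Conj.prems(4), of act]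
    have "(sem w node_cmd ^^ nodes (Conj m1 m2)) s = (sem w node_cmd ^^ nodes m2) ?s2"
      by (simp only: nodes.simps funpow.simps(2) funpow_swap1 comp_apply funpow_add_apply)
    then show ?case
      using b IH1 IH2 frame[of 1 s] frame[of "nodes m1" ?s1]
      by (simp add: power_add div_mult2_eq)
  next
    case (Disj m1 m2)
    have "drop (s (0, rp)) w = [True, False] @ enc_matrix m1 @ enc_matrix m2 @ r"
      using Disj.prems(1) by simp
    note b = branch[OF this Disj.prems(3,4)]
    let ?s1 = "sem w node_cmd s"
    let ?s2 = "(sem w node_cmd ^^ nodes m1) ?s1"
    have N: "?s1 (0, rN) = length w" "?s2 (0, rN) = length w"
      using frame(3)[of 1 s] frame(3)[of "nodes m1" ?s1] Disj.prems(2) by simp_all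
    let ?l = "act \<and> odd (s (0, rG))" and ?r = "act \<and> even (s (0, rG))"
    have "drop (?s1 (0, rp)) w = enc_matrix m1 @ enc_matrix m2 @ r"
      "?s1 (0, rS) = 2 * (2 * S + of_bool ?r) + of_bool ?l" "0 < 2 * S + of_bool ?r"
      using b Disj.prems(4) by auto
    note IH1 = Disj.IH(1)[OF this(1) N(1) this(2,3)]
    have "drop (?s2 (0, rp)) w = enc_matrix m2 @ r"
      using IH1 drop_add_append[OF \<open>drop (?s1 (0, rp)) w = _\<close>] by simp
    note IH2 = Disj.IH(2)[OF this N(2) _ Disj.prems(4), of ?r]
    have "(sem w node_cmd ^^ nodes (Disj m1 m2)) s = (sem w node_cmd ^^ nodes m2) ?s2"
      by (simp only: nodes.simps funpow.simps(2) funpow_swap1 comp_apply funpow_add_apply)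
    then show ?case
      using b IH1 IH2 frame[of 1 s] frame[of "nodes m1" ?s1]
      by (simp add: power_add div_mult2_eq)
  qed
qed

text \<open>Serves twice: the input length is enough rounds for a pass, and the matrix accounts for
  at most k bits of a guess.\<close>

lemma nodes_le_length: "nodes m \<le> length (enc_matrix m)"
  by (induction m) auto

lemma sem_pass_cmd:
  assumes "drop (s (0, rms)) w = enc_matrix m" "s (0, rN) = length w"
  shows "valuation_of (sem w pass_cmd s) =
    pass (order_of w s) (next_of s) (constraints m True (s (0, rgm))) (valuation_of s)"
proof -
  define s1 where "s1 = sem w (rp ::= V rms ;; rG ::= V rgm ;; rchg ::= Num 0 ;; rS ::= Num 3) s"
  have "nodes m \<le> length w"
    using nodes_le_length[of m] assms(1) by (metis diff_le_self le_trans length_drop)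
  then obtain k where k: "length w = nodes m + k"
    using le_Suc_ex by blast
  have s1: "drop (s1 (0, rp)) w = enc_matrix m @ []" "s1 (0, rN) = length w"
    "s1 (0, rS) = 2 * 1 + of_bool True"
    using assms by (simp_all add: s1_def)
  have "(sem w node_cmd ^^ j) t = t" if "t (0, rS) = 1" for t j
    by (induction j) (auto simp: node_cmd_def that)
  note halted = this
  have "sem w pass_cmd s = (sem w node_cmd ^^ length w) s1"
    using assms(2) by (simp add: pass_cmd_def s1_def)
  also have "\<dots> = (sem w node_cmd ^^ nodes m) s1"
    using sem_nodes[OF s1] halted[of _ k] by (simp add: k funpow_add_apply)
  finally have "sem w pass_cmd s = (sem w node_cmd ^^ nodes m) s1" .
  moreover have "order_of w s1 = order_of w s" "next_of s1 = next_of s" "s1 (0, rG) = s (0, rgm)"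
    "valuation_of s1 = (vals s, 0, s (0, rfail))"
    by (simp_all add: s1_def order_of_def next_of_def valuation_of_def vals_def)
  ultimately show ?thesis
    using sem_nodes[OF s1] by (simp add: pass_def valuation_of_def)
qed

subsection \<open>Checking a guess\<close>

lemma enc_formula_alt: "enc_formula \<phi> = concat (map enc_var (fst \<phi>)) @ False # enc_matrix (snd \<phi>)"
proof -
  have "enc_var = (\<lambda>v. True # enc_nat v)"
    by (auto simp: enc_var_def)
  then show ?thesis
    by (simp add: enc_formula_def)
qed

lemma length_le_length_enc_vars: "length xs \<le> length (concat (map enc_var xs))"
  by (induction xs) (auto simp: enc_var_def)

lemma sem_check_cmd:
  assumes "drop (s (0, rfs)) w = enc_formula \<phi>" "s (0, rN) = length w"
  shows "sem w check_cmd s (0, rans) =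
      (if accepts (order_of w s) (next_of s) (\<lambda>j. s (aSt, j)) (s (0, rC)) (length w * length w) \<phi>
         (s (0, rg)) (vals s) (s (0, rchg))
       then 1 else s (0, rans))"
    "sem w check_cmd s (0, rg) = Suc (s (0, rg))"
proof -
  let ?L = "order_of w s" and ?nx = "next_of s" and ?C = "s (0, rC)"
  define s0 where "s0 = sem w (rG ::= V rg ;; rp ::= V rfs ;; rdone ::= Num 0 ;; rfail ::= Num 0) s"
  define s1 where "s1 = (sem w prefix_step ^^ length w) s0"
  define s2 where "s2 = sem w (rms ::= V rp ;; rgm ::= V rG) s1"
  define s3 where "s3 = (sem w pass_cmd ^^ (length w * length w)) s2"
  have len: "length (fst \<phi>) < length w"
  proof -
    have "length (enc_formula \<phi>) \<le> length w"
      using assms(1) by (metis diff_le_self length_drop)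
    then show ?thesis
      using length_le_length_enc_vars[of "fst \<phi>"] by (simp add: enc_formula_alt)
  qed
  have s0: "drop (s0 (0, rp)) w = concat (map enc_var (fst \<phi>)) @ False # enc_matrix (snd \<phi>)"
    "s0 (0, rN) = length w" "s0 (0, rdone) = 0" "s0 (0, rC) = ?C" "s0 (aSt, j) = s (aSt, j)"
    "s0 (0, rG) = s (0, rg)" "vals s0 = vals s" "s0 (0, rfail) = 0" for j
    using assms by (simp_all add: s0_def enc_formula_alt vals_def)
  note s1 = sem_prefix_iter[OF s0(1-3) len, folded s1_def, unfolded s0(4-8)]
  have frame2: "order_of w s2 = ?L" "next_of s2 = ?nx" "s2 (0, rN) = length w" "s2 (0, rchg) = s (0, rchg)"
    "s2 (0, rans) = s (0, rans)" "s2 (0, rg) = s (0, rg)"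
    using assms(2)
    by (simp_all add: order_of_def next_of_def s2_def s1_def s0_def funpow_sem_frame mods_prefix_step)
  have s2: "s2 (0, rms) = s1 (0, rp)" "s2 (0, rgm) = s1 (0, rG)" "vals s2 = vals s1" "s2 (0, rfail) = s1 (0, rfail)"
    by (simp_all add: s2_def vals_def)
  have ms: "drop (s2 (0, rms)) w = enc_matrix (snd \<phi>)"
    using drop_add_append[OF s0(1)] drop_Suc_Cons by (simp add: s2 s1(1))
  let ?ps = "constraints (snd \<phi>) True (s2 (0, rgm))"
  have s3': "valuation_of ((sem w pass_cmd ^^ k) s2) = (pass ?L ?nx ?ps ^^ k) (valuation_of s2)" for k
  proof (induction k)
    case (Suc k)
    let ?t = "(sem w pass_cmd ^^ k) s2"
    have "?t (0, rms) = s2 (0, rms)" "?t (0, rgm) = s2 (0, rgm)" "?t (0, rN) = length w"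
      "order_of w ?t = ?L" "next_of ?t = ?nx"
      using frame2(1-3)
      by (simp_all add: order_of_def next_of_def funpow_sem_frame mods_pass_cmd mods_node_cmd)
    then show ?case
      using sem_pass_cmd[of ?t w "snd \<phi>"] ms Suc by simp
  qed simp
  have frame3: "s3 (0, rans) = s (0, rans)" "s3 (0, rg) = s (0, rg)"
    using frame2 by (simp_all add: s3_def funpow_sem_frame mods_pass_cmd mods_node_cmd)
  \<comment> \<open>A pass leaves \<open>rN\<close> alone, so each outer round performs the same
    number of passes.\<close>
  have "(sem w (Loop rN pass_cmd) ^^ k) s2 = ((sem w pass_cmd ^^ length w) ^^ k) s2" for k
  proof (induction k)
    case (Suc k)
    have "(sem w (Loop rN pass_cmd) ^^ k) s2 (0, rN) = length w"
      using frame2(3) by (simp add: funpow_sem_frame mods_pass_cmd mods_node_cmd)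
    then show ?case
      using Suc by simp
  qed simp
  then have loop: "sem w (Loop rN (Loop rN pass_cmd)) s2 = s3"
    using frame2(3) by (simp add: s3_def funpow_mult del: sem.simps(5)) (simp add: funpow_mult)
  have eq: "sem w check_cmd s = sem w (Cond (V rchg) Skip (Cond (V rfail) Skip (rans ::= Num 1)) ;; incr rg 1) s3"
    using loop s0(2) unfolding check_cmd_def prefix_cmd_def s2_def s1_def s0_def by simp
  obtain v f where vf: "choose_starts ?C (\<lambda>j. s (aSt, j)) (fst \<phi>) (s (0, rg)) (vals s, 0) = (v, f)"
    by fastforce
  have "accepts ?L ?nx (\<lambda>j. s (aSt, j)) ?C (length w * length w) \<phi> (s (0, rg)) (vals s) (s (0, rchg))
    \<longleftrightarrow> s3 (0, rchg) = 0 \<and> s3 (0, rfail) = 0"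
  proof -
    have "(pass ?L ?nx (constraints (snd \<phi>) True (s (0, rg) div 2 ^ (?C * length (fst \<phi>)))) ^^
        (length w * length w)) (v, s (0, rchg), f) = (vals s3, s3 (0, rchg), s3 (0, rfail))"
      using s3'[of "length w * length w", symmetric] s1(2,3) vf
      by (simp add: s2 frame2 valuation_of_def flip: s3_def)
    then show ?thesis
      using vf by (simp add: accepts_def)
  qed
  then show "sem w check_cmd s (0, rans) =
      (if accepts ?L ?nx (\<lambda>j. s (aSt, j)) ?C (length w * length w) \<phi> (s (0, rg)) (vals s) (s (0, rchg))
       then 1 else s (0, rans))"
    using frame3 by (simp add: eq)
  show "sem w check_cmd s (0, rg) = Suc (s (0, rg))"
    using frame3 by (simp add: eq)
qed

subsection \<open>Layout of the input\<close>

text \<open>The counter is at the same time the reading position, so it gets stuck at the separator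
  after the unary size.\<close>

definition size_cmd :: cmd where
  "size_cmd = Loop rN (Cond (Inp (V rn)) (incr rn 1) Skip)"

definition row_step :: cmd where
  "row_step = racc ::= Plus (V racc) (V rn) ;; incr ra 1 ;; Assign aRow (V ra) (V racc)"

text \<open>Repeated addition leaves n n in \<open>racc\<close>. The formula starts after the n n
  entries, the n ones and the separator, and the remaining length \<open>rk\<close> is the
  parameter.\<close>

definition layout_cmd :: cmd where
  "layout_cmd = Loop rn row_step ;; rfs ::= Plus (Plus (V racc) (V rn)) (Num 1) ;;
     rk ::= Minus (V rN) (V rfs)"

lemma sem_size_cmd:
  assumes "w = replicate n True @ False # r" "s (0, rn) = 0" "s (0, rN) = length w"
  shows "sem w size_cmd s (0, rn) = n"
proof -
  let ?c = "Cond (Inp (V rn)) (incr rn 1) Skip"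
  have "(sem w ?c ^^ k) s (0, rn) = min k n" for k
  proof (induction k)
    case (Suc k)
    have "input_at w (min k n) = of_bool (k < n)"
      by (auto simp: input_at_def assms(1) nth_append min_def)
    then show ?case
      using Suc by (auto simp: min_def)
  qed (use assms in simp)
  from this[of "length w"] show ?thesis
    using assms by (simp add: size_cmd_def)
qed

lemma sem_row_iter:
  fixes w s
  assumes "s (0, racc) = 0" "s (0, ra) = 0" "\<And>i. s (aRow, i) = 0"
  defines "s' k \<equiv> (sem w row_step ^^ k) s"
  shows "s' k (0, ra) = k \<and> s' k (0, racc) = k * s (0, rn) \<and>
    (\<forall>i. s' k (aRow, i) = (if i \<le> k then i * s (0, rn) else 0))"
proof (induction k)
  case (Suc k)
  have "s' (Suc k) = sem w row_step (s' k)"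
    by (simp add: s'_def)
  moreover have "s' k (0, rn) = s (0, rn)"
    by (simp add: s'_def funpow_sem_frame row_step_def)
  ultimately show ?case
    using Suc by (auto simp: row_step_def)
qed (use assms in \<open>simp add: s'_def\<close>)

lemma sem_layout_cmd:
  assumes "s (0, racc) = 0" "s (0, ra) = 0" "\<And>i. s (aRow, i) = 0"
  defines "n \<equiv> s (0, rn)"
  shows "i \<le> n \<Longrightarrow> sem w layout_cmd s (aRow, i) = i * n"
    "sem w layout_cmd s (0, rfs) = n * n + n + 1"
    "sem w layout_cmd s (0, rk) = s (0, rN) - (n * n + n + 1)"
  using sem_row_iter[OF assms(1-3), where w = w and k = n]
  by (simp_all add: layout_cmd_def n_def funpow_sem_frame row_step_def)

subsection \<open>Computing the chain partition\<close>

text \<open>Tests by truncated subtraction: the sum of both differences is nonzero iff the elements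
  differ, and \<open>rbest\<close> minus the label is nonzero iff the label is smaller.\<close>

definition match_try :: cmd where
  "match_try =
     Cond (At aNx (V ra)) Skip
       (Cond (Inp (Plus (At aRow (V ra)) (V rb)))
         (Cond (Plus (Minus (V ra) (V rb)) (Minus (V rb) (V ra)))
           (Cond (Minus (V rbest) (At aLab (V rb)))
              (rbest ::= At aLab (V rb) ;; rba ::= V ra ;; rbb ::= V rb)
              Skip)
           Skip)
         Skip)"

definition match_row :: cmd where
  "match_row = incr ra 1 ;; rb ::= Num 0 ;; Loop rn (incr rb 1 ;; match_try)"

text \<open>Starting from n + 1 restricts the offers to labels at most n, so that a label never
  exceeds n + 1; \<open>rba = 0\<close> records that no offer was found.\<close>

definition match_scan :: cmd where
  "match_scan = rbest ::= Plus (V rn) (Num 1) ;; rba ::= Num 0 ;; ra ::= Num 0 ;; Loop rn match_row"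

text \<open>The evicted predecessor is unlinked while \<open>aPv\<close> still names it.\<close>

definition match_augment :: cmd where
  "match_augment =
     Cond (V rba)
       (Assign aNx (At aPv (V rbb)) (Num 0) ;; Assign aPv (V rbb) (V rba) ;;
        Assign aNx (V rba) (V rbb) ;; Assign aLab (V rbb) (Plus (At aLab (V rbb)) (Num 1)))
       Skip"

definition match_cmd :: cmd where
  "match_cmd = Loop rN (match_scan ;; match_augment)"

definition start_step :: cmd where
  "start_step = incr ra 1 ;; Cond (At aPv (V ra)) Skip (Assign aSt (V rj) (V ra) ;; incr rj 1)"

definition starts_cmd :: cmd where
  "starts_cmd = ra ::= Num 0 ;; Loop rn start_step"

lemma mods_match_try: "mods match_try = {(0, rbest), (0, rba), (0, rbb)}"
  by (auto simp: match_try_def)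

lemma mods_match_scan: "mods match_scan = {(0, rbest), (0, rba), (0, rbb), (0, ra), (0, rb)}"
  by (auto simp: match_scan_def match_row_def mods_match_try)

lemma mods_match_cmd: "mods match_cmd =
    {(0, rbest), (0, rba), (0, rbb), (0, ra), (0, rb)} \<union> {aNx, aPv, aLab} \<times> UNIV"
  by (auto simp: match_cmd_def match_augment_def mods_match_scan)

lemma mods_starts_cmd: "mods starts_cmd = {(0, ra), (0, rj)} \<union> {aSt} \<times> UNIV"
  by (auto simp: starts_cmd_def start_step_def)

definition prev_of :: "state \<Rightarrow> nat \<Rightarrow> nat" where
  "prev_of s = (\<lambda>a. s (aPv, a))"

definition label_of :: "state \<Rightarrow> nat \<Rightarrow> nat" where
  "label_of s = (\<lambda>a. s (aLab, a))"

context indexed_poset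
begin

text \<open>\<open>P\<close> is the set of pairs scanned so far.\<close>

definition best_inv :: "(nat \<times> nat) set \<Rightarrow> state \<Rightarrow> bool" where
  "best_inv P s \<longleftrightarrow>
     (s (0, rba) = 0 \<longrightarrow> s (0, rbest) = Suc n) \<and>
     (s (0, rba) \<noteq> 0 \<longrightarrow> next_of s (s (0, rba)) = 0 \<and> lt (s (0, rba)) (s (0, rbb)) \<and>
        label_of s (s (0, rbb)) = s (0, rbest) \<and> s (0, rbest) \<le> n) \<and>
     (\<forall>(a, b)\<in>P. next_of s a = 0 \<longrightarrow> lt a b \<longrightarrow> s (0, rbest) \<le> label_of s b)"

lemma match_try_inv:
  assumes "order_of w s = L" "s (0, ra) \<in> {1..n}" "s (0, rb) \<in> {1..n}" "best_inv P s"
  shows "best_inv (insert (s (0, ra), s (0, rb)) P) (sem w match_try s)"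
proof -
  let ?a = "s (0, ra)" and ?b = "s (0, rb)"
  have lt: "lt ?a ?b \<longleftrightarrow> ?a \<noteq> ?b \<and> input_at w (s (aRow, ?a) + ?b) \<noteq> 0"
    using assms(1-3) by (auto simp: lt_def order_of_def fun_eq_iff)
  have neq: "?a - ?b + (?b - ?a) = 0 \<longleftrightarrow> ?a = ?b"
    by auto
  show ?thesis
  proof (cases "next_of s ?a = 0 \<and> lt ?a ?b \<and> label_of s ?b < s (0, rbest)")
    case True
    define s' where "s' = sem w match_try s"
    have s': "s' (0, rba) = ?a" "s' (0, rbb) = ?b" "s' (0, rbest) = label_of s ?b"
      "next_of s' = next_of s" "label_of s' = label_of s"
      using True lt neq
      by (auto simp: s'_def match_try_def next_of_def label_of_def sem_frame)
    have "s (0, rbest) \<le> Suc n"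
      using assms(4) by (cases "s (0, rba) = 0") (auto simp: best_inv_def)
    then show ?thesis
      using True assms(2,4) s' unfolding s'_def[symmetric] best_inv_def by (auto 0 4)
  next
    case False
    then have "sem w match_try s = s"
      using lt neq by (auto simp: match_try_def next_of_def label_of_def)
    then show ?thesis
      using False assms(4) by (auto simp: best_inv_def)
  qed
qed

lemma match_row_inv:
  assumes "order_of w s = L" "s (0, rn) = n" "Suc (s (0, ra)) \<in> {1..n}" "best_inv P s"
  shows "best_inv (P \<union> {Suc (s (0, ra))} \<times> {1..n}) (sem w match_row s) \<and>
    sem w match_row s (0, ra) = Suc (s (0, ra))"
proof -
  define s0 where "s0 = sem w (incr ra 1 ;; rb ::= Num 0) s"
  define c where "c = incr rb 1 ;; match_try"
  let ?a = "Suc (s (0, ra))"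
  have s0: "s0 (0, ra) = ?a" "s0 (0, rb) = 0" "order_of w s0 = L" "best_inv P s0"
    using assms by (simp_all add: s0_def order_of_def best_inv_def next_of_def label_of_def)
  have iter: "best_inv (P \<union> {?a} \<times> {1..k}) ((sem w c ^^ k) s0) \<and> (sem w c ^^ k) s0 (0, rb) = k"
    if "k \<le> n" for k
    using that
  proof (induction k)
    case (Suc k)
    define t where "t = sem w (incr rb 1) ((sem w c ^^ k) s0)"
    have mods_c: "mods c = {(0, rb), (0, rbest), (0, rba), (0, rbb)}"
      by (auto simp: c_def mods_match_try)
    have t: "order_of w t = L" "t (0, ra) = ?a" "t (0, rb) = Suc k"
      using Suc s0 by (simp_all add: t_def order_of_def funpow_sem_frame mods_c)
    have inv: "best_inv (P \<union> {?a} \<times> {1..k}) t"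
      using Suc by (simp add: t_def best_inv_def next_of_def label_of_def)
    have "best_inv (insert (?a, Suc k) (P \<union> {?a} \<times> {1..k})) (sem w match_try t)"
      using match_try_inv[OF t(1) _ _ inv] assms(3) Suc.prems by (simp add: t)
    moreover have "insert (?a, Suc k) (P \<union> {?a} \<times> {1..k}) = P \<union> {?a} \<times> {1..Suc k}"
      by (auto simp: le_Suc_eq)
    moreover have "(sem w c ^^ Suc k) s0 = sem w match_try t"
      by (simp add: c_def t_def)
    moreover have "sem w match_try t (0, rb) = Suc k"
      by (simp add: sem_frame mods_match_try t)
    ultimately show ?case
      by simp
  qed (use s0 in simp)
  have "s0 (0, rn) = n"
    using assms(2) by (simp add: s0_def)
  then have "sem w match_row s = (sem w c ^^ n) s0"
    by (simp add: match_row_def s0_def c_def)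
  then show ?thesis
    using iter[of n] s0(1) by (simp add: funpow_sem_frame c_def mods_match_try)
qed

lemma match_scan_inv:
  assumes "order_of w s = L" "s (0, rn) = n"
  shows "best_inv ({1..n} \<times> {1..n}) (sem w match_scan s)"
proof -
  define s0 where "s0 = sem w (rbest ::= Plus (V rn) (Num 1) ;; rba ::= Num 0 ;; ra ::= Num 0) s"
  have s0: "s0 (0, ra) = 0" "order_of w s0 = L" "best_inv {} s0" "s0 (0, rn) = n"
    using assms by (simp_all add: s0_def order_of_def best_inv_def)
  have "best_inv ({1..k} \<times> {1..n}) ((sem w match_row ^^ k) s0) \<and> (sem w match_row ^^ k) s0 (0, ra) = k"
    if "k \<le> n" for k
    using that
  proof (induction k)
    case (Suc k)
    let ?t = "(sem w match_row ^^ k) s0"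
    have "order_of w ?t = L" "?t (0, rn) = n"
      using s0 by (simp_all add: order_of_def funpow_sem_frame match_row_def mods_match_try)
    from match_row_inv[OF this, of "{1..k} \<times> {1..n}"] Suc
    have "best_inv ({1..k} \<times> {1..n} \<union> {Suc k} \<times> {1..n}) (sem w match_row ?t) \<and>
        sem w match_row ?t (0, ra) = Suc k"
      by simp
    moreover have "{1..k} \<times> {1..n} \<union> {Suc k} \<times> {1..n} = {1..Suc k} \<times> {1..n}"
      by (auto simp: le_Suc_eq)
    ultimately show ?case
      by simp
  qed (use s0 in simp)
  from this[of n] show ?thesis
    using s0(4) by (simp add: match_scan_def s0_def)
qed

text \<open>The stopping condition of the auction, in the form required by
  \<open>card_chain_starts_le\<close>.\<close>

definition matched :: "state \<Rightarrow> bool" where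
  "matched s \<longleftrightarrow> (\<forall>a b. next_of s a = 0 \<longrightarrow> lt a b \<longrightarrow> n < label_of s b)"

lemma match_iter_inv:
  assumes "order_of w s = L" "s (0, rn) = n" "chain_inv (next_of s) (prev_of s) (label_of s)"
    and "matched s \<or> k \<le> sum (label_of s) {1..n}"
  defines "s' \<equiv> sem w (match_scan ;; match_augment) s"
  shows "chain_inv (next_of s') (prev_of s') (label_of s') \<and>
    (matched s' \<or> Suc k \<le> sum (label_of s') {1..n})"
proof -
  define t where "t = sem w match_scan s"
  have t: "next_of t = next_of s" "prev_of t = prev_of s" "label_of t = label_of s"
    by (simp_all add: t_def next_of_def prev_of_def label_of_def sem_frame mods_match_scan)
  have s': "s' = sem w match_augment t"
    by (simp add: s'_def t_def)
  have best: "best_inv ({1..n} \<times> {1..n}) t"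
    unfolding t_def using match_scan_inv[OF assms(1,2)] .
  have min: "t (0, rbest) \<le> label_of s b" if "next_of s a = 0" "lt a b" for a b
    using best that lt_range[OF that(2)] t unfolding best_inv_def by auto
  show ?thesis
  proof (cases "t (0, rba) = 0")
    case True
    then have "s' = t"
      by (simp add: s' match_augment_def)
    moreover have "t (0, rbest) = Suc n"
      using best True by (simp add: best_inv_def)
    then have "n < label_of s b" if "next_of s a = 0" "lt a b" for a b
      using min[OF that] by simp
    ultimately show ?thesis
      using assms(3) t by (simp add: matched_def)
  next
    case False
    let ?a = "t (0, rba)" and ?b = "t (0, rbb)"
    have ab: "next_of s ?a = 0" "lt ?a ?b" "label_of s ?b = t (0, rbest)" "t (0, rbest) \<le> n"
      using best False t unfolding best_inv_def by auto
    have eq: "next_of s' = (next_of s)(prev_of s ?b := 0, ?a := ?b)" "prev_of s' = (prev_of s)(?b := ?a)"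
      "label_of s' = (label_of s)(?b := Suc (label_of s ?b))"
      unfolding t[symmetric] using False
      by (auto simp: s' match_augment_def next_of_def prev_of_def label_of_def fun_eq_iff)
    have "chain_inv (next_of s') (prev_of s') (label_of s')"
      unfolding eq using chain_inv_augment[OF assms(3) ab(1,2)] ab(3,4) min[OF ab(1)] by simp
    moreover have "\<not> matched s"
      using ab unfolding matched_def by (metis not_le)
    then have "k \<le> sum (label_of s) {1..n}"
      using assms(4) by blast
    moreover have "sum (label_of s') {1..n} = Suc (sum (label_of s) {1..n})"
    proof -
      have b: "?b \<in> {1..n}"
        using lt_range[OF ab(2)] by simp
      have "sum (label_of s') ({1..n} - {?b}) = sum (label_of s) ({1..n} - {?b})"
        by (rule sum.cong) (auto simp: eq)
      then show ?thesis
        using sum.remove[OF _ b, of "label_of s"] sum.remove[OF _ b, of "label_of s'"] by (simp add: eq)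
    qed
    ultimately show ?thesis
      by simp
  qed
qed

text \<open>As long as \<open>matched\<close> fails, each round adds 1 to the label sum, which
  cannot exceed n (n + 1) < N.\<close>

lemma sem_match_cmd:
  assumes "order_of w s = L" "s (0, rn) = n" "n * Suc n < s (0, rN)"
    and "\<And>a. s (aNx, a) = 0" "\<And>a. s (aPv, a) = 0" "\<And>a. s (aLab, a) = 0"
  defines "s' \<equiv> sem w match_cmd s"
  shows "chain_inv (next_of s') (prev_of s') (label_of s')" "matched s'"
proof -
  let ?c = "match_scan ;; match_augment"
  have "chain_inv (next_of ((sem w ?c ^^ k) s)) (prev_of ((sem w ?c ^^ k) s)) (label_of ((sem w ?c ^^ k) s)) \<and>
      (matched ((sem w ?c ^^ k) s) \<or> k \<le> sum (label_of ((sem w ?c ^^ k) s)) {1..n})" for k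
  proof (induction k)
    case 0
    show ?case
      using chain_inv_init by (simp add: next_of_def prev_of_def label_of_def assms(4-6))
  next
    case (Suc k)
    let ?t = "(sem w ?c ^^ k) s"
    have "order_of w ?t = L" "?t (0, rn) = n"
      using assms(1,2)
      by (simp_all add: order_of_def funpow_sem_frame mods_match_scan match_augment_def del: sem.simps)
    from match_iter_inv[OF this, of k] Suc show ?case
      by simp
  qed
  from this[of "s (0, rN)"] show inv: "chain_inv (next_of s') (prev_of s') (label_of s')" and "matched s'"
    using sum_labels_le[of "next_of s'" "prev_of s'" "label_of s'"] assms(3)
    by (auto simp: s'_def match_cmd_def)
qed

end

text \<open>The chain starts fill the array from index 0; entries after the last one keep the value
  0, and a guess that selects one of them fails.\<close>

lemma sem_starts_cmd:
  fixes s w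
  assumes "s (0, rj) = 0" "\<And>j. s (aSt, j) = 0"
  defines "s' \<equiv> sem w starts_cmd s" and "A \<equiv> {a \<in> {1..s (0, rn)}. prev_of s a = 0}"
  shows "s' (aSt, j) \<noteq> 0 \<Longrightarrow> s' (aSt, j) \<in> A" "a \<in> A \<Longrightarrow> \<exists>j<card A. s' (aSt, j) = a"
proof -
  define s0 where "s0 = sem w (ra ::= Num 0) s"
  define t where "t k = (sem w start_step ^^ k) s0" for k
  define A' where "A' k = {a \<in> {1..k}. prev_of s a = 0}" for k
  have A'_Suc: "A' (Suc k) = (if prev_of s (Suc k) = 0 then insert (Suc k) (A' k) else A' k)" for k
    by (auto simp: A'_def le_Suc_eq)
  have fin: "finite (A' k)" for k
    by (simp add: A'_def)
  have inv: "t k (0, ra) = k \<and> t k (0, rj) = card (A' k) \<and>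
      (\<forall>j. t k (aSt, j) \<noteq> 0 \<longrightarrow> t k (aSt, j) \<in> A' k) \<and> (\<forall>a\<in>A' k. \<exists>j<card (A' k). t k (aSt, j) = a)" for k
  proof (induction k)
    case 0
    show ?case
      using assms(1,2) by (simp add: t_def s0_def A'_def)
  next
    case (Suc k)
    have step: "t (Suc k) = sem w start_step (t k)"
      by (simp add: t_def)
    have pv: "t k (aPv, a) = prev_of s a" for a
      by (simp add: t_def s0_def funpow_sem_frame start_step_def prev_of_def)
    show ?case
    proof (cases "prev_of s (Suc k) = 0")
      case True
      have "Suc k \<notin> A' k"
        by (simp add: A'_def)
      then have card: "card (insert (Suc k) (A' k)) = Suc (card (A' k))"
        using fin by simp
      have eq: "t (Suc k) (0, ra) = Suc k" "t (Suc k) (0, rj) = Suc (card (A' k))"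
        "t (Suc k) (aSt, j) = (if j = card (A' k) then Suc k else t k (aSt, j))" for j
        using Suc True pv by (simp_all add: step start_step_def)
      have "\<exists>j<Suc (card (A' k)). t (Suc k) (aSt, j) = a" if "a \<in> A' k" for a
      proof -
        obtain j where "j < card (A' k)" "t k (aSt, j) = a"
          using Suc \<open>a \<in> A' k\<close> by blast
        then show ?thesis
          by (intro exI[of _ j]) (simp add: eq)
      qed
      then show ?thesis
        using Suc True by (auto simp: eq A'_Suc card simp del: card_insert_disjoint)
    next
      case False
      have "t (Suc k) l = (if l = (0, ra) then Suc k else t k l)" for l
        using Suc False pv by (simp add: step start_step_def)
      then show ?thesis
        using Suc False by (simp add: A'_Suc)
    qed
  qed
  have "s' = t (s (0, rn))"
    by (simp add: s'_def starts_cmd_def t_def s0_def)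
  moreover have "A = A' (s (0, rn))"
    by (simp add: A_def A'_def)
  ultimately show "s' (aSt, j) \<noteq> 0 \<Longrightarrow> s' (aSt, j) \<in> A" "a \<in> A \<Longrightarrow> \<exists>j<card A. s' (aSt, j) = a"
    using inv by auto
qed

subsection \<open>Exhaustive search\<close>

text \<open>Exponentiation by repeated doubling. The register is a parameter because the same code
  produces both the number of guesses and the computable time bound.\<close>

definition double_loop :: "nat \<Rightarrow> cmd" where
  "double_loop i = Loop i (Loop rD (rcnt ::= Plus (V rcnt) (V rcnt)))"

lemma sem_double_loop:
  assumes "i \<notin> {rD, rcnt}" "s (0, rcnt) = 1"
  shows "sem w (double_loop i) s (0, rcnt) = 2 ^ (s (0, rD) * s (0, i))"
proof -
  let ?c = "rcnt ::= Plus (V rcnt) (V rcnt)"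
  have inner: "(sem w ?c ^^ k) t (0, rcnt) = 2 ^ k * t (0, rcnt)" for k t
    by (induction k) auto
  define c where "c = Loop rD ?c"
  have "(sem w c ^^ k) s (0, rcnt) = 2 ^ (s (0, rD) * k)" for k
  proof (induction k)
    case (Suc k)
    have "(sem w c ^^ k) s (0, rD) = s (0, rD)"
      by (rule funpow_sem_frame) (simp add: c_def)
    moreover have "sem w c t (0, rcnt) = 2 ^ t (0, rD) * t (0, rcnt)" for t
      by (simp add: c_def inner)
    ultimately show ?case
      using Suc by (simp add: power_add)
  qed (use assms in simp)
  then show ?thesis
    by (simp add: double_loop_def c_def)
qed

definition search_cmd :: cmd where
  "search_cmd = Loop rcnt check_cmd"

text \<open>Round g tries guess g in a memory that is not tracked, so \<open>sound\<close> must hold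
  for all \<open>v\<close> and \<open>c\<close>, and \<open>complete\<close> must supply a guess
  that works for all of them.\<close>

lemma sem_search_cmd:
  assumes "drop (s (0, rfs)) w = enc_formula \<phi>" "s (0, rN) = length w"
    and "s (0, rans) = 0" "s (0, rg) = 0"
  defines "acc \<equiv> accepts (order_of w s) (next_of s) (\<lambda>j. s (aSt, j)) (s (0, rC)) (length w * length w) \<phi>"
  assumes sound: "\<And>g v c. acc g v c \<Longrightarrow> Q"
    and complete: "Q \<Longrightarrow> \<exists>g<s (0, rcnt). \<forall>v c. acc g v c"
  shows "sem w search_cmd s (0, rans) = of_bool Q"
proof -
  define t where "t k = (sem w check_cmd ^^ k) s" for k
  have inv: "t k (0, rg) = k \<and> t k (0, rans) \<le> 1 \<and> (t k (0, rans) = 1 \<longrightarrow> Q) \<and>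
      ((\<exists>g<k. \<forall>v c. acc g v c) \<longrightarrow> t k (0, rans) = 1)" for k
  proof (induction k)
    case 0
    show ?case
      using assms(3,4) by (simp add: t_def)
  next
    case (Suc k)
    have fr: "t k l = s l" if "l \<notin> mods check_cmd" for l
      using that by (simp add: t_def funpow_sem_frame)
    have "drop (t k (0, rfs)) w = enc_formula \<phi>" "t k (0, rN) = length w"
      using assms(1,2) by (simp_all add: fr mods_check_cmd mods_node_cmd)
    note c = sem_check_cmd[OF this]
    have "order_of w (t k) = order_of w s" "next_of (t k) = next_of s" "t k (aSt, j) = s (aSt, j)"
      "t k (0, rC) = s (0, rC)" for j
      by (simp_all add: order_of_def next_of_def fr mods_check_cmd mods_node_cmd)
    with c have "t (Suc k) (0, rans) = (if acc k (vals (t k)) (t k (0, rchg)) then 1 else t k (0, rans))"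
      "t (Suc k) (0, rg) = Suc k"
      using Suc by (simp_all add: t_def acc_def)
    then show ?case
      using Suc sound by (auto simp: less_Suc_eq)
  qed
  have "sem w search_cmd s = t (s (0, rcnt))"
    by (simp add: search_cmd_def t_def)
  then show ?thesis
    using inv[of "s (0, rcnt)"] complete by (cases Q) auto
qed

section \<open>Semantics of sentences\<close>

text \<open>The two assignments may have different carriers, which allows passing between elements
  and their numbers.\<close>

lemma sat_matrix_transfer:
  assumes "\<And>x y. x \<in> matrix_vars m \<Longrightarrow> y \<in> matrix_vars m \<Longrightarrow>
    (\<sigma> x = \<sigma> y \<longleftrightarrow> \<sigma>' x = \<sigma>' y) \<and> ((\<sigma> x, \<sigma> y) \<in> r \<longleftrightarrow> (\<sigma>' x, \<sigma>' y) \<in> r')"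
  shows "sat_matrix r \<sigma> m \<longleftrightarrow> sat_matrix r' \<sigma>' m"
proof -
  have atom: "sat_atom r \<sigma> a \<longleftrightarrow> sat_atom r' \<sigma>' a" if "atom_vars a \<subseteq> matrix_vars m" for a
    using that assms by (cases a) auto
  have "sat_matrix r \<sigma> m' \<longleftrightarrow> sat_matrix r' \<sigma>' m'" if "matrix_vars m' \<subseteq> matrix_vars m" for m'
    using that by (induction m') (auto simp: atom)
  then show ?thesis
    by blast
qed

lemma sat_prefix_iff:
  "sat_prefix A r m xs \<sigma> \<longleftrightarrow>
    (\<exists>\<tau>. (\<forall>x\<in>set xs. \<tau> x \<in> A) \<and> (\<forall>x. x \<notin> set xs \<longrightarrow> \<tau> x = \<sigma> x) \<and> sat_matrix r \<tau> m)"
proof (induction xs arbitrary: \<sigma>)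
  case Nil
  have "(\<forall>x. \<tau> x = \<sigma> x) \<longleftrightarrow> \<tau> = \<sigma>" for \<tau>
    by auto
  then show ?case
    by simp
next
  case (Cons x xs)
  show ?case
  proof
    assume "sat_prefix A r m (x # xs) \<sigma>"
    then obtain a \<tau> where a: "a \<in> A" "\<forall>y\<in>set xs. \<tau> y \<in> A"
      "\<forall>y. y \<notin> set xs \<longrightarrow> \<tau> y = (\<sigma>(x := a)) y" "sat_matrix r \<tau> m"
      by (auto simp: Cons.IH)
    \<comment> \<open>If \<open>x\<close> is quantified again in \<open>xs\<close>, the inner value
      counts; otherwise it is \<open>a\<close>.\<close>
    then have "\<tau> x \<in> A"
      by (cases "x \<in> set xs") auto
    then show "\<exists>\<tau>. (\<forall>y\<in>set (x # xs). \<tau> y \<in> A) \<and>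
        (\<forall>y. y \<notin> set (x # xs) \<longrightarrow> \<tau> y = \<sigma> y) \<and> sat_matrix r \<tau> m"
      using a by (intro exI[of _ \<tau>]) auto
  next
    assume "\<exists>\<tau>. (\<forall>y\<in>set (x # xs). \<tau> y \<in> A) \<and>
        (\<forall>y. y \<notin> set (x # xs) \<longrightarrow> \<tau> y = \<sigma> y) \<and> sat_matrix r \<tau> m"
    then obtain \<tau> where \<tau>: "\<forall>y\<in>set (x # xs). \<tau> y \<in> A"
        "\<forall>y. y \<notin> set (x # xs) \<longrightarrow> \<tau> y = \<sigma> y" "sat_matrix r \<tau> m"
      by blast
    then have "sat_prefix A r m xs (\<sigma>(x := \<tau> x))"
      unfolding Cons.IH by (intro exI[of _ \<tau>]) auto
    then show "sat_prefix A r m (x # xs) \<sigma>"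
      using \<tau>(1) by auto
  qed
qed

lemma models_iff:
  assumes "is_sentence \<phi>"
  shows "models A r \<phi> \<longleftrightarrow> (\<exists>\<sigma>. (\<forall>x\<in>set (fst \<phi>). \<sigma> x \<in> A) \<and> sat_matrix r \<sigma> (snd \<phi>))"
proof
  assume "\<exists>\<sigma>. (\<forall>x\<in>set (fst \<phi>). \<sigma> x \<in> A) \<and> sat_matrix r \<sigma> (snd \<phi>)"
  then obtain \<sigma> where \<sigma>: "\<forall>x\<in>set (fst \<phi>). \<sigma> x \<in> A" "sat_matrix r \<sigma> (snd \<phi>)"
    by blast
  \<comment> \<open>Off the prefix the value must be that of the initial assignment in
    \<open>models_def\<close>.\<close>
  let ?\<tau> = "\<lambda>x. if x \<in> set (fst \<phi>) then \<sigma> x else undefined"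
  have "sat_matrix r ?\<tau> (snd \<phi>) \<longleftrightarrow> sat_matrix r \<sigma> (snd \<phi>)"
    using assms unfolding is_sentence_def by (intro sat_matrix_transfer) auto
  then show "models A r \<phi>"
    unfolding models_def sat_prefix_iff using \<sigma> by (intro exI[of _ ?\<tau>]) auto
qed (auto simp: models_def sat_prefix_iff)

text \<open>Elements are numbered from 1, as 0 is reserved for no element.\<close>

definition index_order :: "'a list \<Rightarrow> ('a \<times> 'a) set \<Rightarrow> nat \<Rightarrow> nat \<Rightarrow> bool" where
  "index_order xs r a b \<longleftrightarrow> (xs ! (a - 1), xs ! (b - 1)) \<in> r"

lemma nth_pred_mem: "a \<in> {1..length xs} \<Longrightarrow> xs ! (a - 1) \<in> set xs"
  by (auto intro!: nth_mem)

lemma nth_pred_eq_iff: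
  "distinct xs \<Longrightarrow> a \<in> {1..length xs} \<Longrightarrow> b \<in> {1..length xs} \<Longrightarrow> xs ! (a - 1) = xs ! (b - 1) \<longleftrightarrow> a = b"
  by (subst nth_eq_iff_index_eq) auto

lemma indexed_poset_of_list:
  assumes "distinct xs" "finite_poset (set xs) r"
    and L: "\<And>a b. a \<in> {1..length xs} \<Longrightarrow> b \<in> {1..length xs} \<Longrightarrow> L a b = index_order xs r a b"
  shows "indexed_poset (length xs) L"
proof -
  have r: "refl_on (set xs) r" "trans r" "antisym r"
    using assms(2) by (auto simp: finite_poset_def partial_order_on_def preorder_on_def)
  show ?thesis
  proof
    fix a assume a: "a \<in> {1..length xs}"
    then show "L a a"
      using refl_onD[OF r(1) nth_pred_mem[OF a]] by (simp add: L index_order_def)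
  next
    fix a b assume *: "a \<in> {1..length xs}" "b \<in> {1..length xs}" "L a b" "L b a"
    then have "xs ! (a - 1) = xs ! (b - 1)"
      using antisymD[OF r(3)] by (simp add: L index_order_def)
    then show "a = b"
      using nth_pred_eq_iff[OF assms(1) *(1,2)] by blast
  next
    fix a b c
    assume *: "a \<in> {1..length xs}" "b \<in> {1..length xs}" "c \<in> {1..length xs}" "L a b" "L b c"
    then show "L a c"
      using transD[OF r(2)] unfolding L[OF *(1,2)] L[OF *(2,3)] L[OF *(1,3)] index_order_def by blast
  qed
qed

lemma card_antichain_le_poset_width:
  assumes "finite A" "antichain A r S"
  shows "card S \<le> poset_width A r"
proof -
  have "finite {S. antichain A r S}"
    by (rule finite_subset[of _ "Pow A"]) (use assms in \<open>auto simp: antichain_def\<close>)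
  then show ?thesis
    unfolding poset_width_def using assms(2) by (intro Max_ge) auto
qed

lemma models_indexed:
  assumes "distinct xs" "is_sentence \<phi>"
    and L: "\<And>a b. a \<in> {1..length xs} \<Longrightarrow> b \<in> {1..length xs} \<Longrightarrow> L a b = index_order xs r a b"
    and "indexed_poset (length xs) L"
  shows "models (set xs) r \<phi> \<longleftrightarrow>
    (\<exists>\<sigma>. (\<forall>x\<in>set (fst \<phi>). \<sigma> x \<in> {1..length xs}) \<and>
      sat_matrix (indexed_poset.rel (length xs) L) \<sigma> (snd \<phi>))"
proof -
  have transfer: "sat_matrix r (\<lambda>x. xs ! (\<sigma> x - 1)) (snd \<phi>) \<longleftrightarrow>
      sat_matrix (indexed_poset.rel (length xs) L) \<sigma> (snd \<phi>)"
    if "\<forall>x\<in>set (fst \<phi>). \<sigma> x \<in> {1..length xs}" for \<sigma>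
  proof (rule sat_matrix_transfer)
    fix x y
    assume "x \<in> matrix_vars (snd \<phi>)" "y \<in> matrix_vars (snd \<phi>)"
    then have "\<sigma> x \<in> {1..length xs}" "\<sigma> y \<in> {1..length xs}"
      using that assms(2) unfolding is_sentence_def by blast+
    then show "(xs ! (\<sigma> x - 1) = xs ! (\<sigma> y - 1) \<longleftrightarrow> \<sigma> x = \<sigma> y) \<and>
        ((xs ! (\<sigma> x - 1), xs ! (\<sigma> y - 1)) \<in> r \<longleftrightarrow> (\<sigma> x, \<sigma> y) \<in> indexed_poset.rel (length xs) L)"
      using nth_pred_eq_iff[OF assms(1)] L[of "\<sigma> x" "\<sigma> y"]
      unfolding indexed_poset.rel_def[OF assms(4)] index_order_def by blast
  qed
  show ?thesis
  proof
    assume "models (set xs) r \<phi>"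
    then obtain \<tau> where \<tau>: "\<forall>x\<in>set (fst \<phi>). \<tau> x \<in> set xs" "sat_matrix r \<tau> (snd \<phi>)"
      using models_iff[OF assms(2)] by blast
    have "\<exists>a. a \<in> {1..length xs} \<and> xs ! (a - 1) = \<tau> x" if "x \<in> set (fst \<phi>)" for x
    proof -
      have "\<tau> x \<in> set xs"
        using \<tau>(1) that by blast
      then obtain i where "i < length xs" "xs ! i = \<tau> x"
        unfolding in_set_conv_nth by blast
      then show ?thesis
        by (intro exI[of _ "Suc i"]) auto
    qed
    then obtain \<sigma> where \<sigma>: "\<forall>x\<in>set (fst \<phi>). \<sigma> x \<in> {1..length xs} \<and> xs ! (\<sigma> x - 1) = \<tau> x"
      by metis
    have "sat_matrix r (\<lambda>x. xs ! (\<sigma> x - 1)) (snd \<phi>) \<longleftrightarrow> sat_matrix r \<tau> (snd \<phi>)"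
    proof (rule sat_matrix_transfer)
      fix x y
      assume "x \<in> matrix_vars (snd \<phi>)" "y \<in> matrix_vars (snd \<phi>)"
      then have "xs ! (\<sigma> x - 1) = \<tau> x" "xs ! (\<sigma> y - 1) = \<tau> y"
        using \<sigma> assms(2) unfolding is_sentence_def by blast+
      then show "(xs ! (\<sigma> x - 1) = xs ! (\<sigma> y - 1) \<longleftrightarrow> \<tau> x = \<tau> y) \<and>
          ((xs ! (\<sigma> x - 1), xs ! (\<sigma> y - 1)) \<in> r \<longleftrightarrow> (\<tau> x, \<tau> y) \<in> r)"
        by (simp only: simp_thms)
    qed
    then show "\<exists>\<sigma>. (\<forall>x\<in>set (fst \<phi>). \<sigma> x \<in> {1..length xs}) \<and>
        sat_matrix (indexed_poset.rel (length xs) L) \<sigma> (snd \<phi>)"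
      using \<sigma> \<tau>(2) transfer[of \<sigma>] by blast
  next
    assume "\<exists>\<sigma>. (\<forall>x\<in>set (fst \<phi>). \<sigma> x \<in> {1..length xs}) \<and>
        sat_matrix (indexed_poset.rel (length xs) L) \<sigma> (snd \<phi>)"
    then obtain \<sigma> where \<sigma>: "\<forall>x\<in>set (fst \<phi>). \<sigma> x \<in> {1..length xs}"
        "sat_matrix (indexed_poset.rel (length xs) L) \<sigma> (snd \<phi>)"
      by blast
    then show "models (set xs) r \<phi>"
      unfolding models_iff[OF assms(2)] using transfer[of \<sigma>] nth_pred_mem
      by (intro exI[of _ "\<lambda>x. xs ! (\<sigma> x - 1)"]) blast
  qed
qed

text \<open>The n ones and the separator exactly absorb the shift of the numbering: (n + 1) + (a -
  1) n + (b - 1) = a n + b.\<close>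

lemma input_at_enc_poset:
  assumes "a \<in> {1..length xs}" "b \<in> {1..length xs}"
  shows "input_at (enc_poset xs r @ u) (a * length xs + b) = of_bool (index_order xs r a b)"
proof -
  let ?n = "length xs"
  obtain a' b' where ab: "a = Suc a'" "b = Suc b'" "a' < ?n" "b' < ?n"
    using assms by (cases a; cases b) auto
  let ?i = "a' * ?n + b'"
  have eq: "a * ?n + b = Suc ?n + ?i"
    by (simp add: ab)
  have "?i < Suc a' * ?n"
    using ab(4) by simp
  also have "\<dots> \<le> ?n * ?n"
    using ab(3) by (intro mult_right_mono) auto
  finally have i: "?i < ?n * ?n" .
  have "?n \<noteq> 0"
    using ab(4) by linarith
  then have "?i div ?n = a'" "?i mod ?n = b'"
    using ab(4) by (simp_all add: div_mult_self3)
  then have "List.product xs xs ! ?i = (xs ! (a - 1), xs ! (b - 1))"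
    using i by (subst product_nth) (auto simp: ab(1,2))
  moreover have "(enc_poset xs r @ u) ! (Suc ?n + ?i) = (List.product xs xs ! ?i \<in> r)"
    using i by (simp add: enc_poset_def nth_append)
  moreover have "Suc ?n + ?i < length (enc_poset xs r @ u)"
    using i by (simp add: enc_poset_def)
  ultimately show ?thesis
    unfolding eq by (simp add: input_at_def index_order_def del: add_Suc)
qed

section \<open>Correctness and running time\<close>

text \<open>\<open>Suc C\<close> is C bits for a variable plus one bit for a matrix node; both kinds
  number at most k, so \<open>rD\<close> times k bits cover every guess.\<close>

definition init_search :: "nat \<Rightarrow> cmd" where
  "init_search C = rC ::= Num C ;; rD ::= Num (Suc C) ;; rcnt ::= Num 1"

definition setup_cmd :: "nat \<Rightarrow> cmd" where
  "setup_cmd C = size_cmd ;; layout_cmd ;; match_cmd ;; starts_cmd ;; init_search C ;; double_loop rk"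

definition main_cmd :: "nat \<Rightarrow> cmd" where
  "main_cmd C = setup_cmd C ;; search_cmd ;; rN ::= V rans"

lemma wf_main_cmd: "wf_cmd (main_cmd C)"
  by (simp add: main_cmd_def setup_cmd_def size_cmd_def layout_cmd_def row_step_def match_cmd_def
      match_scan_def match_row_def match_try_def match_augment_def starts_cmd_def start_step_def
      init_search_def double_loop_def search_cmd_def prog_defs Let_def)

lemma mods_size_cmd: "mods size_cmd = {(0, rn)}"
  by (auto simp: size_cmd_def)

lemma mods_layout_cmd: "mods layout_cmd = {(0, racc), (0, ra), (0, rfs), (0, rk)} \<union> {aRow} \<times> UNIV"
  by (auto simp: layout_cmd_def row_step_def)

lemma mods_init_search: "mods (init_search C) = {(0, rC), (0, rD), (0, rcnt)}"
  by (auto simp: init_search_def)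

lemma mods_double_loop: "mods (double_loop i) = {(0, rcnt)}"
  by (auto simp: double_loop_def)

lemmas mods_setup = mods_size_cmd mods_layout_cmd mods_match_cmd mods_starts_cmd mods_init_search
  mods_double_loop

lemma loop_regs_check_cmd: "loop_regs check_cmd = {rN, rC}"
  by (auto simp: prog_defs Let_def)

lemma loop_regs_setup:
  "loop_regs size_cmd = {rN}" "loop_regs layout_cmd = {rn}" "loop_regs match_cmd = {rN, rn}"
  "loop_regs starts_cmd = {rn}" "loop_regs (init_search C) = {}" "loop_regs (double_loop i) = {i, rD}"
  by (auto simp: size_cmd_def layout_cmd_def row_step_def match_cmd_def match_scan_def match_row_def
      match_try_def match_augment_def starts_cmd_def start_step_def init_search_def double_loop_def)

text \<open>\<open>C\<close> is the width bound of the class, not the width of this poset; the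
  program depends on it and on nothing else, so one machine serves all instances.\<close>

locale mc_instance =
  fixes xs :: "'a list" and r :: "('a \<times> 'a) set" and \<phi> :: ex_formula and C :: nat
  assumes dist: "distinct xs" and poset: "finite_poset (set xs) r"
    and width: "poset_width (set xs) r \<le> C" and sentence: "is_sentence \<phi>"
begin

definition w :: "bool list" where
  "w = enc_poset xs r @ enc_formula \<phi>"

definition k :: nat where
  "k = length (enc_formula \<phi>)"

abbreviation n :: nat where
  "n \<equiv> length xs"

definition "s1 = sem w size_cmd (init_state w)"
definition "s2 = sem w layout_cmd s1"
definition "s3 = sem w match_cmd s2"
definition "s4 = sem w starts_cmd s3"
definition "s5 = sem w (init_search C) s4"
definition "s6 = sem w (double_loop rk) s5"

lemma s6_eq: "sem w (setup_cmd C) (init_state w) = s6"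
  by (simp add: setup_cmd_def s1_def s2_def s3_def s4_def s5_def s6_def)

lemma length_w: "length w = n * n + n + 1 + k"
  by (simp add: w_def enc_poset_def k_def)

lemma s1_rn: "s1 (0, rn) = n"
  unfolding s1_def
  by (rule sem_size_cmd[of w n "map (\<lambda>e. e \<in> r) (List.product xs xs) @ enc_formula \<phi>"])
    (simp_all add: w_def enc_poset_def init_state_def)

lemma s1_simps: "s1 (0, rN) = length w" "i \<noteq> rN \<Longrightarrow> i \<noteq> rn \<Longrightarrow> s1 (0, i) = 0" "a \<noteq> 0 \<Longrightarrow> s1 (a, i) = 0"
  by (simp_all add: s1_def sem_frame mods_size_cmd init_state_def)

lemma s2_simps: "i \<le> n \<Longrightarrow> s2 (aRow, i) = i * n" "s2 (0, rfs) = n * n + n + 1" "s2 (0, rk) = k"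
  using sem_layout_cmd[where s = s1 and w = w] s1_simps s1_rn length_w by (simp_all add: s2_def)

lemma s2_regs: "s2 (0, rN) = length w" "s2 (0, rn) = n"
  by (simp_all add: s2_def sem_frame mods_layout_cmd s1_simps s1_rn)

definition "L = order_of w s2"

lemma L_iff: "a \<in> {1..n} \<Longrightarrow> b \<in> {1..n} \<Longrightarrow> L a b = index_order xs r a b"
  using input_at_enc_poset[of a xs b r "enc_formula \<phi>"]
  by (simp add: L_def order_of_def s2_simps flip: w_def)

sublocale indexed_poset n L
  using indexed_poset_of_list[OF dist poset] L_iff .

lemma card_antichain_le:
  assumes "S \<subseteq> {1..n}" "\<And>x y. x \<in> S \<Longrightarrow> y \<in> S \<Longrightarrow> \<not> lt x y"
  shows "card S \<le> C"
proof -
  let ?f = "\<lambda>a. xs ! (a - 1)"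
  have "inj_on ?f S"
    using assms(1) nth_pred_eq_iff[OF dist] by (intro inj_onI) blast
  then have "card S = card (?f ` S)"
    by (simp add: card_image)
  also have "antichain (set xs) r (?f ` S)"
    unfolding antichain_def
  proof (intro conjI ballI impI)
    show "?f ` S \<subseteq> set xs"
      using assms(1) nth_pred_mem by blast
    fix x y assume "x \<in> ?f ` S" "y \<in> ?f ` S" "x \<noteq> y"
    then obtain a b where ab: "a \<in> S" "b \<in> S" "x = ?f a" "y = ?f b" "a \<noteq> b"
      by blast
    have "a \<in> {1..n}" "b \<in> {1..n}"
      using ab assms(1) by blast+
    then show "(x, y) \<notin> r"
      using assms(2)[OF ab(1,2)] ab(3-5) L_iff unfolding lt_def index_order_def by blast
  qed
  then have "card (?f ` S) \<le> poset_width (set xs) r"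
    by (rule card_antichain_le_poset_width[rotated]) simp
  finally show ?thesis
    using width by simp
qed

lemma s2_arrays: "s2 (aNx, i) = 0" "s2 (aPv, i) = 0" "s2 (aLab, i) = 0"
  by (simp_all add: s2_def sem_frame mods_layout_cmd s1_simps)

lemma s3_inv: "chain_inv (next_of s3) (prev_of s3) (label_of s3)" "matched s3"
  unfolding s3_def using length_w
  by (intro sem_match_cmd; simp add: s2_arrays s2_regs L_def)+

lemma s4_starts:
  shows "s4 (aSt, j) \<noteq> 0 \<Longrightarrow> s4 (aSt, j) \<in> {1..n}"
    and "a \<in> {1..n} \<Longrightarrow> prev_of s3 a = 0 \<Longrightarrow> \<exists>j\<le>C. s4 (aSt, j) = a"
proof -
  have z: "s3 (0, rj) = 0" "s3 (aSt, j) = 0" "s3 (0, rn) = n" for j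
    by (simp_all add: s3_def s2_def sem_frame mods_setup s1_simps s1_rn)
  note st = sem_starts_cmd[of s3, OF z(1,2), where w = w, folded s4_def, unfolded z(3)]
  show "s4 (aSt, j) \<noteq> 0 \<Longrightarrow> s4 (aSt, j) \<in> {1..n}"
    using st(1)[of j] by blast
  have "card {a \<in> {1..n}. prev_of s3 a = 0} \<le> C"
    using s3_inv(2) unfolding matched_def
    by (intro card_chain_starts_le[OF s3_inv(1)] card_antichain_le) auto
  then show "\<exists>j\<le>C. s4 (aSt, j) = a" if "a \<in> {1..n}" "prev_of s3 a = 0"
    using st(2)[of a] that by (auto intro: less_imp_le le_trans)
qed

lemma s6_simps:
  "order_of w s6 = L" "next_of s6 = next_of s3" "s6 (aSt, j) = s4 (aSt, j)" "s6 (0, rC) = C"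
  "s6 (0, rN) = length w" "s6 (0, rfs) = n * n + n + 1" "s6 (0, rans) = 0" "s6 (0, rg) = 0"
  by (simp_all add: order_of_def next_of_def L_def s6_def s5_def s4_def s3_def sem_frame mods_setup s2_regs s2_simps)
    (simp_all add: init_search_def s2_def sem_frame mods_setup s1_simps)

lemma s6_rcnt: "s6 (0, rcnt) = 2 ^ (Suc C * k)"
proof -
  have "s5 (0, rk) = k" "s5 (0, rD) = Suc C" "s5 (0, rcnt) = 1"
    by (simp_all add: s5_def init_search_def s4_def s3_def sem_frame mods_setup s2_simps)
  then show ?thesis
    using sem_double_loop[of rk s5 w] by (simp add: s6_def)
qed

lemma guess_length_le: "C * length (fst \<phi>) + nodes (snd \<phi>) \<le> Suc C * k"
  and prefix_length_less: "length (fst \<phi>) < length w"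
proof -
  have k: "length (fst \<phi>) \<le> k" "nodes (snd \<phi>) \<le> k"
    using length_le_length_enc_vars[of "fst \<phi>"] nodes_le_length[of "snd \<phi>"]
    by (simp_all add: k_def enc_formula_alt)
  have "C * length (fst \<phi>) \<le> C * k"
    using k(1) by (rule mult_le_mono2)
  then show "C * length (fst \<phi>) + nodes (snd \<phi>) \<le> Suc C * k"
    using k(2) unfolding mult_Suc by linarith
  show "length (fst \<phi>) < length w"
    using k(1) by (simp add: length_w)
qed

lemma sem_main_cmd: "sem w (main_cmd C) (init_state w) (0, 0) = of_bool (models (set xs) r \<phi>)"
proof -
  note D = chain_invD[OF s3_inv(1)]
  let ?nx = "next_of s3" and ?st = "\<lambda>j. s4 (aSt, j)"
  have nx0: "?nx 0 = 0"
    using D(1)[of 0] lt_nonzero by blast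
  have reach: "\<exists>j\<le>C. \<exists>i. ?st j \<noteq> 0 \<and> (?nx ^^ i) (?st j) = a" if a: "a \<in> {1..n}" for a
  proof -
    obtain s i where s: "s \<in> {1..n}" "prev_of s3 s = 0" "(?nx ^^ i) s = a"
      using ex_chain_start[OF s3_inv(1) a] by blast
    obtain j where "j \<le> C" "?st j = s"
      using s4_starts(2)[OF s(1,2)] by blast
    then show ?thesis
      using s by (intro exI[of _ j]) auto
  qed
  have models: "models (set xs) r \<phi> \<longleftrightarrow> (\<exists>\<sigma>. (\<forall>x\<in>set (fst \<phi>). \<sigma> x \<in> {1..n}) \<and> sat_matrix rel \<sigma> (snd \<phi>))"
    by (rule models_indexed[OF dist sentence L_iff indexed_poset_axioms])
  have pos: "0 < length w * length w"
    by (simp add: length_w)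
  have "n \<le> length w"
    by (simp add: length_w)
  then have "length (fst \<phi>) * n \<le> length (fst \<phi>) * length w"
    by (rule mult_le_mono2)
  also have "\<dots> < length w * length w"
    using prefix_length_less by (intro mult_strict_right_mono) auto
  finally have passes: "length (fst \<phi>) * n < length w * length w" .
  have "drop (s6 (0, rfs)) w = enc_formula \<phi>"
    by (simp add: s6_simps w_def enc_poset_def)
  note search = sem_search_cmd[OF this s6_simps(5,7,8), unfolded s6_simps(1-4) s6_rcnt]
  have "sem w search_cmd s6 (0, rans) = of_bool (models (set xs) r \<phi>)"
  proof (rule search)
    fix g v c
    assume "accepts L ?nx ?st C (length w * length w) \<phi> g v c"
    then show "models (set xs) r \<phi>"
      unfolding models by (rule accepts_sound[where nx = ?nx, OF _ _ sentence pos, rotated 2])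
        (fact D(1) s4_starts(1))+
  next
    assume "models (set xs) r \<phi>"
    then obtain \<sigma> where "\<forall>x\<in>set (fst \<phi>). \<sigma> x \<in> {1..n}" "sat_matrix rel \<sigma> (snd \<phi>)"
      unfolding models by blast
    from accepts_complete[OF D(1) nx0 reach sentence passes this]
    obtain g where "g < 2 ^ (C * length (fst \<phi>) + nodes (snd \<phi>))"
      "\<forall>v c. accepts L ?nx ?st C (length w * length w) \<phi> g v c"
      by blast
    moreover have "(2::nat) ^ (C * length (fst \<phi>) + nodes (snd \<phi>)) \<le> 2 ^ (Suc C * k)"
      using guess_length_le by (intro power_increasing) auto
    ultimately show "\<exists>g<2 ^ (Suc C * k). \<forall>v c. accepts L ?nx ?st C (length w * length w) \<phi> g v c"
      by (meson less_le_trans)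
  qed
  then show ?thesis
    by (simp add: main_cmd_def s6_eq)
qed

text \<open>The static bound is evaluated at |w| + C + 1, which dominates all counters but
  \<open>rcnt\<close>, including \<open>rC\<close> and \<open>rD\<close>. The constant 6 is the
  overhead of the search loop, 2 in total and 4 per round.\<close>

definition cost_bound :: "nat poly" where
  "cost_bound = pcompose
     (cost_poly size_cmd + cost_poly layout_cmd + cost_poly match_cmd + cost_poly starts_cmd +
      cost_poly (init_search C) + cost_poly (double_loop rk) + cost_poly check_cmd +
      cost_poly (rN ::= V rans) + [:6:]) [:Suc C, 1:]"

lemma cost_main_cmd: "cost w (main_cmd C) (init_state w) \<le> 2 ^ (Suc C * k) * poly cost_bound (length w)"
proof -
  define B where "B = Suc C + length w"
  have B: "length w \<le> B" "n \<le> B" "k \<le> B" "Suc C \<le> B"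
    by (simp_all add: B_def length_w)
  have fr: "s3 (0, rn) = n" "s5 (0, rk) = k" "s5 (0, rD) = Suc C"
    by (simp_all add: s5_def init_search_def s4_def s3_def sem_frame mods_setup s2_simps s2_regs)
  have init: "cost w size_cmd (init_state w) \<le> poly (cost_poly size_cmd) B"
    "cost w layout_cmd s1 \<le> poly (cost_poly layout_cmd) B"
    "cost w match_cmd s2 \<le> poly (cost_poly match_cmd) B"
    "cost w starts_cmd s3 \<le> poly (cost_poly starts_cmd) B"
    "cost w (init_search C) s4 \<le> poly (cost_poly (init_search C)) B"
    "cost w (double_loop rk) s5 \<le> poly (cost_poly (double_loop rk)) B"
    using B by (intro cost_le_cost_poly;
      auto simp: loop_regs_setup mods_setup init_state_def s1_rn s2_regs fr)+
  \<comment> \<open>The counter of the search loop is exponential, so this loop is summed by hand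
    and only a single guess is bounded polynomially.\<close>
  have "cost w check_cmd ((sem w check_cmd ^^ j) s6) \<le> poly (cost_poly check_cmd) B" for j
    using B by (intro cost_le_cost_poly)
      (auto simp: loop_regs_check_cmd funpow_sem_frame mods_check_cmd mods_node_cmd s6_simps)
  then have "(\<Sum>j<2 ^ (Suc C * k). cost w check_cmd ((sem w check_cmd ^^ j) s6) + 4) \<le>
      2 ^ (Suc C * k) * (poly (cost_poly check_cmd) B + 4)"
    using sum_bounded_above[of "{..<2 ^ (Suc C * k)}" "\<lambda>j. cost w check_cmd ((sem w check_cmd ^^ j) s6) + 4"
        "poly (cost_poly check_cmd) B + 4"] by simp
  then have search: "cost w search_cmd s6 \<le> 2 + 2 ^ (Suc C * k) * (poly (cost_poly check_cmd) B + 4)"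
    by (simp only: search_cmd_def cost.simps s6_rcnt add_le_cancel_left)
  define X where "X = poly (cost_poly size_cmd) B + poly (cost_poly layout_cmd) B +
    poly (cost_poly match_cmd) B + poly (cost_poly starts_cmd) B + poly (cost_poly (init_search C)) B +
    poly (cost_poly (double_loop rk)) B + poly (cost_poly (rN ::= V rans)) B + 2"
  define E :: nat where "E = 2 ^ (Suc C * k)"
  have "cost w (main_cmd C) (init_state w) =
      cost w size_cmd (init_state w) + cost w layout_cmd s1 + cost w match_cmd s2 + cost w starts_cmd s3 +
      cost w (init_search C) s4 + cost w (double_loop rk) s5 + cost w search_cmd s6 + cost w (rN ::= V rans) s6"
    unfolding main_cmd_def cost.simps s6_eq
    by (simp add: setup_cmd_def s1_def s2_def s3_def s4_def s5_def s6_def)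
  also have "\<dots> \<le> X + E * (poly (cost_poly check_cmd) B + 4)"
    using init search unfolding X_def E_def by simp
  \<comment> \<open>\<open>E\<close> is at least 1, so the cost of the setup can be multiplied by
    it.\<close>
  also have "\<dots> \<le> E * X + E * (poly (cost_poly check_cmd) B + 4)"
    by (simp add: E_def)
  also have "\<dots> = E * poly cost_bound (length w)"
    by (simp add: X_def cost_bound_def poly_pcompose B_def algebra_simps)
  finally show ?thesis
    by (simp add: E_def)
qed

lemma outputs_within_main_cmd:
  "outputs_within (cmd_code (main_cmd C) 0 0) w (2 ^ (Suc C * k) * poly cost_bound (length w))
     (of_bool (models (set xs) r \<phi>))"
  using outputs_within_cmd[OF wf_main_cmd cost_main_cmd] by (simp only: sem_main_cmd)

end

text \<open>For an argument in unary, the initial content of \<open>rN\<close> is the argument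
  itself.\<close>

lemma computable_exp: "computable (\<lambda>k. 2 ^ (c * k))"
proof -
  define p where "p = rD ::= Num c ;; rcnt ::= Num 1 ;; double_loop rN ;; rN ::= V rcnt"
  have "wf_cmd p"
    by (simp add: p_def double_loop_def)
  moreover have "sem w p (init_state w) (0, 0) = 2 ^ (c * length w)" for w
    using sem_double_loop[of rN "sem w (rD ::= Num c ;; rcnt ::= Num 1) (init_state w)" w]
    by (simp add: p_def init_state_def)
  ultimately have "outputs_within (cmd_code p 0 0) (replicate k True)
      (cost (replicate k True) p (init_state (replicate k True))) (2 ^ (c * k))" for k
    using outputs_within_cmd[of p "replicate k True"] by (metis length_replicate order_refl)
  then show ?thesis
    unfolding computable_def by blast
qed

theorem theorem5:
  fixes C :: "('a set \<times> ('a \<times> 'a) set) set"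
  assumes "\<And>A r. (A, r) \<in> C \<Longrightarrow> finite_poset A r"
    and "bounded_width C"
  shows "fpt_single_exponential (MC C)"
proof -
  obtain c where c: "\<And>A r. (A, r) \<in> C \<Longrightarrow> poset_width A r \<le> c"
    using assms(2) by (auto simp: bounded_width_def)
  let ?f = "\<lambda>k. 2 ^ (Suc c * k) :: nat"
  have "single_exponential ?f"
    unfolding single_exponential_def by (intro exI[of _ "Suc c"]) simp
  moreover have "decidable_in_time (MC C) ?f (mc_instance.cost_bound c)"
    unfolding decidable_in_time_def
  \<comment> \<open>The machine is chosen from the width bound \<open>c\<close> alone, before the
    instance is fixed.\<close>
  proof (intro exI[of _ "cmd_code (main_cmd c) 0 0"] ballI)
    fix i
    assume "i \<in> instances (MC C)"
    then obtain xs r \<phi> where i: "i = (xs, r, \<phi>)" "distinct xs" "(set xs, r) \<in> C" "is_sentence \<phi>"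
      by (auto simp: MC_def)
    interpret mc_instance xs r \<phi> c
      using i assms(1) c by unfold_locales auto
    show "outputs_within (cmd_code (main_cmd c) 0 0) (encoding (MC C) i)
        (?f (parameter (MC C) i) * poly cost_bound (length (encoding (MC C) i)))
        (of_bool (yes_instance (MC C) i))"
      using outputs_within_main_cmd by (simp add: MC_def i(1) w_def k_def)
  qed
  ultimately show ?thesis
    unfolding fpt_single_exponential_def using computable_exp by blast
qed

end
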